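(* Let $E$ be a complete lattice effect algebra. Then: (1) The set $\mathcal O_b(E)$ of bounded observables on $E$, ordered by the Olson order $\preceq_s$, is a Dedekind complete lattice. (2) The set $\mathcal{EO}(E)$ of observables on $E$ whose spectra are contained in $[0,1]$, ordered by $\preceq_s$, is a complete lattice, and $q_0$ and $q_1$ are its bottom and top elements, respectively.
   Context: An effect algebra is a partial algebra $(E;+,0,1)$ with a partially defined binary operation $+$ such that for all $a,b,c\in E$: (i) $a+b$ is defined iff $b+a$ is, and then $a+b=b+a$; (ii) $a+b$ and $(a+b)+c$ are defined iff $b+c$ and $a+(b+c)$ are defined, and then $(a+b)+c=a+(b+c)$; (iii) for each $a$ there is a unique $a'\in E$ with $a+a'=1$; (iv) if $a+1$ is defined, then $a=0$. The partial order is $a\le b$ iff $a+c=b$ for some $c\in E$. $E$ is a complete lattice effect algebra if $(E,\le)$ is a complete lattice. Let $\mathcal B(\mathbb R)$ be the Borel $\sigma$-algebra of $\mathbb R$. An observable on $E$ is a map $x:\mathcal B(\mathbb R)\to E$ such that (i) $x(\mathbb R)=1$; (ii) if $B\cap C=\emptyset$, then $x(B)+x(C)$ is defined and $x(B\cup C)=x(B)+x(C)$; (iii) if $B_i\subseteq B_{i+1}$ for all $i$ and $B=\bigcup_i B_i$, then $x(B)=\bigvee_i x(B_i)$. An observable $x$ is bounded if $x(C)=1$ for some compact $C\subseteq\mathbb R$. The spectrum $\sigma(x)$ is the least closed set $K\subseteq\mathbb R$ with $x(K)=1$. The Olson order on observables is: $x\preceq_s y$ iff $y((-\infty,t))\le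 x((-\infty,t))$ for every $t\in\mathbb R$. For $a\in E$, the question observable $q_a$ is the observable with $q_a(\{0\})=a'$, $q_a(\{1\})=a$; i.e. $q_a(B)$ is $1$, $a$, $a'$ or $0$ according as $B$ contains both $0$ and $1$, only $1$, only $0$, or neither. A Dedekind complete lattice is a lattice in which every nonempty family bounded from below has an infimum and every nonempty family bounded from above has a supremum. *)

theory Defs
  imports "HOL-Analysis.Analysis" "HOL-Algebra.Complete_Lattice"
begin

text \<open>
  The partial sum is option-valued: \<open>psum a b = None\<close> means that $a + b$ is undefined. An equation
  between options thus says that both sides are defined simultaneously and then agree, which is
  how commutativity and associativity of a partial operation are to be read. The carrier of the
  effect algebra is the whole type.
\<close>

locale effect_algebra =
  fixes psum :: "'a \<Rightarrow> 'a \<Rightarrow> 'a option" and zero :: 'a and one :: 'a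
  assumes psum_commute: "psum a b = psum b a"
    and psum_assoc: "Option.bind (psum a b) (\<lambda>s. psum s c) = Option.bind (psum b c) (\<lambda>s. psum a s)"
    and ex1_orthosupplement: "\<exists>!b. psum a b = Some one"
    and psum_one_defined: "psum a one \<noteq> None \<Longrightarrow> a = zero"
begin

definition orthosupplement :: "'a \<Rightarrow> 'a" where
  "orthosupplement a = (THE b. psum a b = Some one)"

definition ea_le :: "'a \<Rightarrow> 'a \<Rightarrow> bool" where
  "ea_le a b \<longleftrightarrow> (\<exists>c. psum a c = Some b)"

definition ea_order :: "'a gorder" where
  "ea_order = \<lparr>carrier = UNIV, eq = (=), le = ea_le\<rparr>"

text \<open>
  An observable is a function on Borel sets only. It is represented by a total function that is
  \<open>undefined\<close> outside the Borel sets, so that equality of observables is equality in HOL.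
\<close>

definition observable :: "(real set \<Rightarrow> 'a) \<Rightarrow> bool" where
  "observable x \<longleftrightarrow>
     x \<in> extensional (sets borel) \<and>
     x UNIV = one \<and>
     (\<forall>B\<in>sets borel. \<forall>C\<in>sets borel. B \<inter> C = {} \<longrightarrow> psum (x B) (x C) = Some (x (B \<union> C))) \<and>
     (\<forall>B :: nat \<Rightarrow> real set. (\<forall>i. B i \<in> sets borel) \<and> (\<forall>i. B i \<subseteq> B (Suc i)) \<longrightarrow>
        is_lub ea_order (x (\<Union>i. B i)) (range (\<lambda>i. x (B i))))"

definition bounded_observable :: "(real set \<Rightarrow> 'a) \<Rightarrow> bool" where
  "bounded_observable x \<longleftrightarrow> observable x \<and> (\<exists>C. compact C \<and> x C = one)"

definition spectrum :: "(real set \<Rightarrow> 'a) \<Rightarrow> real set" where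
  "spectrum x = (LEAST K. closed K \<and> x K = one)"

definition olson_le :: "(real set \<Rightarrow> 'a) \<Rightarrow> (real set \<Rightarrow> 'a) \<Rightarrow> bool" where
  "olson_le x y \<longleftrightarrow> (\<forall>t. ea_le (y {..<t}) (x {..<t}))"

definition question_observable :: "'a \<Rightarrow> real set \<Rightarrow> 'a" where
  "question_observable a = (\<lambda>B\<in>sets borel.
     if 0 \<in> B \<and> 1 \<in> B then one
     else if 1 \<in> B then a
     else if 0 \<in> B then orthosupplement a
     else zero)"

definition bounded_observables :: "(real set \<Rightarrow> 'a) gorder" where
  "bounded_observables = \<lparr>carrier = {x. bounded_observable x}, eq = (=), le = olson_le\<rparr>"

definition unit_interval_observables :: "(real set \<Rightarrow> 'a) gorder" where
  "unit_interval_observables =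
     \<lparr>carrier = {x. observable x \<and> spectrum x \<subseteq> {0..1}}, eq = (=), le = olson_le\<rparr>"

end

locale complete_lattice_effect_algebra = effect_algebra +
  assumes complete_lattice_ea_order: "Complete_Lattice.complete_lattice ea_order"

text \<open>
  \<^const>\<open>Lower\<close> and \<^const>\<open>Upper\<close> are taken within the carrier, so boundedness and the bounds below refer
  to the ordered set itself.
\<close>

locale dedekind_complete_lattice = Lattice.lattice L for L (structure) +
  assumes bounded_inf_exists:
      "\<lbrakk>A \<subseteq> carrier L; A \<noteq> {}; Lower L A \<noteq> {}\<rbrakk> \<Longrightarrow> \<exists>i. is_glb L i A"
    and bounded_sup_exists:
      "\<lbrakk>A \<subseteq> carrier L; A \<noteq> {}; Upper L A \<noteq> {}\<rbrakk> \<Longrightarrow> \<exists>s. is_lub L s A"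

end

theory Submission
  imports Defs "HOL-Probability.Distribution_Functions"
begin

text \<open>
  An observable \<open>x\<close> is determined by its distribution function \<open>F t = x {..<t}\<close>, because the rays
  \<open>{..<t}\<close> generate the Borel sets and are closed under intersection, and the Olson order is the
  reversed pointwise order of distribution functions. Distribution functions of bounded observables
  are monotone, left continuous, \<open>zero\<close> far to the left and \<open>one\<close> far to the right. Such functions
  are closed under suitably bounded suprema and infima: a pointwise supremum of them is again left
  continuous, and a pointwise infimum becomes so after passing to suprema over \<open>s < t\<close>. Hence both
  completeness statements follow once every such function is known to be the distribution function
  of an observable; this is \<open>ex_observable_with_distribution\<close>, the heart of the proof. The second
  ordered set is the interval between the point masses at 0 and 1, which are the question
  observables of \<open>zero\<close> and \<open>one\<close>.

  To extend \<open>F\<close> to the Borel sets, note that its values form a chain, so they lie in a block: a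
  maximal set of pairwise compatible elements. A block is closed under all operations and behaves
  like a complete MV-algebra. An outer measure with values in the block would need distributive laws
  for infinite suprema and infima that may fail, so the extension goes through real numbers
  instead. Let \<open>U\<close> be an ultrafilter of sharp elements of the block. Every element \<open>a\<close> of the
  block has a value \<open>omega U a\<close> in the unit interval, whose binary digits record whether the
  iterates of \<open>a\<close> under doubling modulo one lie above or below their orthosupplements on some
  member of \<open>U\<close>. This value is additive (\<open>omega_sum\<close>), so \<open>omega U \<circ> F\<close> is monotone and
  gives rise to a probability measure \<open>P\<close> on the real line.

  The value of the observable at a Borel set \<open>B\<close> is the element \<open>a\<close> such that \<open>omega U a\<close> is the
  \<open>P\<close>-measure of \<open>B\<close>. This cannot be required for every \<open>U\<close>, since \<open>omega U\<close> need not preserve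
  suprema of sequences. It is required for all \<open>U\<close> that preserve the suprema of the sequences in
  some countable set, which may depend on \<open>B\<close>. A Rasiowa-Sikorski argument
  (\<open>ex_sup_preserving_omega_less\<close>) shows that countably many suprema can be preserved while
  \<open>omega U c < omega U a\<close>, whenever \<open>a\<close> is not below \<open>c\<close>. Therefore inequalities between measures
  carry over to the block, \<open>a\<close> is unique, and it exists for all Borel sets by induction.
\<close>

(* The superscript is used below for the orthosupplement. *)
no_notation orthogonal_comp (\<open>(\<open>open_block notation=\<open>postfix \<bottom>\<close>\<close>_\<^sup>\<bottom>)\<close> [80] 80)

section \<open>Effect algebras as partially ordered sets\<close>

context effect_algebra
begin

text \<open>
  The sum is made total with an arbitrary value outside its domain; definedness is recorded
  separately by \<open>orth\<close>.
\<close>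

definition sum_of :: "'a \<Rightarrow> 'a \<Rightarrow> 'a" (infixl "\<uplus>" 65) where
  "a \<uplus> b = the (psum a b)"

definition orth :: "'a \<Rightarrow> 'a \<Rightarrow> bool" (infix "\<bowtie>" 50) where
  "a \<bowtie> b \<longleftrightarrow> psum a b \<noteq> None"

notation ea_le (infix "\<preceq>" 50)
notation orthosupplement ("(_\<^sup>\<bottom>)" [1000] 1000)

lemma psum_eq_Some_iff: "psum a b = Some c \<longleftrightarrow> a \<bowtie> b \<and> a \<uplus> b = c"
  by (auto simp: orth_def sum_of_def)

lemma orth_commute: "a \<bowtie> b \<longleftrightarrow> b \<bowtie> a"
  by (simp add: orth_def psum_commute)

lemma sum_of_commute: "a \<uplus> b = b \<uplus> a"
  by (simp add: sum_of_def psum_commute)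

lemma sum_of_assoc:
  assumes "a \<bowtie> b" "a \<uplus> b \<bowtie> c"
  shows "b \<bowtie> c" "a \<bowtie> b \<uplus> c" "(a \<uplus> b) \<uplus> c = a \<uplus> (b \<uplus> c)"
proof -
  obtain s t where "psum a b = Some s" "psum s c = Some t"
    using assms by (auto simp: orth_def sum_of_def)
  moreover then obtain r where "psum b c = Some r" "psum a r = Some t"
    using psum_assoc[of a b c] by (auto simp: bind_eq_Some_conv eq_commute[of "Some t"])
  ultimately show "b \<bowtie> c" "a \<bowtie> b \<uplus> c" "(a \<uplus> b) \<uplus> c = a \<uplus> (b \<uplus> c)"
    by (auto simp: orth_def sum_of_def)
qed

lemma sum_of_assoc':
  assumes "b \<bowtie> c" "a \<bowtie> b \<uplus> c"
  shows "a \<bowtie> b" "a \<uplus> b \<bowtie> c" "a \<uplus> (b \<uplus> c) = (a \<uplus> b) \<uplus> c"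
proof -
  obtain s t where "psum b c = Some s" "psum a s = Some t"
    using assms by (auto simp: orth_def sum_of_def)
  moreover then obtain r where "psum a b = Some r" "psum r c = Some t"
    using psum_assoc[of a b c] by (auto simp: bind_eq_Some_conv eq_commute[of "Some t"])
  ultimately show "a \<bowtie> b" "a \<uplus> b \<bowtie> c" "a \<uplus> (b \<uplus> c) = (a \<uplus> b) \<uplus> c"
    by (auto simp: orth_def sum_of_def)
qed

lemma orthosupplement_iff: "b = a\<^sup>\<bottom> \<longleftrightarrow> a \<bowtie> b \<and> a \<uplus> b = one"
  using theI'[OF ex1_orthosupplement[of a]] ex1_orthosupplement[of a]
  unfolding orthosupplement_def psum_eq_Some_iff by blast

lemma orth_compl [simp]: "a \<bowtie> a\<^sup>\<bottom>" "a\<^sup>\<bottom> \<bowtie> a"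
  and sum_compl [simp]: "a \<uplus> a\<^sup>\<bottom> = one" "a\<^sup>\<bottom> \<uplus> a = one"
  using orthosupplement_iff[of "a\<^sup>\<bottom>" a] by (auto simp: orth_commute sum_of_commute)

lemma compl_compl [simp]: "a\<^sup>\<bottom>\<^sup>\<bottom> = a"
  by (metis orthosupplement_iff orth_compl(2) sum_compl(2))

lemma orth_one: "a \<bowtie> one \<Longrightarrow> a = zero"
  using psum_one_defined by (simp add: orth_def)

lemma compl_one [simp]: "one\<^sup>\<bottom> = zero"
  using orth_one orth_compl(2) by blast

lemma compl_zero [simp]: "zero\<^sup>\<bottom> = one"
  using compl_one compl_compl by metis

lemma orth_zero [simp]: "a \<bowtie> zero" "zero \<bowtie> a"
  and sum_zero [simp]: "a \<uplus> zero = a" "zero \<uplus> a = a"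
proof -
  have 1: "a\<^sup>\<bottom> \<uplus> a \<bowtie> zero" "(a\<^sup>\<bottom> \<uplus> a) \<uplus> zero = one"
    using orth_compl(1)[of one] sum_compl(1)[of one] by auto
  show "a \<bowtie> zero"
    using sum_of_assoc[OF orth_compl(2) 1(1)] by auto
  then show "zero \<bowtie> a" by (simp add: orth_commute)
  have "a \<uplus> zero = a\<^sup>\<bottom>\<^sup>\<bottom>"
    unfolding orthosupplement_iff[of "a \<uplus> zero"]
    using sum_of_assoc[OF orth_compl(2) 1(1)] 1(2) by auto
  then show "a \<uplus> zero = a" "zero \<uplus> a = a"
    by (simp_all add: sum_of_commute)
qed

text \<open>
  With \<open>d\<close> the orthosupplement of the common sum, \<open>b\<close> and \<open>c\<close> are both the unique
  orthosupplement of \<open>d \<uplus> a\<close>.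
\<close>

lemma sum_cancel:
  assumes "a \<bowtie> b" "a \<bowtie> c" "a \<uplus> b = a \<uplus> c"
  shows "b = c"
proof -
  define d where "d = (a \<uplus> b)\<^sup>\<bottom>"
  have "d \<bowtie> a \<uplus> b" "d \<uplus> (a \<uplus> b) = one" "d \<bowtie> a \<uplus> c" "d \<uplus> (a \<uplus> c) = one"
    using orth_compl(2) sum_compl(2) assms(3) unfolding d_def by metis+
  then have "b = (d \<uplus> a)\<^sup>\<bottom>" "c = (d \<uplus> a)\<^sup>\<bottom>"
    unfolding orthosupplement_iff using sum_of_assoc' assms by metis+
  then show ?thesis by simp
qed

lemma sum_eq_zero: assumes "a \<bowtie> b" "a \<uplus> b = zero" shows "a = zero" "b = zero"
proof -
  have "b \<bowtie> one" 
    using sum_of_assoc(1)[OF assms(1), of one] assms(2) by simp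
  then show "b = zero" by (rule orth_one)
  then show "a = zero" using assms by simp
qed

lemma le_iff_sum: "a \<preceq> b \<longleftrightarrow> (\<exists>c. a \<bowtie> c \<and> a \<uplus> c = b)"
  by (simp add: ea_le_def psum_eq_Some_iff)

lemma le_sum: "a \<bowtie> b \<Longrightarrow> a \<preceq> a \<uplus> b" "a \<bowtie> b \<Longrightarrow> b \<preceq> a \<uplus> b"
  unfolding le_iff_sum by (metis orth_commute sum_of_commute)+

lemma le_refl [simp]: "a \<preceq> a"
  unfolding le_iff_sum by (metis orth_zero(1) sum_zero(1))

lemma le_trans: "a \<preceq> b \<Longrightarrow> b \<preceq> c \<Longrightarrow> a \<preceq> c"
  unfolding le_iff_sum by (metis sum_of_assoc)

lemma le_antisym: assumes "a \<preceq> b" "b \<preceq> a" shows "a = b"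
proof -
  obtain c d where 1: "a \<bowtie> c" "a \<uplus> c = b" "b \<bowtie> d" "b \<uplus> d = a"
    using assms unfolding le_iff_sum by auto
  then have "c \<bowtie> d" "a \<bowtie> c \<uplus> d" "a \<uplus> (c \<uplus> d) = a \<uplus> zero"
    using sum_of_assoc[of a c d] by auto
  then have "c = zero"
    using sum_cancel orth_zero(1) sum_eq_zero(1) by metis
  then show ?thesis using 1 by simp
qed

lemma zero_le [simp]: "zero \<preceq> a" and le_one [simp]: "a \<preceq> one"
  unfolding le_iff_sum using orth_zero sum_zero orth_compl sum_compl by metis+

lemma le_zero [simp]: "a \<preceq> zero \<longleftrightarrow> a = zero" and one_le [simp]: "one \<preceq> a \<longleftrightarrow> a = one"
  using le_antisym zero_le le_one le_refl by blast+

text \<open>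
  If \<open>a \<uplus> b\<close> is defined, its orthosupplement is what is missing from \<open>a\<close> to \<open>b\<^sup>\<bottom>\<close>. Conversely
  \<open>b\<close> can be added to all of \<open>b\<^sup>\<bottom>\<close>, hence to \<open>a\<close>.
\<close>

lemma orth_iff_le: "a \<bowtie> b \<longleftrightarrow> a \<preceq> b\<^sup>\<bottom>"
proof
  assume "a \<bowtie> b"
  then have "b \<uplus> a \<bowtie> (b \<uplus> a)\<^sup>\<bottom>" "b \<bowtie> a" "(b \<uplus> a) \<uplus> (b \<uplus> a)\<^sup>\<bottom> = one"
    by (simp_all add: orth_commute)
  note 1 = sum_of_assoc[OF this(2,1)] this(3)
  then have "a \<uplus> (b \<uplus> a)\<^sup>\<bottom> = b\<^sup>\<bottom>" unfolding orthosupplement_iff by auto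
  with 1(1) show "a \<preceq> b\<^sup>\<bottom>" unfolding le_iff_sum by blast
next
  assume "a \<preceq> b\<^sup>\<bottom>"
  then obtain c where "a \<bowtie> c" "a \<uplus> c = b\<^sup>\<bottom>" unfolding le_iff_sum by auto
  then show "a \<bowtie> b"
    using sum_of_assoc'(1)[of a c b] by (metis orth_commute orth_compl(1))
qed

lemma compl_mono: "a \<preceq> b \<Longrightarrow> b\<^sup>\<bottom> \<preceq> a\<^sup>\<bottom>"
  using orth_iff_le orth_commute compl_compl by metis

lemma compl_le_iff [simp]: "a\<^sup>\<bottom> \<preceq> b\<^sup>\<bottom> \<longleftrightarrow> b \<preceq> a"
  using compl_mono compl_compl by metis

lemma compl_le_swap: "a\<^sup>\<bottom> \<preceq> b \<longleftrightarrow> b\<^sup>\<bottom> \<preceq> a" "a \<preceq> b\<^sup>\<bottom> \<longleftrightarrow> b \<preceq> a\<^sup>\<bottom>"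
  using compl_le_iff compl_compl by metis+

lemma compl_eq_zero_iff [simp]: "a\<^sup>\<bottom> = zero \<longleftrightarrow> a = one" "a\<^sup>\<bottom> = one \<longleftrightarrow> a = zero"
  using compl_compl compl_zero compl_one by metis+

lemma orth_mono: "a \<bowtie> b \<Longrightarrow> c \<preceq> a \<Longrightarrow> d \<preceq> b \<Longrightarrow> c \<bowtie> d"
  using orth_iff_le compl_le_iff le_trans by metis

text \<open>
  In an ordered group this formula reads \<open>1 - (a + (1 - b))\<close>.
\<close>

definition diff :: "'a \<Rightarrow> 'a \<Rightarrow> 'a"  (infixl "\<setminus>" 65) where
  "b \<setminus> a = (a \<uplus> b\<^sup>\<bottom>)\<^sup>\<bottom>"

lemma sum_diff:
  assumes "a \<bowtie> c"
  shows "(a \<uplus> c) \<setminus> a = c" "(a \<uplus> c) \<setminus> c = a"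
proof -
  have "(a \<uplus> c) \<setminus> a = c" if "a \<bowtie> c" for a c
  proof -
    have "c \<uplus> a \<bowtie> (a \<uplus> c)\<^sup>\<bottom>" "(c \<uplus> a) \<uplus> (a \<uplus> c)\<^sup>\<bottom> = one" "c \<bowtie> a"
      using that by (simp_all add: orth_commute sum_of_commute)
    note 1 = sum_of_assoc[OF this(3,1)] this(2)
    have "a \<uplus> (a \<uplus> c)\<^sup>\<bottom> = c\<^sup>\<bottom>" unfolding orthosupplement_iff using 1 by auto
    then show ?thesis by (simp add: diff_def)
  qed
  then show "(a \<uplus> c) \<setminus> a = c" "(a \<uplus> c) \<setminus> c = a"
    using assms by (metis orth_commute sum_of_commute)+
qed

lemma diff_sum:
  assumes "a \<preceq> b" 
  shows "a \<bowtie> b \<setminus> a" "a \<uplus> (b \<setminus> a) = b" "b \<setminus> a \<bowtie> a" "(b \<setminus> a) \<uplus> a = b" "b \<setminus> a \<preceq> b"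
proof -
  obtain c where 1: "a \<bowtie> c" "a \<uplus> c = b" using assms unfolding le_iff_sum by auto
  then have "b \<setminus> a = c" using sum_diff by auto
  then show "a \<bowtie> b \<setminus> a" "a \<uplus> (b \<setminus> a) = b" "b \<setminus> a \<bowtie> a" "(b \<setminus> a) \<uplus> a = b" "b \<setminus> a \<preceq> b"
    using 1 le_sum(2)[of a c] by (auto simp: orth_commute sum_of_commute)
qed

lemma sum_le_iff:
  assumes "a \<bowtie> c" "a \<bowtie> d"
  shows "a \<uplus> c \<preceq> a \<uplus> d \<longleftrightarrow> c \<preceq> d"
proof
  assume "a \<uplus> c \<preceq> a \<uplus> d"
  then obtain e where e: "a \<uplus> c \<bowtie> e" "(a \<uplus> c) \<uplus> e = a \<uplus> d" unfolding le_iff_sum by auto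
  with sum_of_assoc[OF assms(1) this(1)] have "c \<bowtie> e" "c \<uplus> e = d"
    using assms sum_cancel by auto
  then show "c \<preceq> d" unfolding le_iff_sum by auto
next
  assume "c \<preceq> d"
  then obtain e where "c \<bowtie> e" "c \<uplus> e = d" unfolding le_iff_sum by auto
  with sum_of_assoc'[of c e a] assms show "a \<uplus> c \<preceq> a \<uplus> d"
    by (auto simp: le_iff_sum)
qed

lemma sum_mono:
  assumes "a \<preceq> a'" "c \<preceq> c'" "a' \<bowtie> c'"
  shows "a \<uplus> c \<preceq> a' \<uplus> c'"
proof -
  have "a \<bowtie> c'" "a \<bowtie> c" using assms orth_mono le_refl by blast+
  then have "a \<uplus> c \<preceq> a \<uplus> c'" "c' \<uplus> a \<preceq> c' \<uplus> a'"
    using assms by (auto simp: sum_le_iff orth_commute)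
  then show ?thesis by (metis sum_of_commute le_trans)
qed

lemma le_diff_iff: 
  assumes "c \<preceq> b"
  shows "a \<preceq> b \<setminus> c \<longleftrightarrow> c \<bowtie> a \<and> c \<uplus> a \<preceq> b"
  using sum_le_iff[of c a "b \<setminus> c"] diff_sum[OF assms] orth_mono[of c "b \<setminus> c" c a]  by auto

lemma diff_le_iff:
  assumes "c \<preceq> b" "c \<bowtie> a"
  shows "b \<setminus> c \<preceq> a \<longleftrightarrow> b \<preceq> c \<uplus> a"
  using sum_le_iff[of c "b \<setminus> c" a] diff_sum[OF assms(1)] assms by auto

lemma diff_mono: "c \<preceq> a \<Longrightarrow> a \<preceq> b \<Longrightarrow> a \<setminus> c \<preceq> b \<setminus> c"
  using diff_sum le_diff_iff le_trans by metis

lemma diff_antimono: "a \<preceq> b \<Longrightarrow> b \<preceq> c \<Longrightarrow> c \<setminus> b \<preceq> c \<setminus> a"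
  unfolding diff_def by (simp add: sum_mono orth_iff_le)

lemma diff_zero [simp]: "a \<setminus> zero = a" and diff_self [simp]: "a \<setminus> a = zero"
  and one_diff [simp]: "one \<setminus> a = a\<^sup>\<bottom>"
  by (simp_all add: diff_def)

lemma diff_eq_zero: "a \<preceq> b \<Longrightarrow> b \<setminus> a = zero \<Longrightarrow> a = b"
  using diff_sum(2)[of a b] by simp

lemma le_diff_self_imp_zero:
  assumes "l \<preceq> x" "x \<preceq> x \<setminus> l"
  shows "l = zero"
proof -
  have "x \<setminus> l = x" using diff_sum(5)[OF assms(1)] assms(2) le_antisym by blast
  then have "x \<bowtie> l" "x \<uplus> l = x \<uplus> zero" using diff_sum(3,4)[OF assms(1)] by auto
  then show ?thesis using sum_cancel orth_zero by blast
qed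

text \<open>
  Rearranges a sum of four elements with definedness of all regrouped sums; the partial
  operation admits no unconditional rewriting by associativity and commutativity.
\<close>

lemma sum_sum_swap:
  assumes "a \<bowtie> b" "c \<bowtie> d" "a \<uplus> b \<bowtie> c \<uplus> d"
  shows "a \<bowtie> c" "b \<bowtie> d" "a \<uplus> c \<bowtie> b \<uplus> d" "(a \<uplus> b) \<uplus> (c \<uplus> d) = (a \<uplus> c) \<uplus> (b \<uplus> d)"
proof -
  note 1 = sum_of_assoc[OF assms(1,3)]
  have bcd: "b \<bowtie> c" "b \<uplus> c \<bowtie> d" "b \<uplus> (c \<uplus> d) = (b \<uplus> c) \<uplus> d"
    using sum_of_assoc'[OF assms(2) 1(1)] by auto
  then have cb: "c \<bowtie> b" "c \<uplus> b \<bowtie> d" by (simp_all add: orth_commute sum_of_commute)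
  note 2 = sum_of_assoc[OF this]
  have eq: "b \<uplus> (c \<uplus> d) = c \<uplus> (b \<uplus> d)"
    using bcd(3) 2(3) by (simp add: sum_of_commute)
  note 3 = sum_of_assoc'[OF 2(2) 1(2)[unfolded eq]]
  show "a \<bowtie> c" "b \<bowtie> d" "a \<uplus> c \<bowtie> b \<uplus> d" "(a \<uplus> b) \<uplus> (c \<uplus> d) = (a \<uplus> c) \<uplus> (b \<uplus> d)"
    using 1(3) 2(1) 3 eq by auto
qed

lemma sum_eq_imp_eq:
  assumes "a \<preceq> a'" "c \<preceq> c'" "a' \<bowtie> c'" "a \<uplus> c = a' \<uplus> c'"
  shows "a = a'" "c = c'"
proof -
  have o: "a \<bowtie> c'" "a \<bowtie> c" using assms orth_mono le_refl by blast+
  have "a' \<uplus> c' \<preceq> a \<uplus> c'"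
    unfolding assms(4)[symmetric] using o assms(2) by (simp add: sum_le_iff)
  then have "c' \<uplus> a' \<preceq> c' \<uplus> a" by (simp add: sum_of_commute)
  then show "a = a'" using sum_le_iff[of c' a' a] o assms le_antisym by (simp add: orth_commute)
  then show "c = c'" using sum_cancel o assms by metis
qed

end

section \<open>Compatibility and blocks\<close>

context complete_lattice_effect_algebra
begin

definition ea_Sup :: "'a set \<Rightarrow> 'a" where
  "ea_Sup A = (THE s. (\<forall>a\<in>A. a \<preceq> s) \<and> (\<forall>u. (\<forall>a\<in>A. a \<preceq> u) \<longrightarrow> s \<preceq> u))"

definition ea_Inf :: "'a set \<Rightarrow> 'a" where
  "ea_Inf A = ea_Sup {l. \<forall>a\<in>A. l \<preceq> a}"

definition meet :: "'a \<Rightarrow> 'a \<Rightarrow> 'a" (infixl "\<^bold>\<and>" 70) where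
  "a \<^bold>\<and> b = ea_Inf {a, b}"

definition join :: "'a \<Rightarrow> 'a \<Rightarrow> 'a" (infixl "\<^bold>\<or>" 65) where
  "a \<^bold>\<or> b = ea_Sup {a, b}"

lemma is_lub_ea_order_iff:
  "is_lub ea_order s A \<longleftrightarrow> (\<forall>a\<in>A. a \<preceq> s) \<and> (\<forall>u. (\<forall>a\<in>A. a \<preceq> u) \<longrightarrow> s \<preceq> u)"
  unfolding least_def Upper_def ea_order_def by auto

lemma ea_Sup: "(\<forall>a\<in>A. a \<preceq> ea_Sup A) \<and> (\<forall>u. (\<forall>a\<in>A. a \<preceq> u) \<longrightarrow> ea_Sup A \<preceq> u)"
proof -
  have "\<exists>s. is_lub ea_order s A"
    using Complete_Lattice.complete_lattice.sup_exists[OF complete_lattice_ea_order, of A]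
    by (simp add: ea_order_def)
  then obtain s where s: "\<forall>a\<in>A. a \<preceq> s" "\<And>u. \<forall>a\<in>A. a \<preceq> u \<Longrightarrow> s \<preceq> u"
    unfolding is_lub_ea_order_iff by auto
  have "ea_Sup A = s"
    unfolding ea_Sup_def
  proof (rule the_equality)
    fix r assume "(\<forall>a\<in>A. a \<preceq> r) \<and> (\<forall>u. (\<forall>a\<in>A. a \<preceq> u) \<longrightarrow> r \<preceq> u)"
    then have "r \<preceq> s" "s \<preceq> r" using s by simp_all
    then show "r = s" by (rule le_antisym)
  qed (use s in simp)
  then show ?thesis using s by simp
qed

text \<open>
  Interpreting the type class locale makes the calculus of complete lattices available for
  \<open>\<preceq>\<close>, under the prefix \<open>E\<close>.
\<close>

sublocale E: Complete_Lattices.complete_lattice ea_Inf ea_Sup meet ea_le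
  "\<lambda>a b. a \<preceq> b \<and> a \<noteq> b" join zero one
proof
  have Inf: "ea_Inf A \<preceq> a" if "a \<in> A" for a A
    using ea_Sup[of "{l. \<forall>a\<in>A. l \<preceq> a}"] that unfolding ea_Inf_def by blast
  have Inf': "l \<preceq> ea_Inf A" if "\<And>a. a \<in> A \<Longrightarrow> l \<preceq> a" for l A
    using ea_Sup[of "{l. \<forall>a\<in>A. l \<preceq> a}"] that unfolding ea_Inf_def by blast
  show "ea_Inf A \<preceq> a" if "a \<in> A" for a A by (rule Inf[OF that])
  show "l \<preceq> ea_Inf A" if "\<And>a. a \<in> A \<Longrightarrow> l \<preceq> a" for l A by (rule Inf'[OF that])
  show "meet a b \<preceq> a" "meet a b \<preceq> b" for a b
    unfolding meet_def by (simp_all add: Inf)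
  show "c \<preceq> meet a b" if "c \<preceq> a" "c \<preceq> b" for a b c
    unfolding meet_def using that by (auto intro: Inf')
  show "a \<preceq> join a b" "b \<preceq> join a b" for a b
    unfolding join_def using ea_Sup[of "{a, b}"] by simp_all
  show "join a b \<preceq> c" if "a \<preceq> c" "b \<preceq> c" for a b c
    unfolding join_def using ea_Sup[of "{a, b}"] that by simp
  show "ea_Inf {} = one"
    using Inf'[of "{}" one] by simp
  show "ea_Sup {} = zero"
    using ea_Sup[of "{}"] le_zero by blast
qed (use ea_Sup in \<open>auto intro: le_trans le_antisym\<close>)

lemma is_lub_ea_order_iff_ea_Sup: "is_lub ea_order s A \<longleftrightarrow> s = ea_Sup A"
  unfolding is_lub_ea_order_iff using ea_Sup le_antisym by blast

lemma compl_Inf: "(ea_Inf A)\<^sup>\<bottom> = ea_Sup (orthosupplement ` A)"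
proof (rule le_antisym)
  have "(ea_Sup (orthosupplement ` A))\<^sup>\<bottom> \<preceq> ea_Inf A"
    by (rule E.Inf_greatest) (simp add: compl_le_swap(1) E.Sup_upper)
  then show "(ea_Inf A)\<^sup>\<bottom> \<preceq> ea_Sup (orthosupplement ` A)" by (simp add: compl_le_swap(1))
  show "ea_Sup (orthosupplement ` A) \<preceq> (ea_Inf A)\<^sup>\<bottom>"
    by (rule E.Sup_least) (auto simp: E.Inf_lower)
qed

lemma compl_meet: "(a \<^bold>\<and> b)\<^sup>\<bottom> = a\<^sup>\<bottom> \<^bold>\<or> b\<^sup>\<bottom>"
  unfolding meet_def compl_Inf join_def by simp

lemma disjoint_mono:
  assumes "a \<^bold>\<and> b = zero" "c \<preceq> a"
  shows "c \<^bold>\<and> b = zero"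
  using E.inf_mono[OF assms(2) le_refl[of b]] assms(1) by simp

text \<open>
  If \<open>d\<close> is below both differences, then \<open>(a \<^bold>\<and> c) \<uplus> d\<close> is below both \<open>a\<close> and \<open>c\<close>, hence below
  \<open>a \<^bold>\<and> c\<close>.
\<close>

lemma diff_meet_disjoint: "(a \<setminus> (a \<^bold>\<and> c)) \<^bold>\<and> (c \<setminus> (a \<^bold>\<and> c)) = zero"
proof -
  define m d where "m = a \<^bold>\<and> c" and "d = (a \<setminus> m) \<^bold>\<and> (c \<setminus> m)"
  have "m \<bowtie> d" "m \<uplus> d \<preceq> a" "m \<uplus> d \<preceq> c"
    using le_diff_iff[of m a d] le_diff_iff[of m c d] unfolding d_def m_def by auto
  then have "m \<uplus> d \<preceq> m \<uplus> zero" unfolding m_def by auto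
  then have "d = zero" using \<open>m \<bowtie> d\<close> by (subst (asm) sum_le_iff) auto
  then show ?thesis unfolding d_def m_def .
qed

text \<open>
  Compatibility is the condition that \<open>a\<close> and \<open>b\<close> overlap exactly in their meet, as elements of
  an MV-algebra do: what remains of \<open>a\<close> outside the meet can be added to \<open>b\<close>.
\<close>

definition compatible :: "'a \<Rightarrow> 'a \<Rightarrow> bool" where
  "compatible a b \<longleftrightarrow> a \<setminus> (a \<^bold>\<and> b) \<bowtie> b"

text \<open>
  Any common lower bound can play the part of the meet, because removing the meet leaves even
  less.
\<close>

lemma compatibleI:
  assumes "r \<preceq> a" "r \<preceq> b" "a \<setminus> r \<bowtie> b"
  shows "compatible a b"
proof -
  have "a \<setminus> (a \<^bold>\<and> b) \<preceq> a \<setminus> r"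
    using assms by (intro diff_antimono) auto
  then show ?thesis unfolding compatible_def using assms(3) orth_mono le_refl by blast
qed

lemma compatible_sum_decomposition:
  assumes "compatible a b"
  shows "b \<setminus> (a \<^bold>\<and> b) \<bowtie> a" "(a \<setminus> (a \<^bold>\<and> b)) \<uplus> b = a \<uplus> (b \<setminus> (a \<^bold>\<and> b))"
proof -
  let ?r = "a \<^bold>\<and> b"
  have ra: "?r \<preceq> a" and rb: "?r \<preceq> b" by auto
  have 1: "?r \<uplus> (b \<setminus> ?r) = b" "(a \<setminus> ?r) \<uplus> ?r = a" using diff_sum[OF ra] diff_sum[OF rb] by auto
  have "a \<setminus> ?r \<bowtie> ?r \<uplus> (b \<setminus> ?r)" using assms 1 unfolding compatible_def by simp
  from sum_of_assoc'[OF diff_sum(1)[OF rb] this]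
  show "b \<setminus> ?r \<bowtie> a" "(a \<setminus> ?r) \<uplus> b = a \<uplus> (b \<setminus> ?r)"
    unfolding 1 by (simp_all add: orth_commute)
qed

lemma compatible_sym: "compatible a b \<Longrightarrow> compatible b a"
  using compatible_sum_decomposition(1) unfolding compatible_def by (simp add: E.inf_commute)

text \<open>
  Subtraction from \<open>s = p \<uplus> b\<close> reverses the order below \<open>s\<close>. It turns the claim that \<open>s\<close> is the
  join of \<open>a\<close> and \<open>b\<close> into the disjointness of the two differences \<open>p\<close> and \<open>q\<close>.
\<close>

lemma sum_eq_join:
  assumes "compatible a b"
  shows "(a \<setminus> (a \<^bold>\<and> b)) \<uplus> b = a \<^bold>\<or> b"
proof -
  define r p q s j where "r = a \<^bold>\<and> b" and "p = a \<setminus> r" and "q = b \<setminus> r"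
    and "s = p \<uplus> b" and "j = a \<^bold>\<or> b"
  have ra: "r \<preceq> a" and rb: "r \<preceq> b" unfolding r_def by auto
  have pb: "p \<bowtie> b" using assms unfolding compatible_def p_def r_def .
  have s: "s = a \<uplus> q" "q \<bowtie> a"
    using compatible_sum_decomposition[OF assms] unfolding s_def p_def q_def r_def by auto
  have "a \<preceq> s" using s le_sum(1)[of a q] by (simp add: orth_commute)
  moreover have "b \<preceq> s" using le_sum(2)[OF pb] unfolding s_def .
  ultimately have js: "j \<preceq> s" "a \<preceq> j" "b \<preceq> j" unfolding j_def by auto
  define d where "d = s \<setminus> j"
  have "d \<preceq> s \<setminus> a" "d \<preceq> s \<setminus> b" unfolding d_def using js by (auto intro: diff_antimono)
  moreover have "s \<setminus> a = q" using s sum_diff(1)[of a q] by (simp add: orth_commute)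
  moreover have "s \<setminus> b = p" unfolding s_def using sum_diff(2)[OF pb] .
  ultimately have d: "d \<preceq> p" "d \<preceq> q" by auto
  have "r \<bowtie> d" "r \<uplus> d \<preceq> a" "r \<uplus> d \<preceq> b"
    using d le_diff_iff[OF ra, of d] le_diff_iff[OF rb, of d] unfolding p_def q_def by auto
  then have "r \<uplus> d \<preceq> r \<uplus> zero" unfolding r_def by auto
  then have "d = zero" using sum_le_iff[of r d zero] \<open>r \<bowtie> d\<close> by simp
  then have "j = s" using diff_eq_zero js unfolding d_def by auto
  then show ?thesis unfolding s_def j_def p_def r_def by simp
qed

lemma diff_meet_eq: "compatible a b \<Longrightarrow> a \<setminus> (a \<^bold>\<and> b) = (a \<^bold>\<or> b) \<setminus> b"
  using sum_eq_join sum_diff(2) unfolding compatible_def by metis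

lemma le_compatible: "a \<preceq> b \<Longrightarrow> compatible a b"
  using compatibleI[of a a b] by simp

lemma compatible_refl [simp]: "compatible a a"
  using le_compatible by simp

text \<open>
  The common part of \<open>a\<close> and \<open>b\<^sup>\<bottom>\<close> is what remains of \<open>a\<close> outside \<open>b\<close>.
\<close>

lemma compatible_compl:
  assumes "compatible a b"
  shows "compatible a (b\<^sup>\<bottom>)"
proof (rule compatibleI)
  have m: "a \<^bold>\<and> b \<preceq> a" by simp
  show "a \<setminus> (a \<^bold>\<and> b) \<preceq> a" by (simp add: diff_sum)
  show "a \<setminus> (a \<^bold>\<and> b) \<preceq> b\<^sup>\<bottom>" using assms by (simp add: compatible_def orth_iff_le)
  have "a \<setminus> (a \<setminus> (a \<^bold>\<and> b)) = a \<^bold>\<and> b"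
    using sum_diff(1)[OF diff_sum(3)[OF m]] diff_sum(4)[OF m] by simp
  then show "a \<setminus> (a \<setminus> (a \<^bold>\<and> b)) \<bowtie> b\<^sup>\<bottom>" by (simp add: orth_iff_le)
qed

text \<open>
  The parts of \<open>x\<close> and \<open>y\<close> inside \<open>z\<close> and their parts outside \<open>z\<close> can be subtracted separately.
  The difference \<open>u\<close> of the inner parts is below \<open>z\<close>, and the difference \<open>v\<close> of the outer parts
  can be added to \<open>z\<close>.
\<close>

lemma compatible_diff:
  assumes "y \<preceq> x" "compatible x z" "compatible y z"
  shows "compatible (x \<setminus> y) z"
proof -
  define xz yz x1 y1 where "xz = x \<^bold>\<and> z" and "yz = y \<^bold>\<and> z" and "x1 = x \<setminus> xz" and "y1 = y \<setminus> yz"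
  have le: "xz \<preceq> x" "yz \<preceq> y" "yz \<preceq> xz" "xz \<preceq> z"
    unfolding xz_def yz_def using assms(1) by (auto intro: E.le_infI1)
  have "y1 \<preceq> x1"
    unfolding x1_def y1_def xz_def yz_def diff_meet_eq[OF assms(2)] diff_meet_eq[OF assms(3)]
    by (rule diff_mono) (use assms(1) in \<open>auto intro: E.le_supI1\<close>)
  define u v where "u = xz \<setminus> yz" and "v = x1 \<setminus> y1"
  have 1: "y1 \<bowtie> v" "y1 \<uplus> v = x1" "yz \<bowtie> u" "yz \<uplus> u = xz" "x1 \<bowtie> xz" "x1 \<uplus> xz = x"
    "y1 \<uplus> yz = y" 
    unfolding u_def v_def x1_def y1_def
    using diff_sum[OF le(1)] diff_sum[OF le(2)] diff_sum[OF le(3)] diff_sum[OF \<open>y1 \<preceq> x1\<close>]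
    by (auto simp: x1_def y1_def)
  note 2 = sum_sum_swap[of y1 v yz u, unfolded 1, OF _ _ 1(5)]
  have "v \<bowtie> u" "y \<bowtie> v \<uplus> u" "x = y \<uplus> (v \<uplus> u)" using 2 1 by auto
  then have 3: "x \<setminus> y = v \<uplus> u" "v \<bowtie> u" using sum_diff by auto
  show ?thesis
  proof (rule compatibleI)
    show "u \<preceq> x \<setminus> y" using 3 le_sum by simp
    show "u \<preceq> z" using diff_sum(5)[OF le(3)] le(4) le_trans unfolding u_def by blast
    have "(x \<setminus> y) \<setminus> u = v" using 3 sum_diff by simp
    moreover have "v \<preceq> x1" using diff_sum(5)[OF \<open>y1 \<preceq> x1\<close>] unfolding v_def .
    moreover have "x1 \<bowtie> z" using assms(2) unfolding compatible_def x1_def xz_def .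
    ultimately show "(x \<setminus> y) \<setminus> u \<bowtie> z" using orth_mono le_refl by metis
  qed
qed

lemma compatible_sum:
  assumes "x \<bowtie> y" "compatible x z" "compatible y z"
  shows "compatible (x \<uplus> y) z"
proof -
  have "compatible ((x\<^sup>\<bottom> \<setminus> y)\<^sup>\<bottom>) z"
    using assms by (metis compatible_diff compatible_compl compatible_sym orth_iff_le orth_commute)
  then show ?thesis by (simp add: diff_def sum_of_commute)
qed

text \<open>
  Let \<open>w\<close> be the supremum. The part of each \<open>x\<close> outside \<open>z\<close> is below \<open>k\<close>, which can be added to
  \<open>z\<close>, and the part inside is below \<open>e = w \<^bold>\<and> z\<close>. So \<open>w\<close> is below \<open>k \<uplus> e\<close>.
\<close>

lemma compatible_Sup:
  assumes "\<And>x. x \<in> A \<Longrightarrow> compatible x z"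
  shows "compatible (ea_Sup A) z"
proof -
  define w k e where "w = ea_Sup A" and "k = (w \<^bold>\<or> z) \<setminus> z" and "e = w \<^bold>\<and> z"
  have kz: "k \<bowtie> z" unfolding k_def by (simp add: diff_sum)
  then have ke: "k \<bowtie> e" unfolding e_def by (rule orth_mono) auto
  have "x \<preceq> k \<uplus> e" if "x \<in> A" for x
  proof -
    have xw: "x \<preceq> w" unfolding w_def using that by (rule E.Sup_upper)
    have "x \<setminus> (x \<^bold>\<and> z) \<preceq> k"
      unfolding k_def diff_meet_eq[OF assms[OF that]]
      by (rule diff_mono) (use xw in \<open>auto intro: E.le_supI1\<close>)
    moreover have "x \<^bold>\<and> z \<preceq> e" unfolding e_def using xw by (auto intro: E.le_infI1)
    ultimately have "(x \<setminus> (x \<^bold>\<and> z)) \<uplus> (x \<^bold>\<and> z) \<preceq> k \<uplus> e" using ke sum_mono by blast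
    then show ?thesis using diff_sum(4)[of "x \<^bold>\<and> z" x] by simp
  qed
  then have "w \<preceq> e \<uplus> k" unfolding w_def by (simp add: E.Sup_least sum_of_commute)
  then have "w \<setminus> e \<preceq> k"
    using diff_le_iff[of e w k] ke by (simp add: e_def orth_commute)
  then have "w \<setminus> e \<bowtie> z" using kz orth_mono le_refl by blast
  then show ?thesis unfolding compatible_def e_def w_def .
qed

lemma disjoint_compatible:
  assumes "compatible a b" "a \<^bold>\<and> b = zero"
  shows "a \<bowtie> b" "a \<uplus> b = a \<^bold>\<or> b"
  using assms sum_eq_join[OF assms(1)] by (simp_all add: compatible_def)

text \<open>
  For disjoint compatible elements the sum is the join. Hence each \<open>c\<close> stays below
  \<open>(s \<^bold>\<or> a) \<setminus> a\<close>, which is \<open>s \<setminus> (s \<^bold>\<and> a)\<close>, and so does their supremum \<open>s\<close>.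
\<close>

lemma Sup_disjoint:
  assumes "\<And>c. c \<in> A \<Longrightarrow> compatible c a" "\<And>c. c \<in> A \<Longrightarrow> c \<^bold>\<and> a = zero"
  shows "ea_Sup A \<^bold>\<and> a = zero"
proof -
  define s m where "s = ea_Sup A" and "m = s \<^bold>\<and> a"
  have sa: "compatible s a" unfolding s_def using assms(1) by (rule compatible_Sup)
  have ms: "m \<preceq> s" unfolding m_def by simp
  have "c \<preceq> s \<setminus> m" if "c \<in> A" for c
  proof -
    have "c \<uplus> a = c \<^bold>\<or> a" and ca: "c \<bowtie> a" using disjoint_compatible assms that by auto
    moreover have "c \<^bold>\<or> a \<preceq> s \<^bold>\<or> a" using that unfolding s_def by (auto intro: E.le_supI1 E.Sup_upper)
    ultimately have "a \<uplus> c \<preceq> s \<^bold>\<or> a" by (simp add: sum_of_commute)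
    then show ?thesis
      unfolding m_def diff_meet_eq[OF sa] using ca by (simp add: le_diff_iff orth_commute)
  qed
  then have "s \<preceq> s \<setminus> m" unfolding s_def by (rule E.Sup_least)
  then have "m = zero" by (rule le_diff_self_imp_zero[OF ms])
  then show ?thesis unfolding m_def s_def .
qed

end

text \<open>
  Blocks of a lattice effect algebra are its maximal sets of pairwise compatible elements. By
  maximality a block contains every element that is compatible with all of it, which gives all
  closure properties.
\<close>

locale effect_algebra_block = complete_lattice_effect_algebra +
  fixes M :: "'a set"
  assumes block_compatible: "a \<in> M \<Longrightarrow> b \<in> M \<Longrightarrow> compatible a b"
    and block_maximal: "(\<And>b. b \<in> M \<Longrightarrow> compatible a b) \<Longrightarrow> a \<in> M"

lemma (in complete_lattice_effect_algebra) ex_block: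
  assumes "\<And>a b. a \<in> C \<Longrightarrow> b \<in> C \<Longrightarrow> compatible a b"
  shows "\<exists>M. C \<subseteq> M \<and> effect_algebra_block psum zero one M"
proof -
  define \<A> where "\<A> = {X. C \<subseteq> X \<and> (\<forall>a\<in>X. \<forall>b\<in>X. compatible a b)}"
  have "\<exists>M\<in>\<A>. \<forall>X\<in>\<A>. M \<subseteq> X \<longrightarrow> X = M"
  proof (rule subset_Zorn_nonempty)
    show "\<A> \<noteq> {}" unfolding \<A>_def using assms by auto
    show "\<Union>\<C> \<in> \<A>" if "\<C> \<noteq> {}" "subset.chain \<A> \<C>" for \<C>
    proof -
      have "compatible a b" if ab: "X \<in> \<C>" "Y \<in> \<C>" "a \<in> X" "b \<in> Y" for a b X Y
      proof -
        have "X \<in> \<A>" "Y \<in> \<A>" "X \<subseteq> Y \<or> Y \<subseteq> X"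
          using \<open>subset.chain \<A> \<C>\<close> ab(1,2) by (auto simp: subset_chain_def)
        then show ?thesis using ab(3,4) unfolding \<A>_def by blast
      qed
      moreover obtain X where "X \<in> \<C>" using \<open>\<C> \<noteq> {}\<close> by blast
      moreover from this have "C \<subseteq> X" using that unfolding \<A>_def subset_chain_def by auto
      ultimately show ?thesis unfolding \<A>_def by auto
    qed
  qed
  then obtain M where M: "M \<in> \<A>" "\<And>X. X \<in> \<A> \<Longrightarrow> M \<subseteq> X \<Longrightarrow> X = M" by blast
  have "effect_algebra_block psum zero one M"
  proof
    show "compatible a b" if "a \<in> M" "b \<in> M" for a b using M(1) that unfolding \<A>_def by auto
    show "a \<in> M" if "\<And>b. b \<in> M \<Longrightarrow> compatible a b" for a
    proof -
      have "insert a M \<in> \<A>"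
        using M(1) that compatible_sym unfolding \<A>_def by auto
      then show ?thesis using M(2) by blast
    qed
  qed
  then show ?thesis using M(1) unfolding \<A>_def by blast
qed

context effect_algebra_block
begin

lemma block_compl [simp]: "a \<in> M \<Longrightarrow> a\<^sup>\<bottom> \<in> M"
  by (rule block_maximal) (metis compatible_compl compatible_sym block_compatible)

lemma block_sum [simp]: "a \<in> M \<Longrightarrow> b \<in> M \<Longrightarrow> a \<bowtie> b \<Longrightarrow> a \<uplus> b \<in> M"
  by (rule block_maximal) (metis compatible_sum block_compatible)

lemma block_diff [simp]: "a \<in> M \<Longrightarrow> b \<in> M \<Longrightarrow> a \<preceq> b \<Longrightarrow> b \<setminus> a \<in> M"
  by (rule block_maximal) (metis compatible_diff block_compatible)

lemma block_Sup: "A \<subseteq> M \<Longrightarrow> ea_Sup A \<in> M"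
  by (rule block_maximal) (auto intro: compatible_Sup block_compatible)

lemma block_Inf:
  assumes "A \<subseteq> M"
  shows "ea_Inf A \<in> M"
proof -
  have "orthosupplement ` A \<subseteq> M" using assms by auto
  from block_compl[OF block_Sup[OF this]] show ?thesis by (simp flip: compl_Inf)
qed

lemma block_meet [simp]: "a \<in> M \<Longrightarrow> b \<in> M \<Longrightarrow> a \<^bold>\<and> b \<in> M"
  unfolding meet_def by (rule block_Inf) simp

lemma block_zero [simp]: "zero \<in> M"
  using block_Sup[of "{}"] by simp

lemma block_one [simp]: "one \<in> M"
  using block_compl[OF block_zero] by simp

text \<open>
  This is Riesz decomposition: \<open>r\<close> splits into \<open>r \<^bold>\<and> p\<close> below \<open>p\<close> and a rest below \<open>q\<close>.
\<close>

lemma diff_meet_le_of_le_sum: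
  assumes "r \<in> M" "p \<in> M" "p \<bowtie> q" "r \<preceq> p \<uplus> q"
  shows "r \<setminus> (r \<^bold>\<and> p) \<preceq> q"
proof -
  have "(r \<^bold>\<or> p) \<setminus> p \<preceq> (p \<uplus> q) \<setminus> p"
    by (rule diff_mono) (use assms le_sum in auto)
  then show ?thesis
    using assms by (simp add: diff_meet_eq[OF block_compatible] sum_diff)
qed

lemma le_of_le_sum_disjoint:
  assumes "r \<in> M" "p \<in> M" "p \<bowtie> q" "r \<preceq> p \<uplus> q" "r \<^bold>\<and> p = zero"
  shows "r \<preceq> q"
  using diff_meet_le_of_le_sum[OF assms(1-4)] assms(5) by simp

lemma sum_disjoint:
  assumes "p \<in> M" "q \<in> M" "a \<in> M" "p \<bowtie> q" "p \<^bold>\<and> a = zero" "q \<^bold>\<and> a = zero"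
  shows "(p \<uplus> q) \<^bold>\<and> a = zero"
proof -
  define r where "r = (p \<uplus> q) \<^bold>\<and> a"
  have "r \<^bold>\<and> p \<preceq> p \<^bold>\<and> a" unfolding r_def by (auto intro: E.le_infI1 E.le_infI2)
  then have "r \<preceq> q"
    using assms by (intro le_of_le_sum_disjoint[of r p q]) (auto simp: r_def)
  then have "r \<preceq> q \<^bold>\<and> a" unfolding r_def by auto
  then show ?thesis using assms unfolding r_def by simp
qed

section \<open>Sharp elements of a block\<close>

text \<open>
  In the model of functions with values in the unit interval the sharp elements are the
  indicators, and the meet with a sharp element is the restriction to a set.
\<close>

definition sharp :: "'a \<Rightarrow> bool" where
  "sharp b \<longleftrightarrow> b \<in> M \<and> b \<^bold>\<and> b\<^sup>\<bottom> = zero"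

lemma sharp_block [simp]: "sharp b \<Longrightarrow> b \<in> M" 
  and sharp_disjoint: "sharp b \<Longrightarrow> b \<^bold>\<and> b\<^sup>\<bottom> = zero"
  by (auto simp: sharp_def)

lemma sharp_compl [simp]: "sharp b \<Longrightarrow> sharp (b\<^sup>\<bottom>)"
  by (simp add: sharp_def E.inf_commute)

lemma sharp_one [simp]: "sharp one"
  by (simp add: sharp_def)

lemma sharp_meet [simp]:
  assumes "sharp b" "sharp c"
  shows "sharp (b \<^bold>\<and> c)"
proof -
  have "c\<^sup>\<bottom> \<^bold>\<and> (b \<^bold>\<and> c) = zero" "b\<^sup>\<bottom> \<^bold>\<and> (b \<^bold>\<and> c) = zero"
    using sharp_disjoint[OF assms(1)] sharp_disjoint[OF assms(2)]
    by (metis E.inf_commute E.inf_left_commute E.inf_bot_right)+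
  moreover have "compatible d (b \<^bold>\<and> c)" if "d \<in> {b\<^sup>\<bottom>, c\<^sup>\<bottom>}" for d
    using that assms by (intro block_compatible) auto
  ultimately have "ea_Sup {b\<^sup>\<bottom>, c\<^sup>\<bottom>} \<^bold>\<and> (b \<^bold>\<and> c) = zero"
    by (rule_tac Sup_disjoint) blast+
  then have "(b \<^bold>\<and> c)\<^sup>\<bottom> \<^bold>\<and> (b \<^bold>\<and> c) = zero"
    unfolding compl_meet join_def .
  then show ?thesis unfolding sharp_def using assms by (subst E.inf_commute) simp
qed

text \<open>
  The supremum \<open>p\<close> of all elements disjoint from \<open>a\<close> is itself disjoint from \<open>a\<close>. If \<open>q\<close> is the
  meet of \<open>p\<close> and \<open>p\<^sup>\<bottom>\<close>, then \<open>p \<uplus> q\<close> is still disjoint from \<open>a\<close>, so it is below \<open>p\<close>; this makes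
  \<open>p\<close> sharp.
\<close>

lemma ex_polar:
  assumes "a \<in> M"
  shows "\<exists>p. sharp p \<and> p \<^bold>\<and> a = zero \<and> (\<forall>c\<in>M. c \<^bold>\<and> a = zero \<longrightarrow> c \<preceq> p)"
proof -
  define P where "P = {c\<in>M. c \<^bold>\<and> a = zero}"
  define p where "p = ea_Sup P"
  have pM: "p \<in> M" unfolding p_def by (rule block_Sup) (auto simp: P_def)
  have pa: "p \<^bold>\<and> a = zero" unfolding p_def
    by (rule Sup_disjoint) (use assms in \<open>auto simp: P_def block_compatible\<close>)
  have pmax: "c \<preceq> p" if "c \<in> M" "c \<^bold>\<and> a = zero" for c
    unfolding p_def using that by (auto simp: P_def intro!: E.Sup_upper)
  define q where "q = p \<^bold>\<and> p\<^sup>\<bottom>"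
  have pq: "p \<bowtie> q" "q \<preceq> p" "q \<in> M" unfolding q_def using pM by (auto simp: orth_iff_le compl_le_swap(2)[of p])
  have "q \<^bold>\<and> a = zero" using pa pq(2) by (rule disjoint_mono)
  then have "p \<uplus> q \<preceq> p \<uplus> zero"
    using pmax[of "p \<uplus> q"] sum_disjoint[OF pM pq(3) assms pq(1) pa] pM pq by simp
  then have "q = zero" using pq(1) by (subst (asm) sum_le_iff) auto
  then show ?thesis using pM pa pmax unfolding q_def sharp_def by blast
qed

text \<open>
  Elements of a block are comparable locally. On the polar \<open>p\<close> of the excess of \<open>a\<close> over \<open>c\<close>
  this excess vanishes. The excess of \<open>c\<close> over \<open>a\<close> is disjoint from it, hence below \<open>p\<close>, and
  vanishes on \<open>p\<^sup>\<bottom>\<close>.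
\<close>

lemma ex_sharp_comparison:
  assumes "a \<in> M" "c \<in> M"
  shows "\<exists>p. sharp p \<and> a \<^bold>\<and> p \<preceq> c \<and> c \<^bold>\<and> p\<^sup>\<bottom> \<preceq> a"
proof -
  define m a1 c1 where "m = a \<^bold>\<and> c" and "a1 = a \<setminus> m" and "c1 = c \<setminus> m"
  have m: "m \<preceq> a" "m \<preceq> c" "m \<in> M" unfolding m_def using assms by auto
  have M: "a1 \<in> M" "c1 \<in> M" unfolding a1_def c1_def using m assms by auto
  have "a1 \<^bold>\<and> c1 = zero" unfolding a1_def c1_def m_def by (rule diff_meet_disjoint)
  moreover obtain p where p: "sharp p" "p \<^bold>\<and> a1 = zero" "\<And>c. c \<in> M \<Longrightarrow> c \<^bold>\<and> a1 = zero \<Longrightarrow> c \<preceq> p"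
    using ex_polar[OF M(1)] by auto
  ultimately have "c1 \<preceq> p" using M by (simp add: E.inf_commute)
  then have c1: "c1 \<^bold>\<and> p\<^sup>\<bottom> = zero"
    using sharp_disjoint[OF p(1)] by (rule disjoint_mono[rotated])
  have "a \<^bold>\<and> p \<^bold>\<and> a1 = zero" "c \<^bold>\<and> p\<^sup>\<bottom> \<^bold>\<and> c1 = zero"
    using p(2) c1 by (metis E.inf_assoc E.inf_commute E.inf_bot_right)+
  moreover have "a \<^bold>\<and> p \<preceq> a1 \<uplus> m" "c \<^bold>\<and> p\<^sup>\<bottom> \<preceq> c1 \<uplus> m" "a1 \<bowtie> m" "c1 \<bowtie> m"
    using m by (simp_all add: a1_def c1_def diff_sum)
  ultimately have "a \<^bold>\<and> p \<preceq> m" "c \<^bold>\<and> p\<^sup>\<bottom> \<preceq> m"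
    using le_of_le_sum_disjoint M assms p(1) block_meet sharp_block sharp_compl by metis+
  then show ?thesis using p(1) m le_trans by blast
qed

lemma sharp_split:
  assumes "sharp b" "x \<in> M"
  shows "x \<^bold>\<and> b \<bowtie> x \<^bold>\<and> b\<^sup>\<bottom>" "(x \<^bold>\<and> b) \<uplus> (x \<^bold>\<and> b\<^sup>\<bottom>) = x"
proof -
  show o: "x \<^bold>\<and> b \<bowtie> x \<^bold>\<and> b\<^sup>\<bottom>" by (rule orth_mono[OF orth_compl(1)[of b]]) auto
  have "(x \<^bold>\<and> b) \<^bold>\<and> (x \<^bold>\<and> b\<^sup>\<bottom>) = zero"
    using sharp_disjoint[OF assms(1)] by (metis E.inf_assoc E.inf_left_commute E.inf_bot_right)
  then have "(x \<^bold>\<and> b) \<uplus> (x \<^bold>\<and> b\<^sup>\<bottom>) = (x \<^bold>\<and> b) \<^bold>\<or> (x \<^bold>\<and> b\<^sup>\<bottom>)"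
    using assms by (intro disjoint_compatible block_compatible) auto
  then have 1: "(x \<^bold>\<and> b) \<uplus> (x \<^bold>\<and> b\<^sup>\<bottom>) \<preceq> x" by simp
  have "x \<setminus> (x \<^bold>\<and> b) \<preceq> x \<^bold>\<and> b\<^sup>\<bottom>"
    using block_compatible[of x b] assms by (auto simp: compatible_def orth_iff_le diff_sum)
  then have "x \<preceq> (x \<^bold>\<and> b) \<uplus> (x \<^bold>\<and> b\<^sup>\<bottom>)" using o by (subst (asm) diff_le_iff) auto
  with 1 show "(x \<^bold>\<and> b) \<uplus> (x \<^bold>\<and> b\<^sup>\<bottom>) = x" by (rule le_antisym)
qed

lemma le_sharp_iff: "sharp b \<Longrightarrow> x \<in> M \<Longrightarrow> x \<preceq> b \<longleftrightarrow> x \<^bold>\<and> b\<^sup>\<bottom> = zero"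
  using sharp_split[of b x] sharp_disjoint[of b] disjoint_mono[of b "b\<^sup>\<bottom>" x]
  by (metis E.inf.cobounded2 sum_zero(1))

text \<open>
  Restriction to a sharp element is additive. The right-hand side is below the left-hand side for
  \<open>b\<close> and for \<open>b\<^sup>\<bottom>\<close>, and both sides add up to \<open>x \<uplus> y\<close>; so neither inequality can be strict.
\<close>

lemma meet_sharp_sum:
  assumes "sharp b" "x \<in> M" "y \<in> M" "x \<bowtie> y"
  shows "x \<^bold>\<and> b \<bowtie> y \<^bold>\<and> b" "(x \<uplus> y) \<^bold>\<and> b = (x \<^bold>\<and> b) \<uplus> (y \<^bold>\<and> b)"
proof -
  have o: "x \<^bold>\<and> b \<bowtie> y \<^bold>\<and> b" for b by (rule orth_mono[OF assms(4)]) auto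
  then show "x \<^bold>\<and> b \<bowtie> y \<^bold>\<and> b" .
  have le: "(x \<^bold>\<and> b) \<uplus> (y \<^bold>\<and> b) \<preceq> (x \<uplus> y) \<^bold>\<and> b" if b: "sharp b" for b
  proof (rule E.inf_greatest)
    show "(x \<^bold>\<and> b) \<uplus> (y \<^bold>\<and> b) \<preceq> x \<uplus> y" using assms(4) by (auto intro: sum_mono)
    have z: "z \<^bold>\<and> b \<^bold>\<and> b\<^sup>\<bottom> = zero" for z
      using sharp_disjoint[OF b] by (simp add: E.inf_assoc)
    have "((x \<^bold>\<and> b) \<uplus> (y \<^bold>\<and> b)) \<^bold>\<and> b\<^sup>\<bottom> = zero"
      using assms b o z by (intro sum_disjoint) auto
    then show "(x \<^bold>\<and> b) \<uplus> (y \<^bold>\<and> b) \<preceq> b"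
      using assms b o by (subst le_sharp_iff) auto
  qed
  let ?c = "b\<^sup>\<bottom>"
  have "((x \<^bold>\<and> b) \<uplus> (y \<^bold>\<and> b)) \<uplus> ((x \<^bold>\<and> ?c) \<uplus> (y \<^bold>\<and> ?c)) =
     ((x \<^bold>\<and> b) \<uplus> (x \<^bold>\<and> ?c)) \<uplus> ((y \<^bold>\<and> b) \<uplus> (y \<^bold>\<and> ?c))"
    using assms o sharp_split[OF assms(1,2)] sharp_split[OF assms(1,3)]
    by (intro sum_sum_swap(4)[symmetric]) auto
  also have "\<dots> = ((x \<uplus> y) \<^bold>\<and> b) \<uplus> ((x \<uplus> y) \<^bold>\<and> ?c)"
    using assms by (simp add: sharp_split)
  finally show "(x \<uplus> y) \<^bold>\<and> b = (x \<^bold>\<and> b) \<uplus> (y \<^bold>\<and> b)"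
    using sum_eq_imp_eq(1)[OF le[OF assms(1)] le[of ?c]] sharp_split[of b "x \<uplus> y"] assms by simp
qed

lemma meet_sharp_compl:
  assumes "sharp b" "x \<in> M"
  shows "x \<^bold>\<and> b \<bowtie> x\<^sup>\<bottom> \<^bold>\<and> b" "(x \<^bold>\<and> b) \<uplus> (x\<^sup>\<bottom> \<^bold>\<and> b) = b"
  using meet_sharp_sum[OF assms(1), of x "x\<^sup>\<bottom>"] assms by simp_all

end

section \<open>Real values at an ultrafilter of sharp elements\<close>

context effect_algebra
begin

lemma diff_double:
  assumes "x \<bowtie> y" "x \<preceq> y"
  shows "(x \<uplus> y) \<setminus> (x \<uplus> x) = y \<setminus> x" "x \<bowtie> x" "x \<uplus> x \<preceq> x \<uplus> y"
proof -
  note 1 = diff_sum[OF assms(2)]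
  note 2 = sum_of_assoc'[OF 1(1), of x, unfolded 1(2), OF assms(1)]
  show "(x \<uplus> y) \<setminus> (x \<uplus> x) = y \<setminus> x" using 2 sum_diff(1)[OF 2(2)] by simp
  show "x \<bowtie> x" by (rule 2)
  show "x \<uplus> x \<preceq> x \<uplus> y" using 2 le_sum(1)[OF 2(2)] by simp
qed

text \<open>
  In an ordered group this is \<open>(u + z - v) + (u + v - z) = 2u\<close>. That \<open>v\<close> is below \<open>z\<close> serves to write
  all terms as sums of elements without subtraction.
\<close>

lemma diff_sum_diff:
  assumes "v \<preceq> z" "u \<bowtie> z" "z \<preceq> u \<uplus> v" "u \<bowtie> u"
  shows "(u \<uplus> z) \<setminus> v \<bowtie> (u \<uplus> v) \<setminus> z" "((u \<uplus> z) \<setminus> v) \<uplus> ((u \<uplus> v) \<setminus> z) = u \<uplus> u"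
proof -
  obtain e where e: "v \<bowtie> e" "v \<uplus> e = z" using assms(1) by (auto simp: le_iff_sum)
  have uv: "u \<bowtie> v" using assms(1,2) orth_mono le_refl by blast
  obtain f where f: "z \<bowtie> f" "z \<uplus> f = u \<uplus> v" using assms(3) by (auto simp: le_iff_sum)
  have 1: "e \<bowtie> f" "v \<bowtie> e \<uplus> f" "z \<uplus> f = v \<uplus> (e \<uplus> f)"
    using sum_of_assoc[OF e(1), of f] e f by auto
  have u: "u = e \<uplus> f"
    by (rule sum_cancel[of v]) (use 1 f uv in \<open>simp_all add: orth_commute sum_of_commute\<close>)
  have "e \<bowtie> v" "e \<uplus> v = z" using e by (simp_all add: orth_commute sum_of_commute)
  with sum_of_assoc'[of e v u] assms(2) have ue: "u \<bowtie> e" "u \<uplus> e \<bowtie> v" "u \<uplus> z = (u \<uplus> e) \<uplus> v"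
    using sum_of_assoc'[of e v u] by auto
  have "(u \<uplus> z) \<setminus> v = u \<uplus> e" using ue sum_diff by simp
  moreover have "(u \<uplus> v) \<setminus> z = f" using f sum_diff by metis
  moreover have "u \<uplus> e \<bowtie> f" "(u \<uplus> e) \<uplus> f = u \<uplus> u"
    using sum_of_assoc'[OF 1(1), of u] assms(4) u by auto
  ultimately show "(u \<uplus> z) \<setminus> v \<bowtie> (u \<uplus> v) \<setminus> z" "((u \<uplus> z) \<setminus> v) \<uplus> ((u \<uplus> v) \<setminus> z) = u \<uplus> u"
    by auto
qed

end

text \<open>
  Iterating the assumption bounds \<open>f x\<close> by \<open>K * (1/2) ^ n\<close>. It is applied to the defects of
  identities for values that are given by binary expansions.
\<close>

lemma zero_if_halving:
  fixes f :: "'b \<Rightarrow> real"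
  assumes bound: "\<And>x. P x \<Longrightarrow> \<bar>f x\<bar> \<le> K"
    and halve: "\<And>x. P x \<Longrightarrow> f x = 0 \<or> (\<exists>y. P y \<and> \<bar>f x\<bar> \<le> \<bar>f y\<bar> / 2)"
    and "P x"
  shows "f x = 0"
proof -
  have "\<bar>f x\<bar> \<le> K * (1/2) ^ n" if "P x" for n x
    using that
  proof (induction n arbitrary: x)
    case (Suc n)
    from halve[OF Suc.prems] show ?case
    proof
      assume "f x = 0"
      moreover have "K \<ge> 0" using bound[OF Suc.prems] by simp
      ultimately show ?case by simp
    next
      assume "\<exists>y. P y \<and> \<bar>f x\<bar> \<le> \<bar>f y\<bar> / 2"
      then obtain y where "P y" "\<bar>f x\<bar> \<le> \<bar>f y\<bar> / 2" by blast
      then show ?case using Suc.IH[of y] by simp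
    qed
  qed (use bound in simp)
  moreover have "(\<lambda>n. K * (1/2) ^ n) \<longlonglongrightarrow> K * 0"
    by (intro tendsto_mult tendsto_const LIMSEQ_power_zero) simp
  ultimately have "\<bar>f x\<bar> \<le> K * 0"
    using \<open>P x\<close> by (intro LIMSEQ_le_const) auto
  then show ?thesis by simp
qed

lemma abs_half: "x = y / 2 \<Longrightarrow> \<bar>x\<bar> \<le> \<bar>y\<bar> / 2" "x = - (y / 2) \<Longrightarrow> \<bar>x\<bar> \<le> \<bar>y\<bar> / 2" for x y :: real
  by auto

context effect_algebra_block
begin

definition ultra :: "'a set \<Rightarrow> bool" where
  "ultra U \<longleftrightarrow> (\<forall>b\<in>U. sharp b) \<and> one \<in> U \<and> zero \<notin> U \<and> (\<forall>b\<in>U. \<forall>c\<in>U. b \<^bold>\<and> c \<in> U) \<and>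
     (\<forall>b. sharp b \<longrightarrow> b \<in> U \<or> b\<^sup>\<bottom> \<in> U)"

text \<open>
  A maximal filter \<open>U\<close> contains an element disjoint from \<open>b\<close> unless \<open>b\<close> is in \<open>U\<close>. If neither
  \<open>b\<close> nor \<open>b\<^sup>\<bottom>\<close> were in \<open>U\<close>, some element of \<open>U\<close> would be disjoint from both.
\<close>

lemma ex_ultra:
  assumes S: "\<And>b. b \<in> S \<Longrightarrow> sharp b" "\<And>b c. b \<in> S \<Longrightarrow> c \<in> S \<Longrightarrow> b \<^bold>\<and> c \<in> S"
    "one \<in> S" "zero \<notin> S"
  shows "\<exists>U. S \<subseteq> U \<and> ultra U"
proof -
  define \<F> where "\<F> = {F. S \<subseteq> F \<and> zero \<notin> F \<and> (\<forall>b\<in>F. sharp b) \<and> (\<forall>b\<in>F. \<forall>c\<in>F. b \<^bold>\<and> c \<in> F)}"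
  have "\<exists>U\<in>\<F>. \<forall>X\<in>\<F>. U \<subseteq> X \<longrightarrow> X = U"
  proof (rule subset_Zorn_nonempty)
    have "S \<in> \<F>" using S by (simp add: \<F>_def)
    then show "\<F> \<noteq> {}" by auto
    show "\<Union>\<C> \<in> \<F>" if "\<C> \<noteq> {}" "subset.chain \<F> \<C>" for \<C>
    proof -
      have "b \<^bold>\<and> c \<in> \<Union>\<C>" if bc: "X \<in> \<C>" "Y \<in> \<C>" "b \<in> X" "c \<in> Y" for b c X Y
      proof -
        have "X \<in> \<F>" "Y \<in> \<F>" "X \<subseteq> Y \<or> Y \<subseteq> X"
          using \<open>subset.chain \<F> \<C>\<close> bc(1,2) by (auto simp: subset_chain_def)
        then have "b \<^bold>\<and> c \<in> X \<or> b \<^bold>\<and> c \<in> Y" using bc(3,4) unfolding \<F>_def by blast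
        then show ?thesis using bc by blast
      qed
      then have "\<forall>b\<in>\<Union>\<C>. \<forall>c\<in>\<Union>\<C>. b \<^bold>\<and> c \<in> \<Union>\<C>" by (metis UnionE)
      moreover have F: "S \<subseteq> X" "zero \<notin> X" "\<And>b. b \<in> X \<Longrightarrow> sharp b" if "X \<in> \<C>" for X
      proof -
        have "X \<in> \<F>" using that \<open>subset.chain \<F> \<C>\<close> by (auto simp: subset_chain_def)
        then show "S \<subseteq> X" "zero \<notin> X" "\<And>b. b \<in> X \<Longrightarrow> sharp b" by (simp_all add: \<F>_def)
      qed
      moreover have "S \<subseteq> \<Union>\<C>" using F(1) \<open>\<C> \<noteq> {}\<close> by blast
      moreover have "zero \<notin> \<Union>\<C>" "\<forall>b\<in>\<Union>\<C>. sharp b" using F(2,3) by auto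
      ultimately show ?thesis unfolding \<F>_def by simp
    qed
  qed
  then obtain U where U: "U \<in> \<F>" "\<And>X. X \<in> \<F> \<Longrightarrow> U \<subseteq> X \<Longrightarrow> X = U" by blast
  have UF: "S \<subseteq> U" "zero \<notin> U" "\<And>b. b \<in> U \<Longrightarrow> sharp b" "\<And>b c. b \<in> U \<Longrightarrow> c \<in> U \<Longrightarrow> b \<^bold>\<and> c \<in> U"
    using U(1) unfolding \<F>_def by auto
  have one: "one \<in> U" using UF(1) S(3) by auto
  have disj: "\<exists>c\<in>U. c \<^bold>\<and> b = zero" if "sharp b" "b \<notin> U" for b
  proof (rule ccontr)
    assume *: "\<not> ?thesis"
    \<comment> \<open>\<open>V\<close> is the filter generated by \<open>U\<close> and \<open>b\<close>.\<close>
    define V where "V = U \<union> {c \<^bold>\<and> b |c. c \<in> U}"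
    have "x \<^bold>\<and> y \<in> V" if xy: "x \<in> V" "y \<in> V" for x y
    proof -
      obtain x' y' where xy': "x' \<in> U" "y' \<in> U" "x = x' \<or> x = x' \<^bold>\<and> b" "y = y' \<or> y = y' \<^bold>\<and> b"
        using xy unfolding V_def by blast
      have "x \<^bold>\<and> y = x' \<^bold>\<and> y' \<or> x \<^bold>\<and> y = x' \<^bold>\<and> y' \<^bold>\<and> b"
        using xy'(3,4) by (metis E.inf_assoc E.inf_commute E.inf_left_idem)
      then show "x \<^bold>\<and> y \<in> V" using UF(4)[OF xy'(1,2)] unfolding V_def by auto
    qed
    then have "V \<in> \<F>"
      using UF that(1) * unfolding \<F>_def V_def by auto
    then have "V = U" using U(2) unfolding V_def by blast
    moreover have "b \<in> V" unfolding V_def using one E.inf_top_left[of b] by force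
    ultimately show False using that by simp
  qed
  have "b \<in> U \<or> b\<^sup>\<bottom> \<in> U" if sb: "sharp b" for b
  proof (rule ccontr)
    assume "\<not> (b \<in> U \<or> b\<^sup>\<bottom> \<in> U)"
    then obtain c d where cd: "c \<in> U" "c \<^bold>\<and> b = zero" "d \<in> U" "d \<^bold>\<and> b\<^sup>\<bottom> = zero"
      using disj[OF sb] disj[OF sharp_compl[OF sb]] by blast
    have "c \<^bold>\<and> d \<^bold>\<and> b = zero" "c \<^bold>\<and> d \<^bold>\<and> b\<^sup>\<bottom> = zero"
      using disjoint_mono[OF cd(2), of "c \<^bold>\<and> d"] disjoint_mono[OF cd(4), of "c \<^bold>\<and> d"] by auto
    then have "c \<^bold>\<and> d = zero" using sharp_split(2)[OF sb, of "c \<^bold>\<and> d"] UF(3) cd by simp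
    then show False using UF(2,4) cd by metis
  qed
  then have "ultra U" unfolding ultra_def using UF one by blast
  then show ?thesis using UF(1) by blast
qed

text \<open>
  The value of \<open>a\<close> at \<open>U\<close> is thought of as at most one half.
\<close>

definition lower_half :: "'a set \<Rightarrow> 'a \<Rightarrow> bool" where
  "lower_half U a \<longleftrightarrow> (\<exists>b\<in>U. a \<^bold>\<and> b \<preceq> a\<^sup>\<bottom>)"

text \<open>
  For numbers in the unit interval this is doubling truncated at one, that is, \<open>min (2 * a) 1\<close>.
\<close>

definition double :: "'a \<Rightarrow> 'a" where
  "double a = a \<uplus> (a \<^bold>\<and> a\<^sup>\<bottom>)"

text \<open>
  The second case is \<open>max (2 * a - 1) 0\<close> for numbers, so on values this is doubling modulo one.
\<close>

definition double_mod_one :: "'a set \<Rightarrow> 'a \<Rightarrow> 'a" where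
  "double_mod_one U a = (if lower_half U a then double a else (double (a\<^sup>\<bottom>))\<^sup>\<bottom>)"

text \<open>
  The number whose binary digits say in which half the iterates of \<open>a\<close> under doubling modulo
  one lie.
\<close>

definition omega :: "'a set \<Rightarrow> 'a \<Rightarrow> real" where
  "omega U a = (\<Sum>n. if lower_half U ((double_mod_one U ^^ n) a) then 0 else (1/2) ^ Suc n)"

lemma orth_meet_compl: "a \<bowtie> a \<^bold>\<and> a\<^sup>\<bottom>"
  by (rule orth_mono[OF orth_compl(1)[of a]]) auto

lemma block_double [simp]: "a \<in> M \<Longrightarrow> double a \<in> M"
  by (simp add: double_def orth_meet_compl)

lemma block_double_mod_one [simp]: "a \<in> M \<Longrightarrow> double_mod_one U a \<in> M"
  by (simp add: double_mod_one_def)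

lemma omega_summable: "summable (\<lambda>n. if lower_half U ((double_mod_one U ^^ n) a) then 0 else (1/2::real) ^ Suc n)"
  by (rule summable_comparison_test'[OF sums_summable[OF power_half_series], where N = 0]) auto

lemma omega_ge_0: "0 \<le> omega U a"
  unfolding omega_def by (intro suminf_nonneg omega_summable) auto

lemma omega_le_1: "omega U a \<le> 1"
proof -
  have "omega U a \<le> (\<Sum>n. (1/2::real) ^ Suc n)"
    unfolding omega_def
    by (intro suminf_le omega_summable sums_summable[OF power_half_series]) auto
  then show ?thesis using sums_unique[OF power_half_series] by simp
qed

lemma omega_double_mod_one:
  "omega U a = (if lower_half U a then omega U (double_mod_one U a) / 2 else (1 + omega U (double_mod_one U a)) / 2)"
proof -
  let ?f = "\<lambda>a n. if lower_half U ((double_mod_one U ^^ n) a) then 0 else (1/2::real) ^ Suc n"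
  have "omega U a = ?f a 0 + (\<Sum>n. ?f a (Suc n))"
    unfolding omega_def using suminf_split_head[OF omega_summable[of U a]] by simp
  also have "(\<lambda>n. ?f a (Suc n)) = (\<lambda>n. ?f (double_mod_one U a) n / 2)"
    by (auto simp: funpow_Suc_right simp del: funpow.simps)
  also have "(\<Sum>n. ?f (double_mod_one U a) n / 2) = omega U (double_mod_one U a) / 2"
    unfolding omega_def by (rule suminf_divide[OF omega_summable])
  finally show ?thesis by (simp add: field_simps)
qed

lemma meet_sharp_compl_eq: "sharp b \<Longrightarrow> x \<in> M \<Longrightarrow> x\<^sup>\<bottom> \<^bold>\<and> b = b \<setminus> (x \<^bold>\<and> b)"
  using meet_sharp_compl[of b x] sum_diff(1) by metis

lemma double_meet_sharp:
  assumes "sharp b" "x \<in> M"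
  shows "double x \<^bold>\<and> b = (x \<^bold>\<and> b) \<uplus> ((x \<^bold>\<and> b) \<^bold>\<and> (x\<^sup>\<bottom> \<^bold>\<and> b))"
proof -
  have "(x \<^bold>\<and> b) \<^bold>\<and> (x\<^sup>\<bottom> \<^bold>\<and> b) = x \<^bold>\<and> x\<^sup>\<bottom> \<^bold>\<and> b"
    by (metis E.inf_assoc E.inf_commute E.inf_left_idem)
  then show ?thesis
    unfolding double_def using assms by (simp add: meet_sharp_sum orth_meet_compl)
qed

context
  fixes U assumes U: "ultra U"
begin

lemma ultra_sharp [simp]: "b \<in> U \<Longrightarrow> sharp b"
  and ultra_one [simp]: "one \<in> U"
  and ultra_zero [simp]: "zero \<notin> U"
  and ultra_meet [simp]: "b \<in> U \<Longrightarrow> c \<in> U \<Longrightarrow> b \<^bold>\<and> c \<in> U"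
  and ultra_cases: "sharp b \<Longrightarrow> b \<in> U \<or> b\<^sup>\<bottom> \<in> U"
  using U by (auto simp: ultra_def)

lemma lower_half_cong':
  assumes "b \<in> U" "x \<in> M" "y \<in> M" "x \<^bold>\<and> b = y \<^bold>\<and> b" "lower_half U x"
  shows "lower_half U y"
proof -
  obtain c where c: "c \<in> U" "x \<^bold>\<and> c \<preceq> x\<^sup>\<bottom>" using assms(5) unfolding lower_half_def by auto
  have "y \<^bold>\<and> (b \<^bold>\<and> c) = x \<^bold>\<and> (b \<^bold>\<and> c)" using assms(4) by (metis E.inf_assoc)
  moreover have "x \<^bold>\<and> (b \<^bold>\<and> c) \<preceq> x \<^bold>\<and> c" "x \<^bold>\<and> (b \<^bold>\<and> c) \<preceq> b" by (auto intro: E.le_infI2)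
  moreover have "x\<^sup>\<bottom> \<^bold>\<and> b = y\<^sup>\<bottom> \<^bold>\<and> b" using assms by (simp add: meet_sharp_compl_eq)
  ultimately have "y \<^bold>\<and> (b \<^bold>\<and> c) \<preceq> y\<^sup>\<bottom>"
    using c(2) by (metis E.inf.bounded_iff E.order_trans)
  then show ?thesis unfolding lower_half_def using assms(1) c(1) ultra_meet by blast
qed

lemma lower_half_cong:
  assumes "b \<in> U" "x \<in> M" "y \<in> M" "x \<^bold>\<and> b = y \<^bold>\<and> b"
  shows "lower_half U x \<longleftrightarrow> lower_half U y"
  using lower_half_cong'[OF assms] lower_half_cong'[OF assms(1,3,2)] assms(4) by auto

lemma double_mod_one_cong:
  assumes "b \<in> U" "x \<in> M" "y \<in> M" "x \<^bold>\<and> b = y \<^bold>\<and> b"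
  shows "double_mod_one U x \<^bold>\<and> b = double_mod_one U y \<^bold>\<and> b"
proof -
  have "x\<^sup>\<bottom> \<^bold>\<and> b = y\<^sup>\<bottom> \<^bold>\<and> b" using assms by (simp add: meet_sharp_compl_eq)
  then show ?thesis
    unfolding double_mod_one_def
    using assms lower_half_cong[OF assms] by (simp add: double_meet_sharp meet_sharp_compl_eq)
qed

text \<open>
  The digits depend only on the restriction of the element to a member of \<open>U\<close>.
\<close>

lemma omega_cong:
  assumes "b \<in> U" "x \<in> M" "y \<in> M" "x \<^bold>\<and> b = y \<^bold>\<and> b"
  shows "omega U x = omega U y"
proof -
  have "(double_mod_one U ^^ n) x \<in> M \<and> (double_mod_one U ^^ n) y \<in> M \<and> (double_mod_one U ^^ n) x \<^bold>\<and> b = (double_mod_one U ^^ n) y \<^bold>\<and> b" for n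
    by (induction n) (use assms double_mod_one_cong in auto)
  then have "lower_half U ((double_mod_one U ^^ n) x) \<longleftrightarrow> lower_half U ((double_mod_one U ^^ n) y)" for n
    using lower_half_cong[OF assms(1)] by blast
  then show ?thesis unfolding omega_def by simp
qed

lemma upper_half:
  assumes "a \<in> M" "\<not> lower_half U a"
  shows "\<exists>b\<in>U. a\<^sup>\<bottom> \<^bold>\<and> b \<preceq> a"
  using ex_sharp_comparison[of a "a\<^sup>\<bottom>"] assms ultra_cases unfolding lower_half_def by auto

lemma omega_one [simp]: "omega U one = 1"
proof -
  have "\<not> lower_half U one" unfolding lower_half_def by auto
  moreover have "double zero = zero" unfolding double_def by simp
  ultimately show ?thesis using omega_double_mod_one[of U one] by (simp add: double_mod_one_def)
qed

text \<open>
  Doubling modulo one halves the defect of the identity: if \<open>a\<close> and \<open>a\<^sup>\<bottom>\<close> lie in opposite halves,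
  their images are again orthosupplements. If both lie in the lower half, they agree on a member
  of \<open>U\<close> and their doubles are \<open>one\<close> there.
\<close>

lemma omega_compl:
  assumes "a \<in> M"
  shows "omega U (a\<^sup>\<bottom>) = 1 - omega U a"
proof -
  have "omega U a + omega U (a\<^sup>\<bottom>) - 1 = 0"
  proof (rule zero_if_halving[where P = "\<lambda>a. a \<in> M" and f = "\<lambda>a. omega U a + omega U (a\<^sup>\<bottom>) - 1" and K = 2])
    fix x assume x: "x \<in> M"
    show "\<bar>omega U x + omega U (x\<^sup>\<bottom>) - 1\<bar> \<le> 2"
      using omega_ge_0[of U x] omega_le_1[of U x] omega_ge_0[of U "x\<^sup>\<bottom>"] omega_le_1[of U "x\<^sup>\<bottom>"] by simp
    consider "lower_half U x" "lower_half U (x\<^sup>\<bottom>)" | "lower_half U x" "\<not> lower_half U (x\<^sup>\<bottom>)"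
      | "\<not> lower_half U x" "lower_half U (x\<^sup>\<bottom>)"
      using upper_half[OF x] unfolding lower_half_def by auto
    then show "omega U x + omega U (x\<^sup>\<bottom>) - 1 = 0 \<or>
      (\<exists>y. y \<in> M \<and> \<bar>omega U x + omega U (x\<^sup>\<bottom>) - 1\<bar> \<le> \<bar>omega U y + omega U (y\<^sup>\<bottom>) - 1\<bar> / 2)"
    proof cases
      case 1
      then obtain b c where bc: "b \<in> U" "c \<in> U" "x \<^bold>\<and> b \<preceq> x\<^sup>\<bottom>" "x\<^sup>\<bottom> \<^bold>\<and> c \<preceq> x"
        unfolding lower_half_def by auto
      define d where "d = b \<^bold>\<and> c"
      have d: "d \<in> U" "sharp d" unfolding d_def using bc by auto
      have "x \<^bold>\<and> d \<preceq> x \<^bold>\<and> b" "x\<^sup>\<bottom> \<^bold>\<and> d \<preceq> x\<^sup>\<bottom> \<^bold>\<and> c"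
        unfolding d_def by (simp_all add: E.le_infI2)
      then have "x \<^bold>\<and> d \<preceq> x\<^sup>\<bottom>" "x\<^sup>\<bottom> \<^bold>\<and> d \<preceq> x" using bc(3,4) le_trans by blast+
      then have eq: "x \<^bold>\<and> d = x\<^sup>\<bottom> \<^bold>\<and> d"
        by (intro le_antisym E.inf_greatest) auto
      have "double x \<^bold>\<and> d = one \<^bold>\<and> d" "double (x\<^sup>\<bottom>) \<^bold>\<and> d = one \<^bold>\<and> d"
        using meet_sharp_compl[OF d(2) x] x d by (simp_all add: double_meet_sharp eq)
      then have "omega U (double x) = 1" "omega U (double (x\<^sup>\<bottom>)) = 1"
        using omega_cong[OF d(1), of _ one] x by auto
      then show ?thesis using 1 omega_double_mod_one[of U x] omega_double_mod_one[of U "x\<^sup>\<bottom>"] by (simp add: double_mod_one_def)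
    next
      case 2
      then have "omega U x + omega U (x\<^sup>\<bottom>) - 1 = (omega U (double x) + omega U ((double x)\<^sup>\<bottom>) - 1) / 2"
        using omega_double_mod_one[of U x] omega_double_mod_one[of U "x\<^sup>\<bottom>"] by (simp add: double_mod_one_def field_simps)
      then have "\<bar>omega U x + omega U (x\<^sup>\<bottom>) - 1\<bar> \<le> \<bar>omega U (double x) + omega U ((double x)\<^sup>\<bottom>) - 1\<bar> / 2"
        by (rule abs_half(1))
      then show ?thesis using x block_double by blast
    next
      case 3
      then have "omega U x + omega U (x\<^sup>\<bottom>) - 1 = (omega U (double (x\<^sup>\<bottom>)) + omega U ((double (x\<^sup>\<bottom>))\<^sup>\<bottom>) - 1) / 2"
        using omega_double_mod_one[of U x] omega_double_mod_one[of U "x\<^sup>\<bottom>"] by (simp add: double_mod_one_def field_simps)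
      then have "\<bar>omega U x + omega U (x\<^sup>\<bottom>) - 1\<bar> \<le> \<bar>omega U (double (x\<^sup>\<bottom>)) + omega U ((double (x\<^sup>\<bottom>))\<^sup>\<bottom>) - 1\<bar> / 2"
        by (rule abs_half(1))
      then show ?thesis using x block_double block_compl by blast
    qed
  qed (rule assms)
  then show ?thesis by simp
qed

lemma omega_zero [simp]: "omega U zero = 0"
  using omega_compl[of one] by simp

text \<open>
  The relation \<open>u + v = w\<close>, taken on some member of \<open>U\<close>. It is stable under doubling modulo one,
  up to rearrangement, whereas exact sums are not.
\<close>

definition sum_mod :: "'a \<times> 'a \<times> 'a \<Rightarrow> bool" where
  "sum_mod = (\<lambda>(u, v, w). u \<in> M \<and> v \<in> M \<and> w \<in> M \<and>
     (\<exists>b\<in>U. u \<^bold>\<and> b \<bowtie> v \<^bold>\<and> b \<and> (u \<^bold>\<and> b) \<uplus> (v \<^bold>\<and> b) = w \<^bold>\<and> b))"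

lemma sum_modI:
  assumes "u \<in> M" "v \<in> M" "w \<in> M" "b \<in> U" "u \<^bold>\<and> b \<bowtie> v \<^bold>\<and> b" "(u \<^bold>\<and> b) \<uplus> (v \<^bold>\<and> b) = w \<^bold>\<and> b"
  shows "sum_mod (u, v, w)"
  using assms unfolding sum_mod_def by blast

lemma sum_meet_sharp_mono:
  assumes "sharp c" "u \<in> M" "v \<in> M" "c \<preceq> b" "b \<in> M"
    "u \<^bold>\<and> b \<bowtie> v \<^bold>\<and> b" "(u \<^bold>\<and> b) \<uplus> (v \<^bold>\<and> b) = w \<^bold>\<and> b"
  shows "u \<^bold>\<and> c \<bowtie> v \<^bold>\<and> c" "(u \<^bold>\<and> c) \<uplus> (v \<^bold>\<and> c) = w \<^bold>\<and> c"
proof -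
  have eq: "x \<^bold>\<and> c = x \<^bold>\<and> b \<^bold>\<and> c" for x
    using assms(4) by (simp add: E.inf_assoc E.inf_absorb2)
  show "u \<^bold>\<and> c \<bowtie> v \<^bold>\<and> c" "(u \<^bold>\<and> c) \<uplus> (v \<^bold>\<and> c) = w \<^bold>\<and> c"
    using meet_sharp_sum[OF assms(1) _ _ assms(6)] assms eq[of u] eq[of v] eq[of w] by auto
qed

lemma double_mod_one_meet_lower:
  assumes "sharp b" "x \<in> M" "lower_half U x" "x \<^bold>\<and> b \<preceq> x\<^sup>\<bottom>"
  shows "double_mod_one U x \<^bold>\<and> b = (x \<^bold>\<and> b) \<uplus> (x \<^bold>\<and> b)"
proof -
  have "(x \<^bold>\<and> b) \<^bold>\<and> (x\<^sup>\<bottom> \<^bold>\<and> b) = x \<^bold>\<and> b"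
    using assms(4) by (intro E.inf_absorb1) simp
  then show ?thesis using assms by (simp add: double_mod_one_def double_meet_sharp)
qed

lemma double_mod_one_meet_upper:
  assumes "sharp b" "x \<in> M" "\<not> lower_half U x" "x\<^sup>\<bottom> \<^bold>\<and> b \<preceq> x"
  shows "double_mod_one U x \<^bold>\<and> b = b \<setminus> ((x\<^sup>\<bottom> \<^bold>\<and> b) \<uplus> (x\<^sup>\<bottom> \<^bold>\<and> b))"
proof -
  have "(x\<^sup>\<bottom> \<^bold>\<and> b) \<^bold>\<and> (x \<^bold>\<and> b) = x\<^sup>\<bottom> \<^bold>\<and> b"
    using assms(4) by (intro E.inf_absorb1) simp
  then show ?thesis using assms
    by (simp add: double_mod_one_def double_meet_sharp meet_sharp_compl_eq[of b "double (x\<^sup>\<bottom>)"])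
qed

lemma sum_mod_sym: "sum_mod (u, v, w) \<Longrightarrow> sum_mod (v, u, w)"
  unfolding sum_mod_def by (auto simp: orth_commute sum_of_commute)

text \<open>
  After restriction to a common member \<open>b\<close> of \<open>U\<close>, the elements \<open>u\<close>, \<open>v\<close>, \<open>w\<close> lie exactly in their
  halves, and \<open>x\<close>, \<open>y\<close>, \<open>z\<close> are their orthosupplements relative to \<open>b\<close>. If all three are in the lower
  half, doubling the equation gives \<open>2u + 2v = 2w\<close>. If \<open>v\<close> and \<open>w\<close> are in the upper half, subtracting
  one on both sides gives \<open>2u + (2v - 1) = 2w - 1\<close>. If only \<open>w\<close> is, the equation becomes
  \<open>2u + 2v = 1 + (2w - 1)\<close>, which as a relation between elements reads
  \<open>(1 - 2v) + (2w - 1) = 2u\<close>. In each case the defect of additivity is halved, up to sign. Only \<open>v\<close>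
  in the upper half is impossible, as \<open>v\<close> is below \<open>w\<close> on \<open>b\<close>.
\<close>

lemma sum_mod_halving:
  assumes R: "sum_mod (u, v, w)" and vu: "lower_half U u"
  shows "\<exists>u1 v1 w1. sum_mod (u1, v1, w1) \<and>
    \<bar>omega U u + omega U v - omega U w\<bar> \<le> \<bar>omega U u1 + omega U v1 - omega U w1\<bar> / 2"
proof -
  obtain b0 where b0: "b0 \<in> U" "u \<^bold>\<and> b0 \<bowtie> v \<^bold>\<and> b0" "(u \<^bold>\<and> b0) \<uplus> (v \<^bold>\<and> b0) = w \<^bold>\<and> b0" 
    and M: "u \<in> M" "v \<in> M" "w \<in> M"
    using R unfolding sum_mod_def by auto
  have "\<exists>b\<in>U. if lower_half U x then x \<^bold>\<and> b \<preceq> x\<^sup>\<bottom> else x\<^sup>\<bottom> \<^bold>\<and> b \<preceq> x" if "x \<in> M" for x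
    using upper_half[OF that] unfolding lower_half_def by auto
  then obtain h where h: "\<And>x. x \<in> M \<Longrightarrow> h x \<in> U"
    "\<And>x. x \<in> M \<Longrightarrow> if lower_half U x then x \<^bold>\<and> h x \<preceq> x\<^sup>\<bottom> else x\<^sup>\<bottom> \<^bold>\<and> h x \<preceq> x" by metis
  obtain p where p: "p \<in> U" "v \<^bold>\<and> p \<preceq> w\<^sup>\<bottom> \<or> w\<^sup>\<bottom> \<^bold>\<and> p \<preceq> v"
    using ex_sharp_comparison[of v "w\<^sup>\<bottom>"] ultra_cases M by (metis block_compl)
  \<comment> \<open>On \<open>b\<close> the sum is exact, each element is in its half, and \<open>v\<close> is comparable with \<open>w\<^sup>\<bottom>\<close>.\<close>
  define b where "b = b0 \<^bold>\<and> (h u \<^bold>\<and> (h v \<^bold>\<and> (h w \<^bold>\<and> p)))"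
  have b: "b \<in> U" "sharp b" unfolding b_def using b0 h(1) M p(1) by simp_all
  have ble: "b \<preceq> b0" "b \<preceq> h u" "b \<preceq> h v" "b \<preceq> h w" "b \<preceq> p"
    unfolding b_def by (auto intro: E.le_infI1 E.le_infI2)
  have meet_le: "x \<^bold>\<and> b \<preceq> y" if "x \<^bold>\<and> c \<preceq> y" "b \<preceq> c" for x y c
    using that by (meson E.inf_mono E.order_refl le_trans)
  have lower: "x \<^bold>\<and> b \<preceq> x\<^sup>\<bottom>" if "x = u \<or> x = v \<or> x = w" "lower_half U x" for x
    using meet_le[of x "h x" "x\<^sup>\<bottom>"] h(2)[of x] that ble M by auto
  have upper: "x\<^sup>\<bottom> \<^bold>\<and> b \<preceq> x" if "x = u \<or> x = v \<or> x = w" "\<not> lower_half U x" for x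
    using meet_le[of "x\<^sup>\<bottom>" "h x" x] h(2)[of x] that ble M by auto
  have comp: "v \<^bold>\<and> b \<preceq> w\<^sup>\<bottom> \<^bold>\<and> b \<or> w\<^sup>\<bottom> \<^bold>\<and> b \<preceq> v \<^bold>\<and> b"
    using p(2) meet_le[OF _ ble(5)] by auto
  define u' v' w' x y z where "u' = u \<^bold>\<and> b" and "v' = v \<^bold>\<and> b" and "w' = w \<^bold>\<and> b"
    and "x = u\<^sup>\<bottom> \<^bold>\<and> b" and "y = v\<^sup>\<bottom> \<^bold>\<and> b" and "z = w\<^sup>\<bottom> \<^bold>\<and> b"
  have sum: "u' \<bowtie> v'" "u' \<uplus> v' = w'"
    using sum_meet_sharp_mono[OF b(2) M(1,2) ble(1) _ b0(2,3)] b0(1) unfolding u'_def v'_def w'_def by auto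
  have compl: "u' \<bowtie> x" "u' \<uplus> x = b" "v' \<bowtie> y" "v' \<uplus> y = b" "w' \<bowtie> z" "w' \<uplus> z = b"
    unfolding u'_def v'_def w'_def x_def y_def z_def using meet_sharp_compl[OF b(2)] M by auto
  have uvz: "v' \<bowtie> z" "u' \<bowtie> v' \<uplus> z" "u' \<uplus> (v' \<uplus> z) = b"
    using sum_of_assoc[OF sum(1), of z] sum compl by auto
  have xeq: "x = v' \<uplus> z"
    by (rule sum_cancel[of u']) (use compl uvz in auto)
  have vu: "v' \<bowtie> u'" "v' \<uplus> u' = w'" using sum by (simp_all add: orth_commute sum_of_commute)
  have vuz: "u' \<bowtie> z" "v' \<bowtie> u' \<uplus> z" "v' \<uplus> (u' \<uplus> z) = b"
    using sum_of_assoc[OF vu(1), of z] vu compl by auto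
  have yeq: "y = u' \<uplus> z"
    by (rule sum_cancel[of v']) (use compl vuz in auto)
  have ux: "u' \<preceq> x" using lower[of u] assms(2) unfolding u'_def x_def by auto
  then have uu: "u' \<bowtie> u'" using diff_double compl by blast
  have su: "double_mod_one U u \<^bold>\<and> b = u' \<uplus> u'"
    using double_mod_one_meet_lower[OF b(2) M(1) assms(2)] lower[of u] assms(2) unfolding u'_def by auto
  have ou: "omega U u = omega U (double_mod_one U u) / 2" using omega_double_mod_one[of U u] assms(2) by simp
  consider (LL) "lower_half U v" "lower_half U w" | (LH) "lower_half U v" "\<not> lower_half U w"
    | (HL) "\<not> lower_half U v" "lower_half U w" | (HH) "\<not> lower_half U v" "\<not> lower_half U w" by auto
  then show ?thesis
  proof cases
    case LL
    have s: "double_mod_one U v \<^bold>\<and> b = v' \<uplus> v'" "double_mod_one U w \<^bold>\<and> b = w' \<uplus> w'"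
      using double_mod_one_meet_lower[OF b(2) M(2)] double_mod_one_meet_lower[OF b(2) M(3)] LL lower[of v] lower[of w]
      unfolding v'_def w'_def by auto
    have "w' \<preceq> z" using lower[of w] LL unfolding w'_def z_def by auto
    then have "w' \<bowtie> w'" using diff_double compl by blast
    then have "u' \<uplus> u' \<bowtie> v' \<uplus> v'" "(u' \<uplus> u') \<uplus> (v' \<uplus> v') = w' \<uplus> w'"
      using sum_sum_swap[of u' v' u' v'] sum by auto
    then have "sum_mod (double_mod_one U u, double_mod_one U v, double_mod_one U w)"
      using M s su b(1) by (intro sum_modI[of _ _ _ b]) simp_all
    moreover have "\<bar>omega U u + omega U v - omega U w\<bar> \<le>
      \<bar>omega U (double_mod_one U u) + omega U (double_mod_one U v) - omega U (double_mod_one U w)\<bar> / 2"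
      by (rule abs_half(1)) (use ou omega_double_mod_one[of U v] omega_double_mod_one[of U w] LL in \<open>simp add: field_simps\<close>)
    ultimately show ?thesis by blast
  next
    case HH
    have s: "double_mod_one U v \<^bold>\<and> b = b \<setminus> (y \<uplus> y)" "double_mod_one U w \<^bold>\<and> b = b \<setminus> (z \<uplus> z)"
      using double_mod_one_meet_upper[OF b(2) M(2)] double_mod_one_meet_upper[OF b(2) M(3)] HH upper[of v] upper[of w]
      unfolding y_def z_def by auto
    have "y \<preceq> v'" using upper[of v] HH unfolding v'_def y_def by auto
    then have yy: "y \<bowtie> y" "y \<uplus> y \<preceq> b" 
      using diff_double[of y v'] compl by (auto simp: orth_commute sum_of_commute)
    have "u' \<uplus> z \<bowtie> u' \<uplus> z" using yy yeq by simp
    note sw = sum_sum_swap[OF vuz(1) vuz(1) this]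
    have yy2: "(z \<uplus> z) \<uplus> (u' \<uplus> u') = y \<uplus> y" "z \<uplus> z \<bowtie> u' \<uplus> u'"
      using sw yeq by (simp_all add: sum_of_commute orth_commute)
    obtain e where e: "(y \<uplus> y) \<bowtie> e" "(y \<uplus> y) \<uplus> e = b" using yy(2) by (auto simp: le_iff_sum)
    have "u' \<uplus> u' \<bowtie> e" "z \<uplus> z \<bowtie> (u' \<uplus> u') \<uplus> e" "(z \<uplus> z) \<uplus> ((u' \<uplus> u') \<uplus> e) = b"
      using sum_of_assoc[OF yy2(2), of e] yy2 e by auto
    moreover have "b \<setminus> (y \<uplus> y) = e" using e sum_diff by metis
    ultimately have "u' \<uplus> u' \<bowtie> b \<setminus> (y \<uplus> y)" "(u' \<uplus> u') \<uplus> (b \<setminus> (y \<uplus> y)) = b \<setminus> (z \<uplus> z)"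
      using sum_diff by auto
    then have "sum_mod (double_mod_one U u, double_mod_one U v, double_mod_one U w)"
      using M s su b(1) by (intro sum_modI[of _ _ _ b]) simp_all
    moreover have "\<bar>omega U u + omega U v - omega U w\<bar> \<le>
      \<bar>omega U (double_mod_one U u) + omega U (double_mod_one U v) - omega U (double_mod_one U w)\<bar> / 2"
      by (rule abs_half(1)) (use ou omega_double_mod_one[of U v] omega_double_mod_one[of U w] HH in \<open>simp add: field_simps\<close>)
    ultimately show ?thesis by blast
  next
    case HL
    have "v \<^bold>\<and> b \<preceq> v\<^sup>\<bottom>"
    proof -
      have "v' \<preceq> w'" using le_sum(2)[OF sum(1)] sum(2) by simp
      also have "w' \<preceq> z" using lower[of w] HL unfolding w'_def z_def by auto
      also have "z \<preceq> y" using le_sum(2)[OF vuz(1)] yeq by simp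
      finally show ?thesis unfolding v'_def y_def by simp
    qed
    then have "lower_half U v" unfolding lower_half_def using b(1) by blast
    then show ?thesis using HL by simp
  next
    case LH
    have s: "double_mod_one U v \<^bold>\<and> b = v' \<uplus> v'" "double_mod_one U w \<^bold>\<and> b = b \<setminus> (z \<uplus> z)"
      using double_mod_one_meet_lower[OF b(2) M(2)] double_mod_one_meet_upper[OF b(2) M(3)] LH lower[of v] upper[of w]
      unfolding v'_def z_def by auto
    have vy: "v' \<preceq> y" using lower[of v] LH unfolding v'_def y_def by auto
    have zw: "z \<preceq> w'" using upper[of w] LH unfolding w'_def z_def by auto
    have "z \<bowtie> w'" "z \<uplus> w' = b" using compl by (simp_all add: orth_commute sum_of_commute)
    then have eq: "b \<setminus> (v' \<uplus> v') = y \<setminus> v'" "b \<setminus> (z \<uplus> z) = w' \<setminus> z"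
      using diff_double(1)[OF compl(3) vy] diff_double(1)[of z w'] zw compl by auto
    \<comment> \<open>\<open>(1 - 2v) + (2w - 1) = 2u\<close>, where \<open>1 - 2v = y - v\<close> and \<open>2w - 1 = w - z\<close>\<close>
    have "y \<setminus> v' \<bowtie> w' \<setminus> z \<and> (y \<setminus> v') \<uplus> (w' \<setminus> z) = u' \<uplus> u'"
      using comp
    proof
      assume "v \<^bold>\<and> b \<preceq> w\<^sup>\<bottom> \<^bold>\<and> b"
      then show ?thesis
        using diff_sum_diff[of v' z u'] vuz uu zw yeq sum unfolding v'_def z_def by simp
    next
      assume "w\<^sup>\<bottom> \<^bold>\<and> b \<preceq> v \<^bold>\<and> b"
      then show ?thesis
        using diff_sum_diff[of z v' u'] sum uu vy yeq sum unfolding v'_def z_def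
        by (simp add: orth_commute sum_of_commute)
    qed
    then have "sum_mod ((double_mod_one U v)\<^sup>\<bottom>, double_mod_one U w, double_mod_one U u)"
      using M s su b eq by (intro sum_modI[of _ _ _ b]) (simp_all add: meet_sharp_compl_eq)
    moreover have "\<bar>omega U u + omega U v - omega U w\<bar> \<le>
      \<bar>omega U ((double_mod_one U v)\<^sup>\<bottom>) + omega U (double_mod_one U w) - omega U (double_mod_one U u)\<bar> / 2"
      by (rule abs_half(2))
        (use ou omega_double_mod_one[of U v] omega_double_mod_one[of U w] LH M in \<open>simp add: field_simps omega_compl\<close>)
    ultimately show ?thesis by blast
  qed
qed

text \<open>
  If \<open>u\<close> were above one half on a member of \<open>U\<close>, what is left for \<open>v\<close> there is below one half.
\<close>

lemma sum_mod_lower_half: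
  assumes "sum_mod (u, v, w)"
  shows "lower_half U u \<or> lower_half U v"
proof (rule ccontr)
  assume *: "\<not> ?thesis"
  obtain b0 where b0: "b0 \<in> U" "u \<^bold>\<and> b0 \<bowtie> v \<^bold>\<and> b0" "(u \<^bold>\<and> b0) \<uplus> (v \<^bold>\<and> b0) = w \<^bold>\<and> b0" 
    and M: "u \<in> M" "v \<in> M" "w \<in> M"
    using assms unfolding sum_mod_def by auto
  obtain c where c: "c \<in> U" "u\<^sup>\<bottom> \<^bold>\<and> c \<preceq> u" using upper_half[OF M(1)] * by auto
  define b where "b = b0 \<^bold>\<and> c"
  have b: "b \<in> U" "sharp b" "b \<preceq> b0" "b \<preceq> c" unfolding b_def using b0 c by auto
  have o: "u \<^bold>\<and> b \<bowtie> v \<^bold>\<and> b"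
    using sum_meet_sharp_mono(1)[OF b(2) M(1,2) b(3) _ b0(2,3)] b0(1) by auto
  have "u \<^bold>\<and> b \<uplus> (v \<^bold>\<and> b) \<preceq> b"
    using sum_meet_sharp_mono(2)[OF b(2) M(1,2) b(3) _ b0(2,3)] b0(1) by auto
  then have "v \<^bold>\<and> b \<preceq> u\<^sup>\<bottom> \<^bold>\<and> b"
    using o b(2) M by (simp add: meet_sharp_compl_eq le_diff_iff)
  also have "u\<^sup>\<bottom> \<^bold>\<and> b \<preceq> u \<^bold>\<and> b"
    using c(2) b(4) by (simp, meson E.inf_mono E.order_refl le_trans)
  also have "u \<^bold>\<and> b \<preceq> (v \<^bold>\<and> b)\<^sup>\<bottom>" using o by (simp add: orth_iff_le)
  finally have "v \<^bold>\<and> b \<preceq> (v \<^bold>\<and> b)\<^sup>\<bottom> \<^bold>\<and> b" by simp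
  also have "(v \<^bold>\<and> b)\<^sup>\<bottom> \<^bold>\<and> b = v\<^sup>\<bottom> \<^bold>\<and> b"
    using b(2) M by (simp add: meet_sharp_compl_eq E.inf_assoc)
  finally have "v \<^bold>\<and> b \<preceq> v\<^sup>\<bottom>" by simp
  then show False using * b(1) unfolding lower_half_def by blast
qed

lemma omega_sum_mod:
  assumes "sum_mod t"
  shows "(\<lambda>(u, v, w). omega U u + omega U v - omega U w) t = 0"
proof (rule zero_if_halving[where P = sum_mod and K = 2, OF _ _ assms])
  fix t :: "'a \<times> 'a \<times> 'a"
  obtain u v w where t: "t = (u, v, w)" by (cases t)
  show "\<bar>case t of (u, v, w) \<Rightarrow> omega U u + omega U v - omega U w\<bar> \<le> 2"
    using omega_ge_0[of U u] omega_le_1[of U u] omega_ge_0[of U v] omega_le_1[of U v]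
      omega_ge_0[of U w] omega_le_1[of U w] by (simp add: t)
  assume st: "sum_mod t"
  then consider "lower_half U u" | "lower_half U v" using sum_mod_lower_half t by blast
  then show "(case t of (u, v, w) \<Rightarrow> omega U u + omega U v - omega U w) = 0 \<or>
    (\<exists>y. sum_mod y \<and> \<bar>case t of (u, v, w) \<Rightarrow> omega U u + omega U v - omega U w\<bar> \<le>
       \<bar>case y of (u, v, w) \<Rightarrow> omega U u + omega U v - omega U w\<bar> / 2)"
  proof cases
    case 1
    then show ?thesis using sum_mod_halving[of u v w] st t by auto
  next
    case 2
    then show ?thesis using sum_mod_halving[of v u w] sum_mod_sym[of u v w] st t by (auto simp: add.commute)
  qed
qed

lemma omega_sum:
  assumes "u \<in> M" "v \<in> M" "u \<bowtie> v"
  shows "omega U (u \<uplus> v) = omega U u + omega U v"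
proof -
  have "sum_mod (u, v, u \<uplus> v)"
    using assms by (intro sum_modI[of _ _ _ one]) simp_all
  from omega_sum_mod[OF this] show ?thesis by simp
qed

lemma omega_mono:
  assumes "u \<in> M" "v \<in> M" "u \<preceq> v"
  shows "omega U u \<le> omega U v"
  using omega_sum[of u "v \<setminus> u"] diff_sum[OF assms(3)] assms omega_ge_0[of U "v \<setminus> u"] by simp

lemma omega_meet:
  assumes "b \<in> U" "x \<in> M"
  shows "omega U (x \<^bold>\<and> b) = omega U x"
  by (rule omega_cong[OF assms(1)]) (use assms in \<open>simp_all add: E.inf_assoc\<close>)

end

declare ultra_sharp [simp del]

end

context effect_algebra_block
begin

section \<open>Ultrafilters that preserve countably many suprema\<close>

lemma ultra_upward:
  assumes "ultra U" "b \<in> U" "sharp c" "b \<preceq> c"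
  shows "c \<in> U"
proof (rule ccontr)
  assume "c \<notin> U"
  then have "b \<^bold>\<and> c\<^sup>\<bottom> \<in> U"
    using ultra_cases[OF assms(1,3)] ultra_meet[OF assms(1,2)] by auto
  moreover have "b \<^bold>\<and> c\<^sup>\<bottom> = zero" using sharp_disjoint[OF assms(3)] assms(4) by (rule disjoint_mono)
  ultimately show False using ultra_zero[OF assms(1)] by simp
qed

lemma omega_double_le:
  assumes "ultra U" "a \<in> M"
  shows "omega U (double a) \<le> 2 * omega U a"
  unfolding double_def
  using omega_sum[OF assms(1), of a "a \<^bold>\<and> a\<^sup>\<bottom>"] omega_mono[OF assms(1), of "a \<^bold>\<and> a\<^sup>\<bottom>" a] assms(2)
  by (simp add: orth_meet_compl)

text \<open>
  The Archimedean property. If doubling never overflowed, all multiples \<open>2\<^sup>n a\<close> would exist, and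
  their supremum \<open>s\<close> would satisfy \<open>s \<preceq> s \<setminus> a\<close>, since \<open>2\<^sup>n a + a\<close> is below \<open>2\<^sup>n\<^sup>+\<^sup>1 a\<close>.
\<close>

lemma ex_not_lower_half:
  assumes "a \<noteq> zero"
  shows "\<exists>n. \<not> (double ^^ n) a \<preceq> ((double ^^ n) a)\<^sup>\<bottom>"
proof (rule ccontr)
  assume "\<not> ?thesis"
  then have le: "(double ^^ n) a \<preceq> ((double ^^ n) a)\<^sup>\<bottom>" for n by auto
  define D where "D n = (double ^^ n) a" for n
  have orth: "D n \<bowtie> D n" for n using le unfolding D_def by (simp add: orth_iff_le)
  have D: "D (Suc n) = D n \<uplus> D n" for n
    using le[of n] unfolding D_def by (simp add: double_def E.inf_absorb1)
  have aD: "a \<preceq> D n" for n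
  proof (induction n)
    case (Suc n)
    then show ?case using le_sum(1)[OF orth[of n]] D[of n] le_trans by simp
  qed (simp add: D_def)
  define s where "s = ea_Sup (range D)"
  have Ds: "D n \<preceq> s" for n unfolding s_def by (rule E.Sup_upper) simp
  have as: "a \<preceq> s" using aD[of 0] Ds[of 0] le_trans by blast
  have "D n \<preceq> s \<setminus> a" for n
  proof -
    have "a \<bowtie> D n" using aD[of n] orth[of n] orth_mono le_refl by blast
    moreover have "a \<uplus> D n \<preceq> D (Suc n)" unfolding D using aD orth by (intro sum_mono) auto
    ultimately show ?thesis using Ds[of "Suc n"] le_trans by (simp add: le_diff_iff[OF as]) 
  qed
  then have "s \<preceq> s \<setminus> a" unfolding s_def by (intro E.Sup_least) auto
  then show False using le_diff_self_imp_zero[OF as] assms by simp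
qed

text \<open>
  Some iterated double \<open>d\<close> of \<open>a\<close> is at least one half on a sharp element \<open>p\<^sup>\<bottom>\<close>, and the
  value of \<open>d\<close> is at most \<open>2\<^sup>n\<close> times that of \<open>a\<close>.
\<close>

lemma ex_sharp_omega_pos:
  assumes "a \<in> M" "a \<noteq> zero"
  shows "\<exists>b. sharp b \<and> b \<noteq> zero \<and> (\<forall>U. ultra U \<longrightarrow> b \<in> U \<longrightarrow> omega U a > 0)"
proof -
  obtain n where n: "\<not> (double ^^ n) a \<preceq> ((double ^^ n) a)\<^sup>\<bottom>" using ex_not_lower_half[OF assms(2)] by auto
  have M: "(double ^^ k) a \<in> M" for k by (induction k) (use assms in auto)
  define d where "d = (double ^^ n) a"
  have d: "d \<in> M" "\<not> d \<preceq> d\<^sup>\<bottom>" unfolding d_def using M n by auto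
  obtain p where p: "sharp p" "d \<^bold>\<and> p \<preceq> d\<^sup>\<bottom>" "d\<^sup>\<bottom> \<^bold>\<and> p\<^sup>\<bottom> \<preceq> d"
    using ex_sharp_comparison[of d "d\<^sup>\<bottom>"] d by auto
  have "p\<^sup>\<bottom> \<noteq> zero" using p(2) d(2) by auto
  moreover have "omega U a > 0" if U: "ultra U" "p\<^sup>\<bottom> \<in> U" for U
  proof -
    have "omega U (d\<^sup>\<bottom>) = omega U (d\<^sup>\<bottom> \<^bold>\<and> p\<^sup>\<bottom>)" using omega_meet[OF U] d by simp
    also have "\<dots> \<le> omega U d" using p d by (intro omega_mono[OF U(1)]) auto
    finally have "omega U d \<ge> 1/2" using omega_compl[OF U(1) d(1)] by simp
    moreover have "omega U ((double ^^ k) a) \<le> 2 ^ k * omega U a" for k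
    proof (induction k)
      case (Suc k)
      then show ?case using omega_double_le[OF U(1) M[of k]] by simp
    qed simp
    then have "omega U d \<le> 2 ^ n * omega U a" unfolding d_def .
    ultimately have "2 ^ n * omega U a > 0" by linarith
    then show ?thesis by (simp add: zero_less_mult_iff)
  qed
  ultimately show ?thesis using sharp_compl[OF p(1)] by (intro exI[of _ "p\<^sup>\<bottom>"]) simp
qed

lemma le_of_decseq:
  assumes "\<And>k. d (Suc k) \<preceq> d k" "i \<le> j"
  shows "d j \<preceq> d i"
  using assms(2) by (induction rule: dec_induct) (use assms(1) le_trans in auto)

lemma le_of_incseq:
  assumes "\<And>k. d k \<preceq> d (Suc k)" "i \<le> j"
  shows "d i \<preceq> d j"
  using assms(2) by (induction rule: dec_induct) (use assms(1) le_trans in auto)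

text \<open>
  A sequence that decreases to \<open>zero\<close> becomes small on some sharp piece of any given sharp
  element \<open>b\<close>. If all \<open>d k\<close> were at least one half everywhere on \<open>b\<close>, then \<open>(d i)\<^sup>\<bottom> \<^bold>\<and> b\<close> would be below
  all of them, hence \<open>zero\<close>, and \<open>b\<close> would be below every \<open>d i\<close>. So some \<open>d k0\<close> is at most one half on
  a piece \<open>b1\<close> of \<open>b\<close>. There the sequence can be doubled, it still decreases to \<open>zero\<close>, and the
  induction hypothesis applies to the doubled sequence.
\<close>

lemma ex_sharp_omega_small:
  assumes "\<And>k. d k \<in> M" "\<And>k. d (Suc k) \<preceq> d k" "ea_Inf (range d) = zero" "sharp b" "b \<noteq> zero"
  shows "\<exists>k c. sharp c \<and> c \<noteq> zero \<and> c \<preceq> b \<and> (\<forall>U. ultra U \<longrightarrow> c \<in> U \<longrightarrow> omega U (d k) \<le> (1/2) ^ m)"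
  using assms
proof (induction m arbitrary: d b)
  case 0
  then show ?case using omega_le_1 le_refl by auto
next
  case (Suc m)
  note dM = Suc.prems(1) and dec = le_of_decseq[of d, OF Suc.prems(2)] and inf = Suc.prems(3)
  have lower_zero: "x = zero" if "\<And>j. x \<preceq> d j" for x
    using E.Inf_greatest[of "range d" x] that inf by auto
  have "\<exists>p. sharp p \<and> d k \<^bold>\<and> p \<preceq> (d k)\<^sup>\<bottom> \<and> (d k)\<^sup>\<bottom> \<^bold>\<and> p\<^sup>\<bottom> \<preceq> d k" for k
    using ex_sharp_comparison[of "d k" "(d k)\<^sup>\<bottom>"] dM by auto
  then obtain p where p: "\<And>k. sharp (p k)" "\<And>k. d k \<^bold>\<and> p k \<preceq> (d k)\<^sup>\<bottom>"
    "\<And>k. (d k)\<^sup>\<bottom> \<^bold>\<and> (p k)\<^sup>\<bottom> \<preceq> d k" by metis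
  have "\<exists>k. b \<^bold>\<and> p k \<noteq> zero"
  proof (rule ccontr)
    assume "\<not> ?thesis"
    then have bp: "b \<preceq> (p k)\<^sup>\<bottom>" for k using le_sharp_iff[of "(p k)\<^sup>\<bottom>" b] p(1)[of k] Suc.prems(4) by simp
    have "(d i)\<^sup>\<bottom> \<^bold>\<and> b \<preceq> d j" for i j
    proof -
      let ?k = "max i j"
      have "(d i)\<^sup>\<bottom> \<^bold>\<and> b \<preceq> (d ?k)\<^sup>\<bottom> \<^bold>\<and> (p ?k)\<^sup>\<bottom>"
        using dec[of i ?k] bp[of ?k] by (intro E.inf_mono) auto
      also have "\<dots> \<preceq> d ?k" by (rule p)
      also have "\<dots> \<preceq> d j" by (rule dec) simp
      finally show ?thesis .
    qed
    then have "(d i)\<^sup>\<bottom> \<^bold>\<and> b = zero" for i by (rule lower_zero)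
    then have "b \<preceq> d i" for i
      using disjoint_compatible(1)[OF block_compatible, of "(d i)\<^sup>\<bottom>" b] dM[of i] Suc.prems(4)
      by (simp add: orth_iff_le)
    then show False using lower_zero Suc.prems(5) by blast
  qed
  then obtain k0 where k0: "b \<^bold>\<and> p k0 \<noteq> zero" by auto
  define b1 where "b1 = b \<^bold>\<and> p k0"
  have b1: "sharp b1" "b1 \<noteq> zero" "b1 \<preceq> b" unfolding b1_def using k0 p(1) Suc.prems(4) by auto
  define x where "x j = d (k0 + j) \<^bold>\<and> b1" for j
  have xM: "x j \<in> M" for j unfolding x_def using dM b1 by simp
  have xd: "x j \<preceq> d j" "x j \<preceq> d k0" for j
    using dec[of j "k0 + j"] dec[of k0 "k0 + j"] unfolding x_def by (auto intro: E.le_infI1)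
  have xd': "x j \<preceq> (d k0)\<^sup>\<bottom>" for j
  proof -
    \<comment> \<open>The doubles of \<open>x\<close> exist because \<open>x j\<close> lies in the lower half of \<open>d k0\<close>.\<close>
    have "x j \<preceq> d k0 \<^bold>\<and> p k0" using xd(2)[of j] unfolding x_def b1_def by (auto intro: E.le_infI2)
    then show ?thesis using p(2) le_trans by blast
  qed
  have xx: "x i \<bowtie> x j" for i j
    using xd'[of i] xd(2)[of j] by (metis orth_iff_le compl_le_iff le_trans)
  have xdec: "x j \<preceq> x i" if "i \<le> j" for i j
    unfolding x_def using that dec by (intro E.inf_mono) auto
  define e where "e j = x j \<uplus> x j" for j
  have inf_e: "ea_Inf (range e) = zero"
  proof -
    define r where "r = ea_Inf (range e)"
    have eM: "range e \<subseteq> M" unfolding e_def using xM xx by auto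
    have rM: "r \<in> M" unfolding r_def by (rule block_Inf[OF eM])
    \<comment> \<open>By Riesz decomposition, the part of \<open>r\<close> outside \<open>x j\<close> is below every \<open>x i\<close>, hence below every \<open>d i\<close>.\<close>
    have "r \<preceq> x j" for j
    proof -
      have "r \<setminus> (r \<^bold>\<and> x j) \<preceq> d i" for i
      proof -
        let ?k = "max i j"
        have "r \<preceq> e ?k" unfolding r_def by (rule E.Inf_lower) simp
        also have "e ?k \<preceq> x j \<uplus> x i" unfolding e_def by (intro sum_mono xdec xx) auto
        finally have "r \<setminus> (r \<^bold>\<and> x j) \<preceq> x i" by (intro diff_meet_le_of_le_sum rM xM xx)
        then show ?thesis using xd(1)[of i] le_trans by blast
      qed
      then have "r \<setminus> (r \<^bold>\<and> x j) = zero" by (rule lower_zero)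
      then have "r \<^bold>\<and> x j = r" by (rule diff_eq_zero[rotated]) simp
      then show ?thesis by (metis E.inf_le2)
    qed
    then have "r = zero" using lower_zero xd(1) le_trans by blast
    then show ?thesis unfolding r_def .
  qed
  have "\<exists>k c. sharp c \<and> c \<noteq> zero \<and> c \<preceq> b1 \<and> (\<forall>U. ultra U \<longrightarrow> c \<in> U \<longrightarrow> omega U (e k) \<le> (1/2) ^ m)"
  proof (rule Suc.IH[OF _ _ inf_e b1(1,2)])
    show "e k \<in> M" for k unfolding e_def by (intro block_sum xM xx)
    show "e (Suc k) \<preceq> e k" for k unfolding e_def by (intro sum_mono xdec xx) auto
  qed
  then obtain k c where kc: "sharp c" "c \<noteq> zero" "c \<preceq> b1"
    "\<And>U. ultra U \<Longrightarrow> c \<in> U \<Longrightarrow> omega U (e k) \<le> (1/2) ^ m" by blast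
  have "omega U (d (k0 + k)) \<le> (1/2) ^ Suc m" if U: "ultra U" "c \<in> U" for U
  proof -
    have "b1 \<in> U" using ultra_upward[OF U b1(1) kc(3)] .
    then have "omega U (d (k0 + k)) = omega U (x k)" 
      unfolding x_def using omega_meet[OF U(1)] dM by simp
    then show ?thesis using omega_sum[OF U(1) xM xM xx, of k k] kc(4)[OF U] unfolding e_def by simp
  qed
  moreover have "c \<preceq> b" using kc(3) b1(3) by (rule le_trans)
  ultimately show ?case using kc(1,2) by (intro exI[of _ "k0 + k"] exI[of _ c]) simp
qed

definition increasing :: "(nat \<Rightarrow> 'a) \<Rightarrow> bool" where
  "increasing s \<longleftrightarrow> (\<forall>n. s n \<in> M \<and> s n \<preceq> s (Suc n))"

definition sup_preserving :: "'a set \<Rightarrow> (nat \<Rightarrow> 'a) set \<Rightarrow> bool" where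
  "sup_preserving U T \<longleftrightarrow> ultra U \<and> (\<forall>s\<in>T. (\<lambda>n. omega U (s n)) \<longlonglongrightarrow> omega U (ea_Sup (range s)))"

lemma ex_sharp_omega_close:
  assumes "increasing s" "sharp b" "b \<noteq> zero"
  shows "\<exists>k c. sharp c \<and> c \<noteq> zero \<and> c \<preceq> b \<and>
    (\<forall>U. ultra U \<longrightarrow> c \<in> U \<longrightarrow> omega U (ea_Sup (range s)) - omega U (s k) \<le> (1/2) ^ m)"
proof -
  define S where "S = ea_Sup (range s)"
  have s: "s k \<in> M" "s k \<preceq> s (Suc k)" "s k \<preceq> S" for k
    using assms(1) unfolding increasing_def S_def by (auto intro: E.Sup_upper)
  have SM: "S \<in> M" unfolding S_def using s by (intro block_Sup) auto
  define l where "l = ea_Inf (range (\<lambda>k. S \<setminus> s k))"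
  have ls: "l \<preceq> S \<setminus> s k" for k unfolding l_def by (rule E.Inf_lower) simp
  then have lS: "l \<preceq> S" using diff_sum(5)[OF s(3)] le_trans by blast
  have "s k \<preceq> S \<setminus> l" for k
    using ls[of k] s(3)[of k] lS by (simp add: le_diff_iff orth_commute sum_of_commute)
  then have "S \<preceq> S \<setminus> l" unfolding S_def by (intro E.Sup_least) auto
  then have l0: "l = zero" using le_diff_self_imp_zero lS by blast
  have "\<exists>k c. sharp c \<and> c \<noteq> zero \<and> c \<preceq> b \<and> (\<forall>U. ultra U \<longrightarrow> c \<in> U \<longrightarrow> omega U (S \<setminus> s k) \<le> (1/2) ^ m)"
    using s SM assms(2,3) l0 unfolding l_def by (intro ex_sharp_omega_small) (auto intro: diff_antimono)
  moreover have "omega U S - omega U (s k) = omega U (S \<setminus> s k)" if "ultra U" for U k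
    using omega_sum[OF that, of "s k" "S \<setminus> s k"] s[of k] SM by (simp add: diff_sum)
  ultimately show ?thesis unfolding S_def by metis
qed

lemma sup_preserving_of_close:
  assumes "ultra U" "increasing s"
    "\<And>m. \<exists>k. omega U (ea_Sup (range s)) - omega U (s k) \<le> (1/2) ^ m"
  shows "(\<lambda>n. omega U (s n)) \<longlonglongrightarrow> omega U (ea_Sup (range s))"
proof (rule LIMSEQ_I)
  fix e :: real assume "e > 0"
  then obtain m where m: "(1/2) ^ m < e" using real_arch_pow_inv[of e "1/2"] by auto
  obtain k where k: "omega U (ea_Sup (range s)) - omega U (s k) \<le> (1/2) ^ m" using assms(3) by auto
  have s: "\<And>n. s n \<in> M" "\<And>n. s n \<preceq> s (Suc n)" using assms(2) by (auto simp: increasing_def)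
  have SM: "ea_Sup (range s) \<in> M" using s by (intro block_Sup) auto
  have "norm (omega U (s n) - omega U (ea_Sup (range s))) < e" if "n \<ge> k" for n
  proof -
    have "omega U (s k) \<le> omega U (s n)"
      using assms(1) s le_of_incseq[of s, OF s(2) that] by (intro omega_mono) auto
    moreover have "omega U (s n) \<le> omega U (ea_Sup (range s))"
      using assms(1) s SM by (intro omega_mono E.Sup_upper) auto
    ultimately show ?thesis using k m by simp
  qed
  then show "\<exists>no. \<forall>n\<ge>no. norm (omega U (s n) - omega U (ea_Sup (range s))) < e" by blast
qed

text \<open>
  A Rasiowa-Sikorski construction. Inside a sharp element on which the excess \<open>a1\<close> of \<open>a\<close> over
  \<open>c\<close> has positive value, choose successively smaller sharp elements, each of which forces one of
  the countably many conditions \<open>omega U (ea_Sup (range s)) - omega U (s k) \<le> (1/2) ^ m\<close> for some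
  \<open>k\<close>. Any ultrafilter that contains the chosen elements preserves the suprema. As the excess \<open>c1\<close>
  of \<open>c\<close> over \<open>a\<close> is disjoint from \<open>a1\<close>, its value is then zero.
\<close>

lemma ex_sup_preserving_omega_less:
  assumes "countable T" "\<And>s. s \<in> T \<Longrightarrow> increasing s" "a \<in> M" "c \<in> M" "\<not> a \<preceq> c"
  shows "\<exists>U. sup_preserving U T \<and> omega U c < omega U a"
proof -
  define m a1 c1 where "m = a \<^bold>\<and> c" and "a1 = a \<setminus> m" and "c1 = c \<setminus> m"
  have m: "m \<preceq> a" "m \<preceq> c" "m \<in> M" unfolding m_def using assms by auto
  have M: "a1 \<in> M" "c1 \<in> M" unfolding a1_def c1_def using m assms by auto
  have "a1 \<noteq> zero" using diff_eq_zero[OF m(1)] assms(5) m(2) unfolding a1_def by auto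
  then obtain b0 where b0: "sharp b0" "b0 \<noteq> zero" "\<And>U. ultra U \<Longrightarrow> b0 \<in> U \<Longrightarrow> omega U a1 > 0"
    using ex_sharp_omega_pos[OF M(1)] by auto
  \<comment> \<open>The constant sequence only ensures that the set to be enumerated is nonempty.\<close>
  define T' where "T' = insert (\<lambda>_. zero) T"
  have T': "countable T'" "\<And>s. s \<in> T' \<Longrightarrow> increasing s"
    using assms(1,2) unfolding T'_def by (auto simp: increasing_def)
  define f where "f = from_nat_into (T' \<times> (UNIV::nat set))"
  have f: "range f = T' \<times> UNIV" unfolding f_def
    by (rule range_from_nat_into) (use T' in \<open>auto simp: T'_def\<close>)
  have "\<exists>B. \<forall>n::nat. (sharp (B n) \<and> B n \<noteq> zero \<and> (n = 0 \<longrightarrow> B n = b0)) \<and> (B (Suc n) \<preceq> B n \<and>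
     (\<exists>k. \<forall>U. ultra U \<longrightarrow> B (Suc n) \<in> U \<longrightarrow>
        omega U (ea_Sup (range (fst (f n)))) - omega U (fst (f n) k) \<le> (1/2) ^ snd (f n)))"
  proof (rule dependent_nat_choice)
    fix b and n :: nat assume b: "sharp b \<and> b \<noteq> zero \<and> (n = 0 \<longrightarrow> b = b0)"
    have "f n \<in> T' \<times> UNIV" using f by auto
    then have "increasing (fst (f n))" by (intro T'(2)) auto
    from ex_sharp_omega_close[OF this, of b "snd (f n)"] b obtain k y
      where y: "sharp y \<and> y \<noteq> zero \<and> y \<preceq> b \<and> (\<forall>U. ultra U \<longrightarrow> y \<in> U \<longrightarrow>
         omega U (ea_Sup (range (fst (f n)))) - omega U (fst (f n) k) \<le> (1/2) ^ snd (f n))"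
      by auto
    show "\<exists>y. (sharp y \<and> y \<noteq> zero \<and> (Suc n = 0 \<longrightarrow> y = b0)) \<and> y \<preceq> b \<and>
      (\<exists>k. \<forall>U. ultra U \<longrightarrow> y \<in> U \<longrightarrow>
         omega U (ea_Sup (range (fst (f n)))) - omega U (fst (f n) k) \<le> (1/2) ^ snd (f n))"
      by (intro exI[of _ y] conjI exI[of _ k]) (simp_all add: y)
  qed (use b0 in auto)
  then obtain B where B': "\<And>n. (sharp (B n) \<and> B n \<noteq> zero \<and> (n = 0 \<longrightarrow> B n = b0)) \<and> (B (Suc n) \<preceq> B n \<and>
     (\<exists>k. \<forall>U. ultra U \<longrightarrow> B (Suc n) \<in> U \<longrightarrow>
        omega U (ea_Sup (range (fst (f n)))) - omega U (fst (f n) k) \<le> (1/2) ^ snd (f n)))"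
    by blast
  have B: "sharp (B n)" "B n \<noteq> zero" "B 0 = b0" "B (Suc n) \<preceq> B n"
    "\<exists>k. \<forall>U. ultra U \<longrightarrow> B (Suc n) \<in> U \<longrightarrow>
        omega U (ea_Sup (range (fst (f n)))) - omega U (fst (f n) k) \<le> (1/2) ^ snd (f n)" for n
    using B'[of n] B'[of 0] by simp_all
  have "B i \<^bold>\<and> B j \<in> range B" for i j
  proof (cases "i \<le> j")
    case True
    then show ?thesis using le_of_decseq[of B, OF B(4) True] by (simp add: E.inf_absorb2)
  next
    case False
    then show ?thesis using le_of_decseq[of B j i, OF B(4)] by (simp add: E.inf_absorb1)
  qed
  moreover have "one \<noteq> zero" using B(2)[of 0] le_one[of "B 0"] by (metis le_zero)
  ultimately have "\<exists>U. insert one (range B) \<subseteq> U \<and> ultra U"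
    using B(1,2) by (intro ex_ultra) (auto simp: eq_commute[of zero] intro: le_antisym)
  then obtain U where U: "ultra U" "\<And>n. B n \<in> U" by auto
  have "(\<lambda>n. omega U (s n)) \<longlonglongrightarrow> omega U (ea_Sup (range s))" if "s \<in> T" for s
  proof (rule sup_preserving_of_close[OF U(1) assms(2)[OF that]])
    fix m
    have "(s, m) \<in> range f" using that unfolding f T'_def by simp
    then obtain n where "f n = (s, m)" by auto
    then show "\<exists>k. omega U (ea_Sup (range s)) - omega U (s k) \<le> (1/2) ^ m"
      using B(5)[of n] U by auto
  qed
  then have "sup_preserving U T" unfolding sup_preserving_def using U(1) by blast
  moreover have "omega U c < omega U a"
  proof -
    have pos: "omega U a1 > 0" using b0(3)[OF U(1)] U(2)[of 0] B(3) by simp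
    have disj: "a1 \<^bold>\<and> c1 = zero" unfolding a1_def c1_def m_def by (rule diff_meet_disjoint)
    obtain p where p: "sharp p" "p \<^bold>\<and> a1 = zero" "\<And>x. x \<in> M \<Longrightarrow> x \<^bold>\<and> a1 = zero \<Longrightarrow> x \<preceq> p"
      using ex_polar[OF M(1)] by auto
    \<comment> \<open>On the polar of \<open>a1\<close> the value of \<open>a1\<close> would be zero.\<close>
    have "p \<notin> U"
      using omega_meet[OF U(1) _ M(1), of p] p(2) pos omega_zero[OF U(1)] by (auto simp: E.inf_commute)
    then have "p\<^sup>\<bottom> \<in> U" using ultra_cases[OF U(1) p(1)] by simp
    moreover have "c1 \<preceq> p" using p(3)[OF M(2)] disj by (simp add: E.inf_commute)
    then have "c1 \<^bold>\<and> p\<^sup>\<bottom> = zero" using sharp_disjoint[OF p(1)] by (rule disjoint_mono[rotated])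
    ultimately have "omega U c1 = 0" using omega_meet[OF U(1) _ M(2)] omega_zero[OF U(1)] by metis
    moreover have "omega U a = omega U m + omega U a1" "omega U c = omega U m + omega U c1"
      using omega_sum[OF U(1) m(3), of a1] omega_sum[OF U(1) m(3), of c1] M m
      unfolding a1_def c1_def by (simp_all add: diff_sum)
    ultimately show ?thesis using pos by simp
  qed
  ultimately show ?thesis by blast
qed

lemma le_if_omega_le:
  assumes "countable T" "\<And>s. s \<in> T \<Longrightarrow> increasing s" "a \<in> M" "c \<in> M"
    "\<And>U. sup_preserving U T \<Longrightarrow> omega U a \<le> omega U c"
  shows "a \<preceq> c"
  using ex_sup_preserving_omega_less[OF assms(1-4)] assms(5) by force

end

section \<open>Extension of spectral families to observables\<close>

lemma borel_induct_lessThan [consumes 1, case_names lessThan empty compl union]: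
  fixes B :: "real set"
  assumes "B \<in> sets borel"
    and lessThan: "\<And>t. P {..<t}"
    and empty: "P {}"
    and compl: "\<And>A. A \<in> sets borel \<Longrightarrow> P A \<Longrightarrow> P (UNIV - A)"
    and union: "\<And>A :: nat \<Rightarrow> real set. disjoint_family A \<Longrightarrow> (\<And>i. A i \<in> sets borel) \<Longrightarrow>
      (\<And>i. P (A i)) \<Longrightarrow> P (\<Union>i. A i)"
  shows "P B"
proof -
  have borel: "sets borel = sigma_sets UNIV (range (lessThan :: real \<Rightarrow> real set))"
    unfolding borel_Iio by simp
  have "Int_stable (range (lessThan :: real \<Rightarrow> real set))"
    unfolding Int_stable_def
  proof (intro ballI)
    fix A B :: "real set" assume "A \<in> range lessThan" "B \<in> range lessThan"
    then obtain a b where "A = {..<a}" "B = {..<b}" by auto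
    then have "A \<inter> B = {..<min a b}" by auto
    then show "A \<inter> B \<in> range lessThan" by blast
  qed
  moreover have "range (lessThan :: real \<Rightarrow> real set) \<subseteq> Pow UNIV" by simp
  ultimately show ?thesis
    using assms(1)[unfolded borel]
  proof (induction rule: sigma_sets_induct_disjoint)
    case (union A)
    then show ?case by (intro assms(5)) (auto simp: borel)
  qed (use lessThan empty compl in \<open>auto simp: borel\<close>)
qed

text \<open>
  Stieltjes measures are built from right continuous functions, so the line is reflected at 0.
\<close>

lemma ex_measure_with_distribution:
  fixes f :: "real \<Rightarrow> real"
  assumes mono: "\<And>s t. s \<le> t \<Longrightarrow> f s \<le> f t"
    and left: "\<And>t e. e > 0 \<Longrightarrow> \<exists>s<t. f t - e < f s"
    and f0: "\<And>t. t \<le> l \<Longrightarrow> f t = 0" and f1: "\<And>t. r < t \<Longrightarrow> f t = 1"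
  shows "\<exists>P. prob_space P \<and> sets P = sets borel \<and> (\<forall>t. measure P {..<t} = f t)"
proof -
  define G where "G x = 1 - f (- x)" for x
  have G: "G x \<le> G y" if "x \<le> y" for x y using mono[of "-y" "-x"] that unfolding G_def by simp
  have "\<forall>e>0. \<exists>d>0. G (a + d) - G a < e" for a
  proof (intro allI impI)
    fix e :: real assume "0 < e"
    then obtain s where s: "s < -a" "f (-a) - e < f s" using left by blast
    show "\<exists>d>0. G (a + d) - G a < e"
    proof (intro exI conjI)
      show "0 < - a - s" using s by simp
      show "G (a + (- a - s)) - G a < e" using s(2) unfolding G_def by simp
    qed
  qed
  then have cont: "continuous (at_right a) G" for a
    using continuous_at_right_real_increasing[of G a] G by blast
  have "\<forall>\<^sub>F x in at_bot. G x = 0"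
    using eventually_at_bot_dense[of "\<lambda>x. G x = 0"] f1 unfolding G_def
    by (intro eventually_at_bot_dense[THEN iffD2] exI[of _ "- r"]) auto
  then have bot: "(G \<longlongrightarrow> 0) at_bot" by (rule tendsto_eventually)
  have "\<forall>\<^sub>F x in at_top. G x = 1"
    unfolding G_def eventually_at_top_linorder by (intro exI[of _ "- l"]) (auto intro: f0)
  then have top: "(G \<longlongrightarrow> 1) at_top" by (rule tendsto_eventually)
  define Q where "Q = interval_measure G"
  interpret Q: real_distribution Q
    unfolding Q_def by (rule real_distribution_interval_measure[OF G cont bot top])
  define P where "P = distr Q borel (\<lambda>x. - x)"
  have "measure P {..<t} = f t" for t
  proof -
    have "measure P {..<t} = measure Q ((\<lambda>x. - x) -` {..<t} \<inter> space Q)"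
      unfolding P_def by (subst measure_distr) auto
    also have "(\<lambda>x. - x) -` {..<t} \<inter> space Q = space Q - {..- t}" by auto
    also have "measure Q (space Q - {..- t}) = 1 - measure Q {..- t}" by (rule Q.prob_compl) simp
    also have "measure Q {..- t} = G (- t)"
      unfolding Q_def by (rule measure_interval_measure_Iic[OF G cont bot])
    finally show ?thesis by (simp add: G_def)
  qed
  moreover have "prob_space P" unfolding P_def by (rule Q.prob_space_distr) simp
  moreover have "sets P = sets borel" unfolding P_def by simp
  ultimately show ?thesis by blast
qed

locale spectral_family = effect_algebra_block +
  fixes F :: "real \<Rightarrow> 'a" and l r :: real
  assumes F_block: "F t \<in> M"
    and F_mono: "s \<le> t \<Longrightarrow> F s \<preceq> F t"
    and F_left: "F t = ea_Sup (F ` {..<t})"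
    and F_zero: "t \<le> l \<Longrightarrow> F t = zero"
    and F_one: "r < t \<Longrightarrow> F t = one"
begin

text \<open>
  Left limits are taken because \<open>omega U\<close> need not preserve the suprema
  \<open>F t = ea_Sup (F ` {..<t})\<close>.
\<close>

definition distribution :: "'a set \<Rightarrow> real measure \<Rightarrow> bool" where
  "distribution U P \<longleftrightarrow> prob_space P \<and> sets P = sets borel \<and>
     (\<forall>t. measure P {..<t} = (SUP s\<in>{..<t}. omega U (F s)))"

text \<open>
  The countable set \<open>T\<close> of sequences whose suprema \<open>U\<close> must preserve may grow during the induction
  over Borel sets, but it stays countable, so enough ultrafilters remain to separate elements.
\<close>

definition represents :: "real set \<Rightarrow> 'a \<Rightarrow> bool" where
  "represents B a \<longleftrightarrow> a \<in> M \<and> (\<exists>T. countable T \<and> (\<forall>s\<in>T. increasing s) \<and>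
     (\<forall>U P. sup_preserving U T \<longrightarrow> distribution U P \<longrightarrow> omega U a = measure P B))"

lemma representsE:
  assumes "represents B a"
  obtains T where "a \<in> M" "countable T" "\<And>s. s \<in> T \<Longrightarrow> increasing s"
    "\<And>U P. sup_preserving U T \<Longrightarrow> distribution U P \<Longrightarrow> omega U a = measure P B"
proof -
  from assms obtain T where T: "a \<in> M" "countable T" "\<forall>s\<in>T. increasing s"
    "\<forall>U P. sup_preserving U T \<longrightarrow> distribution U P \<longrightarrow> omega U a = measure P B"
    unfolding represents_def by (elim conjE exE)
  show thesis by (rule that[OF T(1,2)]) (use T(3,4) in simp_all)
qed

lemma bdd_above_omega_F: "bdd_above ((\<lambda>s. omega U (F s)) ` S)"
  by (rule bdd_aboveI[of _ 1]) (auto intro: omega_le_1)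

lemma ex_distribution:
  assumes U: "ultra U"
  shows "\<exists>P. distribution U P"
proof -
  have sup_const: "(SUP s\<in>{..<t}. c) = c" for t c :: real
    by (rule cSUP_const) auto
  define f where "f t = (SUP s\<in>{..<t}. omega U (F s))" for t
  have le: "omega U (F s) \<le> f t" if "s < t" for s t
    unfolding f_def using that by (intro cSUP_upper bdd_above_omega_F) auto
  have "\<exists>P. prob_space P \<and> sets P = sets borel \<and> (\<forall>t. measure P {..<t} = f t)"
  proof (rule ex_measure_with_distribution[where l = l and r = "r + 1"])
    show "f s \<le> f t" if "s \<le> t" for s t
      unfolding f_def using that by (intro cSUP_subset_mono bdd_above_omega_F) auto
    show "\<exists>s<t. f t - e < f s" if "e > 0" for t e
    proof -
      have "\<exists>u\<in>{..<t}. f t - e < omega U (F u)"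
        using less_cSUP_iff[of "{..<t}" "\<lambda>s. omega U (F s)" "f t - e", OF _ bdd_above_omega_F] that
        unfolding f_def by auto
      then obtain u where u: "u < t" "f t - e < omega U (F u)" by auto
      have "omega U (F u) \<le> f ((u + t) / 2)" using u(1) by (intro le) simp
      then have "f t - e < f ((u + t) / 2)" using u(2) by simp
      moreover have "(u + t) / 2 < t" using u(1) by simp
      ultimately show ?thesis by blast
    qed
    show "f t = 0" if "t \<le> l" for t
    proof -
      have "f t = (SUP s\<in>{..<t}. 0)"
        unfolding f_def by (rule SUP_cong) (use that F_zero omega_zero[OF U] in auto)
      then show ?thesis using sup_const by simp
    qed
    show "f t = 1" if "r + 1 < t" for t
    proof (rule antisym)
      show "f t \<le> 1" unfolding f_def by (rule cSUP_least) (auto intro: omega_le_1)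
      show "1 \<le> f t" using le[of "r + 1" t] that F_one[of "r + 1"] omega_one[OF U] by simp
    qed
  qed
  then show ?thesis unfolding distribution_def f_def .
qed

lemma sup_preserving_subset: "sup_preserving U T \<Longrightarrow> S \<subseteq> T \<Longrightarrow> sup_preserving U S"
  unfolding sup_preserving_def by auto

text \<open>
  The union of the two countable sets of sequences is countable, so inequalities of the values for
  its sup-preserving ultrafilters carry over to the elements.
\<close>

lemma represents_le:
  assumes "represents B a" "represents C c"
    "\<And>U P. distribution U P \<Longrightarrow> measure P B \<le> measure P C"
  shows "a \<preceq> c"
proof -
  obtain S where S: "a \<in> M" "countable S" "\<And>s. s \<in> S \<Longrightarrow> increasing s"
    "\<And>U P. sup_preserving U S \<Longrightarrow> distribution U P \<Longrightarrow> omega U a = measure P B"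
    by (rule representsE[OF assms(1)]) blast
  obtain T where T: "c \<in> M" "countable T" "\<And>s. s \<in> T \<Longrightarrow> increasing s"
    "\<And>U P. sup_preserving U T \<Longrightarrow> distribution U P \<Longrightarrow> omega U c = measure P C"
    by (rule representsE[OF assms(2)]) blast
  show ?thesis
  proof (rule le_if_omega_le[of "S \<union> T"])
    fix U assume U: "sup_preserving U (S \<union> T)"
    then obtain P where P: "distribution U P" using ex_distribution unfolding sup_preserving_def by blast
    show "omega U a \<le> omega U c"
      using S(4)[OF _ P] T(4)[OF _ P] assms(3)[OF P] sup_preserving_subset[OF U] by auto
  qed (use S(1-3) T(1-3) in auto)
qed

lemma represents_unique: "represents B a \<Longrightarrow> represents B c \<Longrightarrow> a = c"
  using represents_le le_antisym by blast

lemma represents_lessThan: "represents {..<t} (F t)"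
proof -
  define s where "s n = F (t - 1 / real (Suc n))" for n
  have inc: "increasing s"
    unfolding increasing_def s_def using F_block by (auto intro!: F_mono frac_le)
  have "ea_Sup (range s) = F t"
  proof (rule le_antisym)
    show "ea_Sup (range s) \<preceq> F t" unfolding s_def by (intro E.Sup_least) (auto intro: F_mono)
    have "F u \<preceq> ea_Sup (range s)" if "u < t" for u
    proof -
      obtain n where "inverse (real (Suc n)) < t - u" using reals_Archimedean[of "t - u"] \<open>u < t\<close> by auto
      then have "F u \<preceq> s n" unfolding s_def by (intro F_mono) (simp add: field_simps)
      also have "s n \<preceq> ea_Sup (range s)" by (rule E.Sup_upper) simp
      finally show ?thesis .
    qed
    then have "ea_Sup (F ` {..<t}) \<preceq> ea_Sup (range s)" by (intro E.Sup_least) auto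
    then show "F t \<preceq> ea_Sup (range s)" using F_left[of t] by simp
  qed
  moreover have "omega U (F t) = measure P {..<t}"
    if U: "ultra U" and P: "distribution U P" and lim: "(\<lambda>n. omega U (s n)) \<longlonglongrightarrow> omega U (F t)" for U P
  proof -
    have "omega U (F t) = (SUP s\<in>{..<t}. omega U (F s))"
    proof (rule antisym)
      show "omega U (F t) \<le> (SUP s\<in>{..<t}. omega U (F s))"
      proof (rule LIMSEQ_le_const2[OF lim])
        have "omega U (s n) \<le> (SUP s\<in>{..<t}. omega U (F s))" for n
          unfolding s_def by (rule cSUP_upper[OF _ bdd_above_omega_F]) simp
        then show "\<exists>N. \<forall>n\<ge>N. omega U (s n) \<le> (SUP s\<in>{..<t}. omega U (F s))" by blast
      qed
      show "(SUP s\<in>{..<t}. omega U (F s)) \<le> omega U (F t)"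
        by (rule cSUP_least) (auto intro!: omega_mono[OF U] F_block F_mono)
    qed
    then show ?thesis using P unfolding distribution_def by simp
  qed
  ultimately show ?thesis
    unfolding represents_def sup_preserving_def using F_block inc by (intro conjI exI[of _ "{s}"]) auto
qed

lemma represents_empty: "represents {} zero"
  unfolding represents_def sup_preserving_def using omega_zero by (intro conjI exI[of _ "{}"]) auto

lemma represents_compl:
  assumes "represents B a" "B \<in> sets borel"
  shows "represents (UNIV - B) (a\<^sup>\<bottom>)"
proof -
  have "measure P (UNIV - B) = 1 - measure P B" if "distribution U P" for U P
  proof -
    interpret prob_space P using that unfolding distribution_def by simp
    have "sets P = sets borel" using that unfolding distribution_def by simp
    then show ?thesis using prob_compl[of B] assms(2) sets_eq_imp_space_eq[of P borel] by simp
  qed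
  moreover obtain T where M: "a \<in> M" and T: "countable T" "\<And>s. s \<in> T \<Longrightarrow> increasing s"
    "\<And>U P. sup_preserving U T \<Longrightarrow> distribution U P \<Longrightarrow> omega U a = measure P B"
    by (rule representsE[OF assms(1)]) blast
  ultimately have "omega U (a\<^sup>\<bottom>) = measure P (UNIV - B)" if "sup_preserving U T" "distribution U P" for U P
    using that omega_compl[OF _ M, of U] by (simp add: sup_preserving_def)
  then show ?thesis using T M unfolding represents_def by (intro conjI exI[of _ T]) auto
qed

text \<open>
  The sum is defined because the measures of disjoint sets add up to at most one.
\<close>

lemma represents_Un:
  assumes "represents B a" "represents C c" "B \<in> sets borel" "C \<in> sets borel" "B \<inter> C = {}"
  shows "a \<bowtie> c" "represents (B \<union> C) (a \<uplus> c)"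
proof -
  have meas: "measure P (B \<union> C) = measure P B + measure P C" "measure P (UNIV - C) = 1 - measure P C"
    "measure P (B \<union> C) \<le> 1"
    if "distribution U P" for U P
  proof -
    interpret prob_space P using that unfolding distribution_def by simp
    have s: "sets P = sets borel" using that unfolding distribution_def by simp
    show "measure P (B \<union> C) = measure P B + measure P C"
      using finite_measure_Union[of B C] assms s by simp
    show "measure P (UNIV - C) = 1 - measure P C"
      using prob_compl[of C] assms s sets_eq_imp_space_eq[of P borel] by simp
    show "measure P (B \<union> C) \<le> 1" by simp
  qed
  have "a \<preceq> c\<^sup>\<bottom>"
  proof (rule represents_le[OF assms(1) represents_compl[OF assms(2,4)]])
    fix U P assume "distribution U P"
    from meas[OF this] show "measure P B \<le> measure P (UNIV - C)" by simp
  qed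
  then show ac: "a \<bowtie> c" by (simp add: orth_iff_le)
  obtain S where S: "a \<in> M" "countable S" "\<And>s. s \<in> S \<Longrightarrow> increasing s"
    "\<And>U P. sup_preserving U S \<Longrightarrow> distribution U P \<Longrightarrow> omega U a = measure P B"
    by (rule representsE[OF assms(1)]) blast
  obtain T where T: "c \<in> M" "countable T" "\<And>s. s \<in> T \<Longrightarrow> increasing s"
    "\<And>U P. sup_preserving U T \<Longrightarrow> distribution U P \<Longrightarrow> omega U c = measure P C"
    by (rule representsE[OF assms(2)]) blast
  have "omega U (a \<uplus> c) = measure P (B \<union> C)" if U: "sup_preserving U (S \<union> T)" and P: "distribution U P" for U P
  proof -
    have "sup_preserving U S" "sup_preserving U T" "ultra U" using sup_preserving_subset[OF U] U by (auto simp: sup_preserving_def)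
    then show ?thesis using S(4)[OF _ P] T(4)[OF _ P] meas(1)[OF P] omega_sum[OF _ S(1) T(1) ac, of U] by simp
  qed
  then show "represents (B \<union> C) (a \<uplus> c)"
    unfolding represents_def using S(1-3) T(1-3) ac by (intro conjI exI[of _ "S \<union> T"]) auto
qed

text \<open>
  The sequence \<open>a\<close> itself joins the sequences to be preserved, so that continuity of the measures
  gives the value of its supremum.
\<close>

lemma represents_UN_incseq:
  fixes B :: "nat \<Rightarrow> real set"
  assumes "\<And>n. represents (B n) (a n)" "\<And>n. B n \<in> sets borel" "\<And>n. B n \<subseteq> B (Suc n)"
  shows "represents (\<Union>n. B n) (ea_Sup (range a))"
proof -
  have meas: "measure P (B n) \<le> measure P (B (Suc n))" "(\<lambda>n. measure P (B n)) \<longlonglongrightarrow> measure P (\<Union>n. B n)"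
    if "distribution U P" for U P n
  proof -
    interpret prob_space P using that unfolding distribution_def by simp
    have s: "sets P = sets borel" using that unfolding distribution_def by simp
    show "measure P (B n) \<le> measure P (B (Suc n))"
      by (rule finite_measure_mono) (use assms s in auto)
    show "(\<lambda>n. measure P (B n)) \<longlonglongrightarrow> measure P (\<Union>n. B n)"
      by (rule finite_Lim_measure_incseq) (use assms s in \<open>auto intro!: incseq_SucI\<close>)
  qed
  have "\<forall>n. \<exists>T. countable T \<and> (\<forall>s\<in>T. increasing s) \<and>
     (\<forall>U P. sup_preserving U T \<longrightarrow> distribution U P \<longrightarrow> omega U (a n) = measure P (B n))" and M: "\<And>n. a n \<in> M"
    using assms(1) unfolding represents_def by auto
  then obtain T where T: "\<And>n. countable (T n)" "\<And>n s. s \<in> T n \<Longrightarrow> increasing s"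
    "\<And>n U P. sup_preserving U (T n) \<Longrightarrow> distribution U P \<Longrightarrow> omega U (a n) = measure P (B n)" by metis
  have "a n \<preceq> a (Suc n)" for n using represents_le[OF assms(1) assms(1)] meas(1) by blast
  then have inc: "increasing a" unfolding increasing_def using M by simp
  define S where "S = insert a (\<Union>n. T n)"
  have "omega U (ea_Sup (range a)) = measure P (\<Union>n. B n)" if U: "sup_preserving U S" and P: "distribution U P" for U P
  proof -
    have "sup_preserving U (T n)" for n using sup_preserving_subset[OF U] unfolding S_def by blast
    then have "omega U (a n) = measure P (B n)" for n using T(3) P by blast
    moreover have "(\<lambda>n. omega U (a n)) \<longlonglongrightarrow> omega U (ea_Sup (range a))"
      using U unfolding sup_preserving_def S_def by simp
    ultimately show ?thesis using meas(2)[OF P] LIMSEQ_unique by auto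
  qed
  moreover have "countable S" "\<forall>s\<in>S. increasing s" using T(1,2) inc unfolding S_def by auto
  moreover have "ea_Sup (range a) \<in> M" using M by (intro block_Sup) auto
  ultimately show ?thesis unfolding represents_def by blast
qed

lemma ex_represents:
  assumes "B \<in> sets borel"
  shows "\<exists>a. represents B a"
  using assms
proof (induction rule: borel_induct_lessThan)
  case (lessThan t)
  then show ?case using represents_lessThan by blast
next
  case empty
  then show ?case using represents_empty by blast
next
  case (compl A)
  then show ?case using represents_compl by blast
next
  case (union A)
  note A = union.hyps(2)
  have "\<exists>a. represents (\<Union>i<n. A i) a" for n
  proof (induction n)
    case (Suc n)
    then obtain a where "represents (\<Union>i<n. A i) a" by blast
    moreover obtain c where "represents (A n) c" using union.IH by blast
    moreover have "(\<Union>i<n. A i) \<inter> A n = {}"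
    proof -
      have "A i \<inter> A n = {}" if "i < n" for i
        using disjoint_family_onD[OF union.hyps(1), of i n] that by simp
      then show ?thesis by blast
    qed
    ultimately have "represents ((\<Union>i<n. A i) \<union> A n) (a \<uplus> c)" using A by (intro represents_Un) auto
    moreover have "(\<Union>i<Suc n. A i) = (\<Union>i<n. A i) \<union> A n" by (auto simp: lessThan_Suc)
    ultimately show ?case by auto
  qed (use represents_empty in auto)
  then obtain a where a: "\<And>n. represents (\<Union>i<n. A i) (a n)" by metis
  have "represents (\<Union>n. \<Union>i<n. A i) (ea_Sup (range a))"
    by (rule represents_UN_incseq[OF a]) (use A in \<open>auto simp: less_Suc_eq\<close>)
  moreover have "(\<Union>n. \<Union>i<n. A i) = (\<Union>n. A n)" by auto
  ultimately show ?case by auto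
qed

lemma ex_observable: "\<exists>x. observable x \<and> (\<forall>t. x {..<t} = F t)"
proof -
  define x where "x = (\<lambda>B\<in>sets borel. THE a. represents B a)"
  have rep: "represents B (x B)" if "B \<in> sets borel" for B
    unfolding x_def using theI'[of "represents B"] ex_represents[OF that] represents_unique that
    by (metis restrict_apply')
  have eq: "x B = a" if "represents B a" "B \<in> sets borel" for B a
    using represents_unique[OF rep that(1)] that(2) by blast
  have "observable x"
    unfolding observable_def
  proof (intro conjI ballI allI impI)
    show "x \<in> extensional (sets borel)" unfolding x_def by simp
    show "x UNIV = one" using represents_compl[OF represents_empty] by (intro eq) auto
    fix B C :: "real set" assume BC: "B \<in> sets borel" "C \<in> sets borel" "B \<inter> C = {}"
    show "psum (x B) (x C) = Some (x (B \<union> C))"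
      using represents_Un[OF rep[OF BC(1)] rep[OF BC(2)] BC] eq BC by (simp add: psum_eq_Some_iff)
  next
    fix B :: "nat \<Rightarrow> real set" assume B: "(\<forall>i. B i \<in> sets borel) \<and> (\<forall>i. B i \<subseteq> B (Suc i))"
    then have "represents (\<Union>i. B i) (ea_Sup (range (\<lambda>i. x (B i))))"
      by (intro represents_UN_incseq rep) auto
    then show "is_lub ea_order (x (\<Union>i. B i)) (range (\<lambda>i. x (B i)))"
      unfolding is_lub_ea_order_iff_ea_Sup using B by (intro eq) auto
  qed
  moreover have "x {..<t} = F t" for t using represents_lessThan by (intro eq) auto
  ultimately show ?thesis by blast
qed

end

text \<open>
  Comparable elements are compatible, so the values of \<open>F\<close> lie in a block.
\<close>

lemma (in complete_lattice_effect_algebra) ex_observable_with_distribution: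
  fixes F :: "real \<Rightarrow> 'a"
  assumes "\<And>s t. s \<le> t \<Longrightarrow> F s \<preceq> F t" "\<And>t. F t = ea_Sup (F ` {..<t})"
    "\<And>t. t \<le> l \<Longrightarrow> F t = zero" "\<And>t. r < t \<Longrightarrow> F t = one"
  shows "\<exists>x. observable x \<and> (\<forall>t. x {..<t} = F t)"
proof -
  have "compatible (F s) (F t)" for s t
  proof (cases "s \<le> t")
    case True
    then show ?thesis by (intro le_compatible assms(1))
  next
    case False
    then show ?thesis by (intro compatible_sym[OF le_compatible] assms(1)) simp
  qed
  then have "\<exists>M. range F \<subseteq> M \<and> effect_algebra_block psum zero one M"
    by (intro ex_block) (elim rangeE, simp)
  then obtain M where M: "range F \<subseteq> M" "effect_algebra_block psum zero one M" by blast
  interpret effect_algebra_block psum zero one M by (rule M)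
  interpret spectral_family psum zero one M F l r
  proof
    show "F t \<in> M" for t using M(1) by auto
  qed (rule assms; assumption)+
  show ?thesis by (rule ex_observable)
qed

section \<open>Observables and their distribution functions\<close>

lemma lessThan_eq_UN: "{..<t} = (\<Union>n. {..<t - 1 / real (Suc n)})"
proof -
  have "\<exists>n. u < t - 1 / real (Suc n)" if "u < t" for u
    using reals_Archimedean[of "t - u"] that by (auto simp: field_simps)
  then show ?thesis by (force simp: less_diff_eq intro: less_trans[rotated])
qed

lemma lessThan_incseq: "{..<t - 1 / real (Suc n)} \<subseteq> {..<t - 1 / real (Suc (Suc n))}"
proof -
  have "1 / real (Suc (Suc n)) \<le> 1 / real (Suc n)" by (intro frac_le) auto
  then show ?thesis by auto
qed

context complete_lattice_effect_algebra
begin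

lemma observable_Un:
  assumes "observable x" "B \<in> sets borel" "C \<in> sets borel" "B \<inter> C = {}"
  shows "x B \<bowtie> x C" "x (B \<union> C) = x B \<uplus> x C"
  using assms unfolding observable_def by (auto simp: psum_eq_Some_iff)

lemma observable_UNIV: "observable x \<Longrightarrow> x UNIV = one"
  unfolding observable_def by simp

lemma observable_empty:
  assumes "observable x" shows "x {} = zero"
proof -
  have "one \<bowtie> x {}" using observable_Un(1)[OF assms, of UNIV "{}"] observable_UNIV[OF assms] by simp
  then show ?thesis using orth_one by (simp add: orth_commute)
qed

lemma observable_mono:
  assumes "observable x" "B \<in> sets borel" "C \<in> sets borel" "B \<subseteq> C"
  shows "x B \<preceq> x C"
proof -
  have "x (B \<union> (C - B)) = x B \<uplus> x (C - B)" "x B \<bowtie> x (C - B)"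
    using observable_Un[OF assms(1,2), of "C - B"] assms(2,3) by auto
  moreover have "B \<union> (C - B) = C" using assms(4) by auto
  ultimately show ?thesis using le_sum(1) by simp
qed

lemma observable_compl:
  assumes "observable x" "B \<in> sets borel"
  shows "x (UNIV - B) = (x B)\<^sup>\<bottom>"
proof -
  have "B \<union> (UNIV - B) = UNIV" by auto
  then show ?thesis
    unfolding orthosupplement_iff
    using observable_Un[OF assms, of "UNIV - B"] assms(2) observable_UNIV[OF assms(1)] by auto
qed

lemma observable_UN_incseq:
  fixes B :: "nat \<Rightarrow> real set"
  assumes "observable x" "\<And>n. B n \<in> sets borel" "\<And>n. B n \<subseteq> B (Suc n)"
  shows "x (\<Union>n. B n) = ea_Sup (range (\<lambda>n. x (B n)))"
  using assms unfolding observable_def is_lub_ea_order_iff_ea_Sup by blast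

lemma observable_lessThan_mono: "observable x \<Longrightarrow> s \<le> t \<Longrightarrow> x {..<s} \<preceq> x {..<t}"
  by (rule observable_mono) auto

lemma observable_lessThan_left:
  assumes "observable x"
  shows "x {..<t} = ea_Sup ((\<lambda>s. x {..<s}) ` {..<t})"
proof (rule le_antisym)
  have "x {..<t} = ea_Sup (range (\<lambda>n. x {..<t - 1 / real (Suc n)}))"
    by (subst lessThan_eq_UN) (intro observable_UN_incseq assms lessThan_incseq, simp)
  also have "\<dots> \<preceq> ea_Sup ((\<lambda>s. x {..<s}) ` {..<t})"
    by (rule E.Sup_subset_mono) auto
  finally show "x {..<t} \<preceq> ea_Sup ((\<lambda>s. x {..<s}) ` {..<t})" .
  show "ea_Sup ((\<lambda>s. x {..<s}) ` {..<t}) \<preceq> x {..<t}"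
    by (rule E.Sup_least) (auto intro: observable_lessThan_mono[OF assms])
qed

lemma observable_eqI:
  assumes x: "observable x" and y: "observable y" and eq: "\<And>t. x {..<t} = y {..<t}"
  shows "x = y"
proof (rule extensionalityI)
  show "x \<in> extensional (sets borel)" "y \<in> extensional (sets borel)"
    using x y by (auto simp: observable_def)
  fix B :: "real set" assume "B \<in> sets borel"
  then show "x B = y B"
  proof (induction rule: borel_induct_lessThan)
    case (lessThan t)
    show ?case by (rule eq)
  next
    case empty
    show ?case using observable_empty[OF x] observable_empty[OF y] by simp
  next
    case (compl A)
    then show ?case using observable_compl[OF x] observable_compl[OF y] by simp
  next
    case (union A)
    note A = union.hyps(2)
    define C where "C n = (\<Union>i<n. A i)" for n
    have C: "C n \<in> sets borel" "C n \<subseteq> C (Suc n)" "C (Suc n) = C n \<union> A n" for n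
      unfolding C_def using A by (auto simp: less_Suc_eq)
    have disj: "C n \<inter> A n = {}" for n
    proof -
      have "A i \<inter> A n = {}" if "i < n" for i
        using disjoint_family_onD[OF union.hyps(1), of i n] that by simp
      then show ?thesis unfolding C_def by blast
    qed
    have xy: "x (C n) = y (C n)" for n
    proof (induction n)
      case 0
      then show ?case unfolding C_def using observable_empty[OF x] observable_empty[OF y] by simp
    next
      case (Suc n)
      then show ?case
        unfolding C(3) using observable_Un(2)[OF x C(1) A disj] observable_Un(2)[OF y C(1) A disj] union.IH
        by simp
    qed
    have "(\<Union>n. A n) = (\<Union>n. C n)" unfolding C_def by auto
    then show ?case
      using observable_UN_incseq[of x C] observable_UN_incseq[of y C] x y C xy by simp
  qed
qed

lemma observable_null_Un:
  assumes "observable x" "B \<in> sets borel" "C \<in> sets borel" "x B = zero" "x C = zero"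
  shows "x (B \<union> C) = zero"
proof -
  have "x (C - B) \<preceq> x C" using assms by (intro observable_mono) auto
  then have "x (C - B) = zero" using assms(5) by simp
  moreover have "x (B \<union> (C - B)) = x B \<uplus> x (C - B)" using assms by (intro observable_Un) auto
  ultimately show ?thesis using assms(4) by simp
qed

lemma observable_null_UN:
  fixes B :: "nat \<Rightarrow> real set"
  assumes "observable x" "\<And>n. B n \<in> sets borel" "\<And>n. x (B n) = zero"
  shows "x (\<Union>n. B n) = zero"
proof -
  define C where "C n = (\<Union>i<n. B i)" for n
  have C: "C n \<in> sets borel" "C n \<subseteq> C (Suc n)" "C (Suc n) = C n \<union> B n" for n
    unfolding C_def using assms(2) by (auto simp: less_Suc_eq)
  have "x (C n) = zero" for n
  proof (induction n)
    case 0
    then show ?case unfolding C_def using observable_empty[OF assms(1)] by simp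
  next
    case (Suc n)
    then show ?case unfolding C(3) by (rule observable_null_Un[OF assms(1) C(1) assms(2) _ assms(3)])
  qed
  moreover have "(\<Union>n. B n) = (\<Union>n. C n)" unfolding C_def by auto
  ultimately show ?thesis using observable_UN_incseq[of x C] assms(1) C by simp
qed

lemma observable_eq_one_iff:
  assumes "observable x" "B \<in> sets borel"
  shows "x B = one \<longleftrightarrow> x (UNIV - B) = zero"
  using observable_compl[OF assms] by simp

lemma observable_null_mono:
  assumes "observable x" "B \<in> sets borel" "C \<in> sets borel" "B \<subseteq> C" "x C = zero"
  shows "x B = zero"
  using observable_mono[OF assms(1-4)] assms(5) by simp

lemma observable_one_mono:
  assumes "observable x" "B \<in> sets borel" "C \<in> sets borel" "B \<subseteq> C" "x B = one"
  shows "x C = one"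
  using observable_mono[OF assms(1-4)] assms(5) by simp

lemma bounded_observable_iff:
  "bounded_observable x \<longleftrightarrow> observable x \<and> (\<exists>l r. x {..<l} = zero \<and> x {..<r} = one)"
proof (intro iffI conjI)
  assume b: "bounded_observable x"
  then show x: "observable x" by (simp add: bounded_observable_def)
  from b obtain C where C: "compact C" "x C = one" by (auto simp: bounded_observable_def)
  then obtain k where k: "\<And>c. c \<in> C \<Longrightarrow> \<bar>c\<bar> \<le> k"
    using compact_imp_bounded[OF C(1)] by (auto simp: bounded_iff)
  have Cb: "C \<in> sets borel" using C(1) by (simp add: borel_compact)
  have "x (UNIV - C) = zero" using observable_eq_one_iff[OF x Cb] C(2) by simp
  then have "x {..<-k} = zero"
    by (rule observable_null_mono[OF x, rotated 3]) (use k Cb in force)+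
  moreover have "x {..<k+1} = one"
    by (rule observable_one_mono[OF x Cb _ _ C(2)]) (use k in force)+
  ultimately show "\<exists>l r. x {..<l} = zero \<and> x {..<r} = one" by blast
next
  assume "observable x \<and> (\<exists>l r. x {..<l} = zero \<and> x {..<r} = one)"
  then obtain l r where x: "observable x" and lr: "x {..<l} = zero" "x {..<r} = one" by blast
  \<comment> \<open>The maximum matters if \<open>r < l\<close>, which is possible when \<open>zero = one\<close>.\<close>
  let ?C = "{l..max l r}"
  have "x ({..<l} \<union> ?C) = x {..<l} \<uplus> x ?C" by (intro observable_Un x) auto
  moreover have "x ({..<l} \<union> ?C) = one"
    by (rule observable_one_mono[OF x _ _ _ lr(2)]) auto
  ultimately have "x ?C = one" using lr(1) by simp
  then show "bounded_observable x"
    unfolding bounded_observable_def using x compact_Icc by blast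
qed

text \<open>
  By Lindelof's theorem the union of all open null sets is the union of countably many of them,
  hence null. Its complement is the least closed set with value \<open>one\<close>.
\<close>

lemma observable_spectrum:
  assumes x: "observable x"
  shows "closed (spectrum x)" "x (spectrum x) = one" "\<And>K. closed K \<Longrightarrow> x K = one \<Longrightarrow> spectrum x \<subseteq> K"
proof -
  define \<O> where "\<O> = {G. open G \<and> x G = zero}"
  obtain \<G> where G: "\<G> \<subseteq> \<O>" "countable \<G>" "\<Union>\<G> = \<Union>\<O>"
    using Lindelof[of \<O>] unfolding \<O>_def by blast
  define S where "S = UNIV - \<Union>\<O>"
  have op: "open (\<Union>\<O>)" unfolding \<O>_def by auto
  have empty: "{} \<in> \<O>" unfolding \<O>_def using observable_empty[OF x] by simp
  define f where "f = from_nat_into (insert {} \<G>)"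
  have f: "range f = insert {} \<G>" unfolding f_def using G(2) by (intro range_from_nat_into) auto
  have fO: "f n \<in> \<O>" for n using f G(1) empty by (metis insert_iff rangeI subset_iff)
  have "x (\<Union>n. f n) = zero"
    using fO by (intro observable_null_UN[OF x]) (auto simp: \<O>_def)
  moreover have "(\<Union>n. f n) = \<Union>\<O>" using f G(3) by simp
  ultimately have "x S = one"
    unfolding S_def using observable_compl[OF x, of "\<Union>\<O>"] op by simp
  moreover have "closed S" unfolding S_def using op by (simp add: closed_def Compl_eq_Diff_UNIV[symmetric])
  moreover have least: "S \<subseteq> K" if "closed K" "x K = one" for K
  proof -
    have "UNIV - K \<in> \<O>"
      using that observable_eq_one_iff[OF x, of K] unfolding \<O>_def
      by (simp add: Compl_eq_Diff_UNIV[symmetric] open_Compl)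
    then show ?thesis unfolding S_def by blast
  qed
  ultimately have "spectrum x = S"
    unfolding spectrum_def by (intro Least_equality) auto
  then show "closed (spectrum x)" "x (spectrum x) = one" "\<And>K. closed K \<Longrightarrow> x K = one \<Longrightarrow> spectrum x \<subseteq> K"
    using \<open>closed S\<close> \<open>x S = one\<close> least by auto
qed

lemma spectrum_subset_unit_iff:
  assumes x: "observable x"
  shows "spectrum x \<subseteq> {0..1} \<longleftrightarrow> x {..<0} = zero \<and> (\<forall>t>1. x {..<t} = one)"
proof
  assume "spectrum x \<subseteq> {0..1}"
  then have one: "x {0..1} = one"
    using observable_one_mono[OF x _ _ _ observable_spectrum(2)[OF x]] observable_spectrum(1)[OF x] by auto
  then have "x (UNIV - {0..1}) = zero" using observable_eq_one_iff[OF x] by simp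
  then have "x {..<0} = zero"
    by (rule observable_null_mono[OF x, rotated 3]) auto
  moreover have "x {..<t} = one" if "t > 1" for t
    by (rule observable_one_mono[OF x _ _ _ one]) (use that in auto)
  ultimately show "x {..<0} = zero \<and> (\<forall>t>1. x {..<t} = one)" by blast
next
  assume *: "x {..<0} = zero \<and> (\<forall>t>1. x {..<t} = one)"
  have "x (UNIV - {..<1 + 1 / real (Suc n)}) = zero" for n
    using * observable_eq_one_iff[OF x, of "{..<1 + 1 / real (Suc n)}"] by simp
  then have "x (\<Union>n. UNIV - {..<1 + 1 / real (Suc n)}) = zero"
    by (intro observable_null_UN[OF x]) auto
  then have "x ({..<0} \<union> (\<Union>n. UNIV - {..<1 + 1 / real (Suc n)})) = zero"
    using * by (intro observable_null_Un[OF x]) auto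
  moreover have "UNIV - {0..1} \<subseteq> {..<0} \<union> (\<Union>n. UNIV - {..<1 + 1 / real (Suc n)})"
  proof -
    have "\<exists>n. 1 + 1 / real (Suc n) \<le> u" if "u > 1" for u :: real
    proof -
      obtain n where "inverse (real (Suc n)) < u - 1" using reals_Archimedean[of "u - 1"] \<open>u > 1\<close> by auto
      then show ?thesis by (intro exI[of _ n]) (simp add: inverse_eq_divide)
    qed
    then have "u \<in> (\<Union>n. UNIV - {..<1 + 1 / real (Suc n)})" if "u > 1" for u :: real
      using that by (auto simp: not_less)
    moreover have "u < 0 \<or> u > 1" if "u \<in> UNIV - {0..1}" for u :: real
      using that by auto
    ultimately show ?thesis by blast
  qed
  ultimately have "x (UNIV - {0..1}) = zero"
    by (intro observable_null_mono[OF x, of "UNIV - {0..1}"]) auto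
  then have "x {0..1} = one" using observable_eq_one_iff[OF x] by simp
  then show "spectrum x \<subseteq> {0..1}" by (intro observable_spectrum(3)[OF x]) auto
qed

text \<open>
  Point masses serve as bounds for bounded observables; those at 0 and 1 are the question
  observables of \<open>zero\<close> and \<open>one\<close>.
\<close>

definition dirac :: "real \<Rightarrow> real set \<Rightarrow> 'a" where
  "dirac p = (\<lambda>B\<in>sets borel. if p \<in> B then one else zero)"

lemma observable_dirac: "observable (dirac p)"
  unfolding observable_def
proof (intro conjI ballI allI impI)
  fix B :: "nat \<Rightarrow> real set" assume B: "(\<forall>i. B i \<in> sets borel) \<and> (\<forall>i. B i \<subseteq> B (Suc i))"
  then have U: "(\<Union>i. B i) \<in> sets borel" by auto
  have d: "dirac p (B i) = (if p \<in> B i then one else zero)" for i using B by (simp add: dirac_def)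
  have "dirac p (\<Union>i. B i) = (if p \<in> (\<Union>i. B i) then one else zero)" using U by (simp add: dirac_def)
  also have "\<dots> = ea_Sup (range (\<lambda>i. dirac p (B i)))"
  proof (cases "p \<in> (\<Union>i. B i)")
    case True
    then obtain i where "p \<in> B i" by auto
    then have "dirac p (B i) = one" by (simp add: d)
    then have "one \<preceq> ea_Sup (range (\<lambda>i. dirac p (B i)))" by (metis E.Sup_upper rangeI)
    then show ?thesis unfolding if_P[OF True] by simp
  next
    case False
    then have "range (\<lambda>i. dirac p (B i)) = {zero}" by (auto simp: d)
    then show ?thesis unfolding if_not_P[OF False] by simp
  qed
  finally show "is_lub ea_order (dirac p (\<Union>i. B i)) (range (\<lambda>i. dirac p (B i)))"
    unfolding is_lub_ea_order_iff_ea_Sup .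
qed (auto simp: dirac_def psum_eq_Some_iff)

lemma dirac_lessThan [simp]: "dirac p {..<t} = (if p < t then one else zero)"
  by (simp add: dirac_def)

lemma bounded_dirac: "bounded_observable (dirac p)"
  unfolding bounded_observable_iff
  by (intro conjI observable_dirac exI[of _ p] exI[of _ "p + 1"]) simp_all

lemma question_observable_zero: "question_observable zero = dirac 0"
  unfolding question_observable_def dirac_def by (intro restrict_ext) simp

lemma question_observable_one: "question_observable one = dirac 1"
  unfolding question_observable_def dirac_def by (intro restrict_ext) simp

section \<open>Suprema and infima in the Olson order\<close>

lemma olson_le_refl: "olson_le x x"
  by (simp add: olson_le_def)

lemma olson_le_trans: "olson_le x y \<Longrightarrow> olson_le y z \<Longrightarrow> olson_le x z"
  unfolding olson_le_def using le_trans by blast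

lemma olson_le_antisym: "observable x \<Longrightarrow> observable y \<Longrightarrow> olson_le x y \<Longrightarrow> olson_le y x \<Longrightarrow> x = y"
  unfolding olson_le_def using le_antisym by (intro observable_eqI) auto

lemma bounded_observable_between:
  assumes "bounded_observable x" "bounded_observable z" "observable y" "olson_le x y" "olson_le y z"
  shows "bounded_observable y"
proof -
  obtain l r where "x {..<l} = zero" "z {..<r} = one"
    using assms(1,2) unfolding bounded_observable_iff by blast
  then have "y {..<l} = zero" "y {..<r} = one"
    using assms(4,5) unfolding olson_le_def by (metis le_zero one_le)+
  then show ?thesis unfolding bounded_observable_iff using assms(3) by blast
qed

lemma bounded_observable_bounds:
  assumes "bounded_observable x"
  obtains l r where "\<And>t. t \<le> l \<Longrightarrow> x {..<t} = zero" "\<And>t. r < t \<Longrightarrow> x {..<t} = one"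
proof -
  obtain l r where x: "observable x" and lr: "x {..<l} = zero" "x {..<r} = one"
    using assms unfolding bounded_observable_iff by blast
  have "x {..<t} = zero" if "t \<le> l" for t using observable_lessThan_mono[OF x that] lr by simp
  moreover have "x {..<t} = one" if "r < t" for t
    using observable_lessThan_mono[OF x less_imp_le[OF that]] lr by simp
  ultimately show thesis using that by blast
qed

text \<open>
  Since the order is reversed, infima are given by pointwise suprema of distribution functions,
  which inherit left continuity. The lower bound \<open>z\<close> makes the supremum vanish on the left, and
  any member of \<open>A\<close> makes it \<open>one\<close> on the right.
\<close>

lemma ex_olson_Inf:
  assumes "A \<noteq> {}" "\<And>x. x \<in> A \<Longrightarrow> bounded_observable x"
    "bounded_observable z" "\<And>x. x \<in> A \<Longrightarrow> olson_le z x"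
  shows "\<exists>y. observable y \<and> (\<forall>x\<in>A. olson_le y x) \<and> (\<forall>w. (\<forall>x\<in>A. olson_le w x) \<longrightarrow> olson_le w y)"
proof -
  have obs: "observable x" if "x \<in> A" for x using assms(2)[OF that] by (simp add: bounded_observable_def)
  define F where "F t = ea_Sup ((\<lambda>x. x {..<t}) ` A)" for t
  have up: "x {..<t} \<preceq> F t" if "x \<in> A" for x t unfolding F_def using that by (intro E.Sup_upper) auto
  have least: "F t \<preceq> u" if "\<And>x. x \<in> A \<Longrightarrow> x {..<t} \<preceq> u" for t u
    unfolding F_def using that by (intro E.Sup_least) auto
  obtain l where l: "\<And>t. t \<le> l \<Longrightarrow> z {..<t} = zero" using bounded_observable_bounds[OF assms(3)] by metis
  obtain x0 where x0: "x0 \<in> A" using assms(1) by auto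
  obtain r where r: "\<And>t. r < t \<Longrightarrow> x0 {..<t} = one" using bounded_observable_bounds[OF assms(2)[OF x0]] by metis
  have mono: "F s \<preceq> F t" if "s \<le> t" for s t
  proof (rule least)
    fix x assume "x \<in> A"
    then show "x {..<s} \<preceq> F t" using observable_lessThan_mono[OF obs that] up le_trans by blast
  qed
  have "\<exists>y. observable y \<and> (\<forall>t. y {..<t} = F t)"
  proof (rule ex_observable_with_distribution[where F = F and l = l and r = r])
    show "F t = ea_Sup (F ` {..<t})" for t
    proof (rule le_antisym)
      show "F t \<preceq> ea_Sup (F ` {..<t})"
      proof (rule least)
        fix x assume x: "x \<in> A"
        have "ea_Sup ((\<lambda>s. x {..<s}) ` {..<t}) \<preceq> ea_Sup (F ` {..<t})"
        proof (rule E.Sup_least)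
          fix a assume "a \<in> (\<lambda>s. x {..<s}) ` {..<t}"
          then obtain s where s: "s < t" "a = x {..<s}" by auto
          then have "F s \<preceq> ea_Sup (F ` {..<t})" by (intro E.Sup_upper) auto
          then show "a \<preceq> ea_Sup (F ` {..<t})" using up[OF x, of s] le_trans unfolding s(2) by blast
        qed
        then show "x {..<t} \<preceq> ea_Sup (F ` {..<t})" using observable_lessThan_left[OF obs[OF x], of t] by simp
      qed
      show "ea_Sup (F ` {..<t}) \<preceq> F t" by (rule E.Sup_least) (auto intro: mono)
    qed
    show "F t = zero" if "t \<le> l" for t
      using least[of t zero] assms(4) l[OF that] unfolding olson_le_def by (metis le_zero)
    show "F t = one" if "r < t" for t using up[OF x0, of t] r[OF that] by simp
  qed (rule mono)
  then obtain y where y: "observable y" "\<And>t. y {..<t} = F t" by blast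
  have "\<forall>x\<in>A. olson_le y x" unfolding olson_le_def y(2) using up by blast
  moreover have "\<forall>w. (\<forall>x\<in>A. olson_le w x) \<longrightarrow> olson_le w y" unfolding olson_le_def y(2) using least by blast
  ultimately show ?thesis using y(1) by blast
qed

text \<open>
  The pointwise infimum \<open>H\<close> of the distribution functions need not be left continuous. Its left
  regularisation \<open>F\<close> is below \<open>H\<close>, and above every left continuous function that is below \<open>H\<close>.
\<close>

lemma ex_olson_Sup:
  assumes "A \<noteq> {}" "\<And>x. x \<in> A \<Longrightarrow> bounded_observable x"
    "bounded_observable z" "\<And>x. x \<in> A \<Longrightarrow> olson_le x z"
  shows "\<exists>y. observable y \<and> (\<forall>x\<in>A. olson_le x y) \<and>
    (\<forall>w. observable w \<longrightarrow> (\<forall>x\<in>A. olson_le x w) \<longrightarrow> olson_le y w)"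
proof -
  have obs: "observable x" if "x \<in> A" for x using assms(2)[OF that] by (simp add: bounded_observable_def)
  define H where "H t = ea_Inf ((\<lambda>x. x {..<t}) ` A)" for t
  have low: "H t \<preceq> x {..<t}" if "x \<in> A" for x t unfolding H_def using that by (intro E.Inf_lower) auto
  have greatest: "u \<preceq> H t" if "\<And>x. x \<in> A \<Longrightarrow> u \<preceq> x {..<t}" for t u
    unfolding H_def using that by (intro E.Inf_greatest) auto
  have Hmono: "H s \<preceq> H t" if "s \<le> t" for s t
  proof (rule greatest)
    fix x assume "x \<in> A"
    then show "H s \<preceq> x {..<t}" using observable_lessThan_mono[OF obs that] low le_trans by blast
  qed
  define F where "F t = ea_Sup (H ` {..<t})" for t
  have HF: "H s \<preceq> F t" if "s < t" for s t unfolding F_def using that by (intro E.Sup_upper) auto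
  have least: "F t \<preceq> u" if "\<And>s. s < t \<Longrightarrow> H s \<preceq> u" for t u
    unfolding F_def using that by (intro E.Sup_least) auto
  have FH: "F t \<preceq> H t" for t by (rule least) (auto intro: Hmono)
  have mono: "F s \<preceq> F t" if "s \<le> t" for s t
    by (rule least) (use that in \<open>auto intro: HF\<close>)
  obtain r where r: "\<And>t. r < t \<Longrightarrow> z {..<t} = one" using bounded_observable_bounds[OF assms(3)] by metis
  obtain x0 where x0: "x0 \<in> A" using assms(1) by auto
  obtain l where l: "\<And>t. t \<le> l \<Longrightarrow> x0 {..<t} = zero" using bounded_observable_bounds[OF assms(2)[OF x0]] by metis
  have "\<exists>y. observable y \<and> (\<forall>t. y {..<t} = F t)"
  proof (rule ex_observable_with_distribution[where F = F and l = l and r = r])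
    show "F t = ea_Sup (F ` {..<t})" for t
    proof (rule le_antisym)
      show "F t \<preceq> ea_Sup (F ` {..<t})"
      proof (rule least)
        fix s assume "s < t"
        then obtain u where u: "s < u" "u < t" using dense by blast
        have "F u \<preceq> ea_Sup (F ` {..<t})" using u by (intro E.Sup_upper) auto
        then show "H s \<preceq> ea_Sup (F ` {..<t})" using HF[OF u(1)] le_trans by blast
      qed
      show "ea_Sup (F ` {..<t}) \<preceq> F t" by (rule E.Sup_least) (auto intro: mono)
    qed
    show "F t = zero" if "t \<le> l" for t
      using le_trans[OF FH low[OF x0], of t] l[OF that] by simp
    show "F t = one" if "r < t" for t
    proof -
      obtain s where s: "r < s" "s < t" using dense \<open>r < t\<close> by blast
      have "one \<preceq> H s"
      proof (rule greatest)
        fix x assume "x \<in> A"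
        then have "z {..<s} \<preceq> x {..<s}" using assms(4) by (simp add: olson_le_def)
        then show "one \<preceq> x {..<s}" using r[OF s(1)] by simp
      qed
      then have "one \<preceq> F t" using HF[OF s(2)] le_trans by blast
      then show ?thesis by simp
    qed
  qed (rule mono)
  then obtain y where y: "observable y" "\<And>t. y {..<t} = F t" by blast
  have "olson_le x y" if "x \<in> A" for x
    unfolding olson_le_def y(2) using FH low[OF that] le_trans by blast
  moreover have "olson_le y w" if w: "observable w" "\<forall>x\<in>A. olson_le x w" for w
    unfolding olson_le_def y(2)
  proof
    fix t
    have "w {..<s} \<preceq> F t" if "s < t" for s
    proof -
      have "w {..<s} \<preceq> H s" using w(2) unfolding olson_le_def by (intro greatest) blast
      then show ?thesis using HF[OF that] le_trans by blast
    qed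
    then have "ea_Sup ((\<lambda>s. w {..<s}) ` {..<t}) \<preceq> F t" by (intro E.Sup_least) auto
    then show "w {..<t} \<preceq> F t" using observable_lessThan_left[OF w(1), of t] by simp
  qed
  ultimately show ?thesis using y(1) by blast
qed

text \<open>
  Both ordered sets of the theorem have this form, for a property \<open>Q\<close> of bounded observables that
  is inherited by observables lying between two others; such sets inherit infima and suprema.
\<close>

definition olson_order :: "((real set \<Rightarrow> 'a) \<Rightarrow> bool) \<Rightarrow> (real set \<Rightarrow> 'a) gorder" where
  "olson_order Q = \<lparr>carrier = {x. Q x}, eq = (=), le = olson_le\<rparr>"

lemma carrier_olson_order [simp]: "carrier (olson_order Q) = {x. Q x}"
  by (simp add: olson_order_def)

lemma le_olson_order [simp]: "le (olson_order Q) = olson_le"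
  by (simp add: olson_order_def)

lemma partial_order_olson_order:
  assumes "\<And>x. Q x \<Longrightarrow> observable x"
  shows "partial_order (olson_order Q)"
proof
  fix x y assume "le (olson_order Q) x y" "le (olson_order Q) y x"
    "x \<in> carrier (olson_order Q)" "y \<in> carrier (olson_order Q)"
  then show "eq (olson_order Q) x y"
    using olson_le_antisym assms by (simp add: olson_order_def)
qed (auto simp: olson_order_def intro: olson_le_refl olson_le_trans)

lemma ex_is_glb_olson_order:
  assumes Q: "\<And>x. Q x \<Longrightarrow> bounded_observable x"
    "\<And>x y z. Q x \<Longrightarrow> Q z \<Longrightarrow> observable y \<Longrightarrow> olson_le x y \<Longrightarrow> olson_le y z \<Longrightarrow> Q y"
    and A: "A \<subseteq> carrier (olson_order Q)" "A \<noteq> {}" "z \<in> Lower (olson_order Q) A"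
  shows "\<exists>i. is_glb (olson_order Q) i A"
proof -
  have AQ: "Q x" if "x \<in> A" for x using A(1) that by auto
  have z: "Q z" "\<And>x. x \<in> A \<Longrightarrow> olson_le z x" using A(1,3) by (auto simp: Lower_def)
  obtain y where y: "observable y" "\<And>x. x \<in> A \<Longrightarrow> olson_le y x"
    "\<And>w. (\<And>x. x \<in> A \<Longrightarrow> olson_le w x) \<Longrightarrow> olson_le w y"
    using ex_olson_Inf[OF A(2) Q(1)[OF AQ] Q(1)[OF z(1)] z(2)] by blast
  have "Q y"
  proof -
    obtain x where "x \<in> A" using A(2) by auto
    then show ?thesis using Q(2)[OF z(1) AQ y(1) y(3)[OF z(2)] y(2)] by blast
  qed
  then have "is_glb (olson_order Q) y A"
    using y A(1) by (intro greatest_LowerI) (auto simp: Lower_def)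
  then show ?thesis by blast
qed

lemma ex_is_lub_olson_order:
  assumes Q: "\<And>x. Q x \<Longrightarrow> bounded_observable x"
    "\<And>x y z. Q x \<Longrightarrow> Q z \<Longrightarrow> observable y \<Longrightarrow> olson_le x y \<Longrightarrow> olson_le y z \<Longrightarrow> Q y"
    and A: "A \<subseteq> carrier (olson_order Q)" "A \<noteq> {}" "z \<in> Upper (olson_order Q) A"
  shows "\<exists>s. is_lub (olson_order Q) s A"
proof -
  have AQ: "Q x" if "x \<in> A" for x using A(1) that by auto
  have z: "Q z" "\<And>x. x \<in> A \<Longrightarrow> olson_le x z" using A(1,3) by (auto simp: Upper_def)
  have obs: "observable x" if "Q x" for x using Q(1)[OF that] by (simp add: bounded_observable_def)
  obtain y where y: "observable y" "\<And>x. x \<in> A \<Longrightarrow> olson_le x y"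
    "\<And>w. observable w \<Longrightarrow> (\<And>x. x \<in> A \<Longrightarrow> olson_le x w) \<Longrightarrow> olson_le y w"
    using ex_olson_Sup[OF A(2) Q(1)[OF AQ] Q(1)[OF z(1)] z(2)] by blast
  have "Q y"
  proof -
    obtain x where "x \<in> A" using A(2) by auto
    then show ?thesis using Q(2)[OF AQ z(1) y(1) y(2) y(3)[OF obs[OF z(1)] z(2)]] by blast
  qed
  moreover have "olson_le y w" if "w \<in> Upper (olson_order Q) A" for w
    using that A(1) obs by (intro y(3)) (auto simp: Upper_def)
  ultimately have "is_lub (olson_order Q) y A"
    using y(2) A(1) by (intro least_UpperI) auto
  then show ?thesis by blast
qed

lemma bounded_observables_eq: "bounded_observables = olson_order bounded_observable"
  by (simp add: bounded_observables_def olson_order_def)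

lemma unit_interval_observables_eq:
  "unit_interval_observables = olson_order (\<lambda>x. observable x \<and> spectrum x \<subseteq> {0..1})"
  by (simp add: unit_interval_observables_def olson_order_def)

lemma bounded_imp_observable: "bounded_observable x \<Longrightarrow> observable x"
  by (simp add: bounded_observable_def)

theorem dedekind_complete_bounded_observables: "dedekind_complete_lattice bounded_observables"
proof -
  let ?L = "olson_order bounded_observable"
  interpret partial_order ?L
    by (rule partial_order_olson_order) (rule bounded_imp_observable)
  have glb: "\<exists>i. is_glb ?L i A" if "A \<subseteq> carrier ?L" "A \<noteq> {}" "z \<in> Lower ?L A" for A z
    using that by (rule ex_is_glb_olson_order[rotated 2]) (auto intro: bounded_observable_between)
  have lub: "\<exists>i. is_lub ?L i A" if "A \<subseteq> carrier ?L" "A \<noteq> {}" "z \<in> Upper ?L A" for A z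
    using that by (rule ex_is_lub_olson_order[rotated 2]) (auto intro: bounded_observable_between)
  have "dedekind_complete_lattice ?L"
  proof
    fix x y assume "x \<in> carrier ?L" "y \<in> carrier ?L"
    then have b: "bounded_observable x" "bounded_observable y" by auto
    obtain l r where x: "\<And>t. t \<le> l \<Longrightarrow> x {..<t} = zero" "\<And>t. r < t \<Longrightarrow> x {..<t} = one"
      using bounded_observable_bounds[OF b(1)] by metis
    obtain l' r' where y: "\<And>t. t \<le> l' \<Longrightarrow> y {..<t} = zero" "\<And>t. r' < t \<Longrightarrow> y {..<t} = one"
      using bounded_observable_bounds[OF b(2)] by metis
    have "dirac (max r r') \<in> Upper ?L {x, y}"
      using bounded_dirac x(2) y(2) by (auto simp: Upper_def olson_le_def)
    then show "\<exists>s. is_lub ?L s {x, y}" using b by (intro lub) auto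
    have "dirac (min l l') \<in> Lower ?L {x, y}"
      using bounded_dirac x(1) y(1) by (auto simp: Lower_def olson_le_def)
    then show "\<exists>s. is_glb ?L s {x, y}" using b by (intro glb) auto
  next
    fix A assume "A \<subseteq> carrier ?L" "A \<noteq> {}" "Lower ?L A \<noteq> {}"
    then show "\<exists>i. is_glb ?L i A" using glb by blast
  next
    fix A assume "A \<subseteq> carrier ?L" "A \<noteq> {}" "Upper ?L A \<noteq> {}"
    then show "\<exists>i. is_lub ?L i A" using lub by blast
  qed
  then show ?thesis unfolding bounded_observables_eq .
qed

text \<open>
  Observables with spectrum in the unit interval form the interval between two point masses.
\<close>

lemma unit_interval_observable_iff:
  "observable x \<and> spectrum x \<subseteq> {0..1} \<longleftrightarrow> observable x \<and> olson_le (dirac 0) x \<and> olson_le x (dirac 1)"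
proof (cases "observable x")
  case x: True
  have "x {..<0} = zero \<longleftrightarrow> olson_le (dirac 0) x"
  proof
    assume "x {..<0} = zero"
    then have "x {..<t} = zero" if "t \<le> 0" for t using observable_lessThan_mono[OF x that] by simp
    then show "olson_le (dirac 0) x" by (auto simp: olson_le_def)
  next
    assume "olson_le (dirac 0) x"
    then have "x {..<0} \<preceq> dirac 0 {..<0}" unfolding olson_le_def by blast
    then show "x {..<0} = zero" by simp
  qed
  moreover have "(\<forall>t>1. x {..<t} = one) \<longleftrightarrow> olson_le x (dirac 1)"
    unfolding olson_le_def by auto
  ultimately show ?thesis using spectrum_subset_unit_iff[OF x] x by simp
qed simp

theorem unit_interval_observables_complete:
  "Complete_Lattice.complete_lattice unit_interval_observables"
  "least unit_interval_observables (question_observable zero) (carrier unit_interval_observables)"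
  "greatest unit_interval_observables (question_observable one) (carrier unit_interval_observables)"
proof -
  define Q where "Q x \<longleftrightarrow> observable x \<and> olson_le (dirac 0) x \<and> olson_le x (dirac 1)" for x
  have eq: "unit_interval_observables = olson_order Q"
    unfolding unit_interval_observables_eq unit_interval_observable_iff Q_def ..
  have "olson_le (dirac 0) (dirac 1)" by (auto simp: olson_le_def)
  then have dirac: "Q (dirac 0)" "Q (dirac 1)"
    unfolding Q_def using observable_dirac olson_le_refl by auto
  have bounded: "bounded_observable x" if "Q x" for x
    using that bounded_observable_between[OF bounded_dirac bounded_dirac] unfolding Q_def by blast
  have between: "Q y" if "Q x" "Q z" "observable y" "olson_le x y" "olson_le y z" for x y z
    using that olson_le_trans unfolding Q_def by blast
  let ?L = "olson_order Q"
  show least: "least unit_interval_observables (question_observable zero) (carrier unit_interval_observables)"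
    unfolding eq question_observable_zero least_def using dirac by (auto simp: Q_def)
  show greatest: "greatest unit_interval_observables (question_observable one) (carrier unit_interval_observables)"
    unfolding eq question_observable_one greatest_def using dirac by (auto simp: Q_def)
  interpret partial_order ?L
    by (rule partial_order_olson_order) (simp add: Q_def)
  have "Complete_Lattice.complete_lattice ?L"
  proof
    fix A assume A: "A \<subseteq> carrier ?L"
    show "\<exists>s. is_lub ?L s A"
    proof (cases "A = {}")
      case True
      then show ?thesis using least unfolding eq by auto
    next
      case False
      have bound: "dirac 1 \<in> Upper ?L A" using A dirac by (auto simp: Upper_def Q_def)
      show ?thesis
        by (rule ex_is_lub_olson_order[OF _ _ A False bound]) (erule bounded, erule (4) between)
    qed
    show "\<exists>s. is_glb ?L s A"
    proof (cases "A = {}")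
      case True
      then show ?thesis using greatest unfolding eq by auto
    next
      case False
      have bound: "dirac 0 \<in> Lower ?L A" using A dirac by (auto simp: Lower_def Q_def)
      show ?thesis
        by (rule ex_is_glb_olson_order[OF _ _ A False bound]) (erule bounded, erule (4) between)
    qed
  qed
  then show "Complete_Lattice.complete_lattice unit_interval_observables" unfolding eq .
qed

end

theorem theorem3p6:
  fixes psum :: "'a \<Rightarrow> 'a \<Rightarrow> 'a option" and zero one :: 'a
  assumes "complete_lattice_effect_algebra psum zero one"
  shows "dedekind_complete_lattice (effect_algebra.bounded_observables psum one) \<and>
    Complete_Lattice.complete_lattice (effect_algebra.unit_interval_observables psum one) \<and>
    least (effect_algebra.unit_interval_observables psum one)
      (effect_algebra.question_observable psum zero one zero)
      (carrier (effect_algebra.unit_interval_observables psum one)) \<and>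
    greatest (effect_algebra.unit_interval_observables psum one)
      (effect_algebra.question_observable psum zero one one)
      (carrier (effect_algebra.unit_interval_observables psum one))"
proof -
  interpret complete_lattice_effect_algebra psum zero one by (rule assms)
  show ?thesis
    using dedekind_complete_bounded_observables unit_interval_observables_complete by blast
qed

end
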